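(* For each $n\in\mathbb{Z}_{>0}$ and each $\rho=(\rho_1,\dots,\rho_n)$ with $0<\rho_1<\rho_2<\dots<\rho_n$ let $\mu^\rho=\nu^\rho\circ(\mathcal{D}^{(n)})^{-1}$ be the probability measure on $\mathcal{X}_n$ defined in the context. The probability measures $\mu^\rho$ are translation-ergodic and have the following properties. (Continuity.) The probability measure $\mu^\rho$ is weakly continuous as a function of $\rho$ on the set of vectors that satisfy $0<\rho_1<\rho_2<\dots<\rho_n$. (Consistency.) If $(\eta^1,\dots,\eta^n)\sim\mu^{(\rho_1,\dots,\rho_n)}$, then $(\eta^1,\dots,\eta^{j-1},\eta^{j+1},\dots,\eta^n)\sim\mu^{(\rho_1,\dots,\rho_{j-1},\rho_{j+1},\dots,\rho_n)}$ for all $j\in\{1,\dots,n\}$.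
   Context: Queueing map. For sequences $I=(I_k)_{k\in\mathbb{Z}}$ and $\omega=(\omega_k)_{k\in\mathbb{Z}}$ in $\mathbb{R}_{\ge0}^{\mathbb{Z}}$ with $\lim_{m\to-\infty}\sum_{i=m}^0(\omega_i-I_{i+1})=-\infty$, choose any $G:\mathbb{Z}\to\mathbb{R}$ with $I_k=G_k-G_{k-1}$, put $\widetilde G_\ell=\sup_{k\le\ell}\{G_k+\sum_{i=k}^\ell\omega_i\}$, and define $D(I,\omega)=\widetilde I$ by $\widetilde I_\ell=\widetilde G_\ell-\widetilde G_{\ell-1}$ (this does not depend on the choice of $G$). Iterated maps: $D^{(1)}(\zeta)=\zeta$ and $D^{(n)}(\zeta^1,\dots,\zeta^n)=D\bigl(D^{(n-1)}(\zeta^1,\dots,\zeta^{n-1}),\zeta^n\bigr)$ for $n\ge2$. Spaces. $\mathcal{Y}_n$ is the set of $I=(I^1,\dots,I^n)\in(\mathbb{R}_{\ge0}^{\mathbb{Z}})^n$ such that for all $i\in\{2,\dots,n\}$ the following limits exist and satisfy $\lim_{m\to-\infty}\frac1{|m|}\sum_{k=m}^0I^i_k>\lim_{m\to-\infty}\frac1{|m|}\sum_{k=m}^0I^{i-1}_k>0$. $\mathcal{X}_n$ is the set of $\eta=(\eta^1,\dots,\eta^n)\in(\mathbb{R}_{\ge0}^{\mathbb{Z}})^n$ such that $\eta^i\ge\eta^{i-1}$ coordinatewise for $i\in\{2,\dots,n\}$ and $\liminf_{m\to-\infty}\frac1{|m|}\sum_{k=m}^0\eta^1_k>0$. Both carry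 the product topology and Borel $\sigma$-algebra. The map $\mathcal{D}^{(n)}:\mathcal{Y}_n\to\mathcal{X}_n$, $\eta=\mathcal{D}^{(n)}(I)$, is defined by $\eta^i=D^{(i)}(I^i,I^{i-1},\dots,I^1)$ for $i=1,\dots,n$ (well-defined on $\mathcal{Y}_n$). For $\rho\in(0,\infty)^n$, $\nu^\rho$ is the distribution of $I=(I^1,\dots,I^n)$ under which all coordinates $I^i_k$ ($1\le i\le n$, $k\in\mathbb{Z}$) are independent and $I^i_k$ is exponential with mean $\rho_i$. When $0<\rho_1<\dots<\rho_n$, $\nu^\rho$ is supported on $\mathcal{Y}_n$, and $\mu^\rho=\nu^\rho\circ(\mathcal{D}^{(n)})^{-1}$ is the distribution of $\mathcal{D}^{(n)}(I)$ when $I\sim\nu^\rho$. Translations $\{\theta_\ell\}_{\ell\in\mathbb{Z}}$ act by $(\theta_\ell\eta)^i_k=\eta^i_{k+\ell}$. A probability measure $Q$ on $\mathcal{X}_n$ is translation-ergodic if it is invariant under $\{\theta_\ell\}$ and $Q(A)\in\{0,1\}$ for every Borel set $A\subset\mathcal{X}_n$ invariant under $\{\theta_\ell\}$. *)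

theory Defs
  imports "HOL-Probability.Probability"
begin

section \<open>Queueing map\<close>

text \<open>Real sequences indexed by the integers have type \<^typ>\<open>int \<Rightarrow> real\<close>. The first argument of
  the queueing map is the arrival sequence \<open>I\<close>, the second the service sequence \<open>\<omega>\<close>.\<close>

definition is_potential :: "(int \<Rightarrow> real) \<Rightarrow> (int \<Rightarrow> real) \<Rightarrow> bool" where
  "is_potential I G \<longleftrightarrow> (\<forall>k. I k = G k - G (k - 1))"

definition departures :: "(int \<Rightarrow> real) \<Rightarrow> (int \<Rightarrow> real) \<Rightarrow> int \<Rightarrow> real" where
  "departures G \<omega> l = (SUP k\<in>{..l}. G k + (\<Sum>i\<in>{k..l}. \<omega> i))"

definition queue_admissible :: "(int \<Rightarrow> real) \<Rightarrow> (int \<Rightarrow> real) \<Rightarrow> bool" where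
  "queue_admissible I \<omega> \<longleftrightarrow> filterlim (\<lambda>m::int. \<Sum>i\<in>{m..0}. \<omega> i - I (i + 1)) at_bot at_bot"

text \<open>The map is total; its value is meaningful only for admissible pairs, where the supremum is
  finite and the choice of the potential \<open>G\<close> is irrelevant (lemmas \<open>departures_bdd\<close> and
  \<open>queue_map_eq\<close> below).\<close>

definition queue_map :: "(int \<Rightarrow> real) \<Rightarrow> (int \<Rightarrow> real) \<Rightarrow> int \<Rightarrow> real" where
  "queue_map I \<omega> =
     (let G = (SOME G. is_potential I G) in (\<lambda>l. departures G \<omega> l - departures G \<omega> (l - 1)))"

lemma ex_potential: "\<exists>G. is_potential I G"
proof
  show "is_potential I (\<lambda>k. (\<Sum>i\<in>{1..k}. I i) - (\<Sum>i\<in>{k+1..0}. I i))"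
    unfolding is_potential_def
  proof
    fix k :: int
    show "I k = (\<Sum>i\<in>{1..k}. I i) - (\<Sum>i\<in>{k+1..0}. I i)
        - ((\<Sum>i\<in>{1..k-1}. I i) - (\<Sum>i\<in>{k-1+1..0}. I i))"
    proof (cases "k \<ge> 1")
      case True
      then have "{1..k} = insert k {1..k-1}" by auto
      with True show ?thesis by simp
    next
      case False
      then have "{k..0} = insert k {k+1..0}" by auto
      with False show ?thesis by simp
    qed
  qed
qed

lemma potential_sum:
  assumes "is_potential I G" "m \<le> (1::int)"
  shows "(\<Sum>i\<in>{m..0}. I (i + 1)) = G 1 - G m"
  using assms(2)
proof (induction m rule: int_le_induct)
  case base
  show ?case by simp
next
  case (step m)
  then have "{m-1..0} = insert (m-1) {m..0}" by auto
  then show ?case using step assms(1) by (simp add: is_potential_def)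
qed

lemma departures_bdd:
  assumes "queue_admissible I \<omega>" "is_potential I G"
  shows "bdd_above ((\<lambda>k. G k + (\<Sum>i\<in>{k..l}. \<omega> i)) ` {..l})"
proof -
  define S where "S m = (\<Sum>i\<in>{m..0}. \<omega> i - I (i + 1))" for m :: int
  have "eventually (\<lambda>m. S m \<le> 0) at_bot"
    using assms(1) unfolding queue_admissible_def S_def filterlim_at_bot by blast
  then obtain N where N: "\<And>m. m \<le> N \<Longrightarrow> S m \<le> 0"
    unfolding eventually_at_bot_linorder by blast
  define K where "K = min N (min 0 l)"
  define c where "c = G 1 + (\<Sum>i\<in>{1..l}. \<omega> i) - (\<Sum>i\<in>{l+1..0}. \<omega> i)"
  have low: "G k + (\<Sum>i\<in>{k..l}. \<omega> i) \<le> c" if k: "k \<le> K" for k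
  proof -
    have k': "k \<le> N" "k \<le> 0" "k \<le> l" using k by (auto simp: K_def)
    have eq: "(\<Sum>i\<in>{k..l}. \<omega> i) = (\<Sum>i\<in>{k..0}. \<omega> i) + (\<Sum>i\<in>{1..l}. \<omega> i) - (\<Sum>i\<in>{l+1..0}. \<omega> i)"
    proof (cases "l \<ge> 0")
      case True
      then have "{k..l} = {k..0} \<union> {1..l}" using k' by auto
      then have "(\<Sum>i\<in>{k..l}. \<omega> i) = (\<Sum>i\<in>{k..0}. \<omega> i) + (\<Sum>i\<in>{1..l}. \<omega> i)"
        by (simp add: sum.union_disjoint)
      with True show ?thesis by simp
    next
      case False
      then have "{k..0} = {k..l} \<union> {l+1..0}" using k' by auto
      then have "(\<Sum>i\<in>{k..0}. \<omega> i) = (\<Sum>i\<in>{k..l}. \<omega> i) + (\<Sum>i\<in>{l+1..0}. \<omega> i)"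
        by (simp add: sum.union_disjoint)
      with False show ?thesis by simp
    qed
    have "S k = (\<Sum>i\<in>{k..0}. \<omega> i) - (G 1 - G k)"
      using potential_sum[OF assms(2), of k] k' by (simp add: S_def sum_subtractf)
    with N[OF k'(1)] eq show ?thesis by (simp add: c_def)
  qed
  have "bdd_above ((\<lambda>k. G k + (\<Sum>i\<in>{k..l}. \<omega> i)) ` {..K})"
    using low by (intro bdd_aboveI[of _ c]) auto
  moreover have "bdd_above ((\<lambda>k. G k + (\<Sum>i\<in>{k..l}. \<omega> i)) ` {K..l})"
    by (intro bdd_above_finite finite_imageI) simp
  moreover have "{..l} = {..K} \<union> {K..l}" by (auto simp: K_def)
  ultimately show ?thesis by (simp add: image_Un)
qed

lemma potential_unique:
  assumes "is_potential I G" "is_potential I H"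
  shows "H k = G k + (H 0 - G 0)"
proof -
  have step: "H k - G k = H (k - 1) - G (k - 1)" for k
  proof -
    have "I k = G k - G (k - 1)" "I k = H k - H (k - 1)"
      using assms unfolding is_potential_def by blast+
    then show ?thesis by simp
  qed
  have "H k - G k = H 0 - G 0"
  proof (induction k rule: int_induct[where k = 0])
    case base
    show ?case by simp
  next
    case (step1 i)
    then show ?case using step[of "i + 1"] by simp
  next
    case (step2 i)
    then show ?case using step[of i] by simp
  qed
  then show ?thesis by simp
qed

lemma queue_map_eq:
  assumes adm: "queue_admissible I \<omega>" and G: "is_potential I G"
  shows "queue_map I \<omega> l = departures G \<omega> l - departures G \<omega> (l - 1)"
proof -
  define H where "H = (SOME G. is_potential I G)"
  have H: "is_potential I H" unfolding H_def using ex_potential by (rule someI_ex)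
  have eq: "departures H \<omega> m = departures G \<omega> m + (H 0 - G 0)" for m
  proof -
    have "departures H \<omega> m = (SUP k\<in>{..m}. (H 0 - G 0) + (G k + (\<Sum>i\<in>{k..m}. \<omega> i)))"
      unfolding departures_def
    proof (rule SUP_cong)
      fix k
      show "H k + (\<Sum>i\<in>{k..m}. \<omega> i) = (H 0 - G 0) + (G k + (\<Sum>i\<in>{k..m}. \<omega> i))"
        using potential_unique[OF G H, of k] by linarith
    qed simp
    also have "\<dots> = (H 0 - G 0) + departures G \<omega> m"
      unfolding departures_def using departures_bdd[OF adm G, of m]
      by (intro Sup_add_eq) auto
    finally show ?thesis by simp
  qed
  show ?thesis unfolding queue_map_def H_def[symmetric] Let_def by (simp add: eq)
qed

text \<open>\<open>queue_iter n \<zeta>\<close> is the iterated map applied to \<open>\<zeta> 1, \<dots>, \<zeta> n\<close>; the value at \<open>n = 0\<close> is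
  a dummy.\<close>

fun queue_iter :: "nat \<Rightarrow> (nat \<Rightarrow> int \<Rightarrow> real) \<Rightarrow> int \<Rightarrow> real" where
  "queue_iter 0 \<zeta> = (\<lambda>_. 0)"
| "queue_iter (Suc 0) \<zeta> = \<zeta> 1"
| "queue_iter (Suc (Suc n)) \<zeta> = queue_map (queue_iter (Suc n) \<zeta>) (\<zeta> (Suc (Suc n)))"


section \<open>Spaces\<close>

text \<open>An \<open>n\<close>-tuple is a function on \<^typ>\<open>nat\<close> that is extensional on \<open>{1..n}\<close>. The type
  \<^typ>\<open>nat \<Rightarrow> int \<Rightarrow> real\<close> carries the product topology, which induces on such a set of
  extensional functions the usual product topology over \<open>{1..n}\<close>.\<close>

definition nonneg_tuples :: "nat \<Rightarrow> (nat \<Rightarrow> int \<Rightarrow> real) set" where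
  "nonneg_tuples n = {1..n} \<rightarrow>\<^sub>E {x. \<forall>k. 0 \<le> x k}"

definition left_avg :: "(int \<Rightarrow> real) \<Rightarrow> int \<Rightarrow> real" where
  "left_avg x m = (1 / real_of_int \<bar>m\<bar>) * (\<Sum>k\<in>{m..0}. x k)"

definition Y_space :: "nat \<Rightarrow> (nat \<Rightarrow> int \<Rightarrow> real) set" where
  "Y_space n = {I \<in> nonneg_tuples n. \<forall>i\<in>{2..n}. \<exists>a b.
     (left_avg (I i) \<longlongrightarrow> a) at_bot \<and> (left_avg (I (i - 1)) \<longlongrightarrow> b) at_bot \<and> a > b \<and> b > 0}"

definition X_space :: "nat \<Rightarrow> (nat \<Rightarrow> int \<Rightarrow> real) set" where
  "X_space n = {\<eta> \<in> nonneg_tuples n. (\<forall>i\<in>{2..n}. \<forall>k. \<eta> i k \<ge> \<eta> (i - 1) k) \<and>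
     Liminf at_bot (\<lambda>m. ereal (left_avg (\<eta> 1) m)) > 0}"

abbreviation X_borel :: "nat \<Rightarrow> (nat \<Rightarrow> int \<Rightarrow> real) measure" where
  "X_borel n \<equiv> restrict_space borel (X_space n)"

definition multi_queue_map :: "nat \<Rightarrow> (nat \<Rightarrow> int \<Rightarrow> real) \<Rightarrow> nat \<Rightarrow> int \<Rightarrow> real" where
  "multi_queue_map n I = (\<lambda>i\<in>{1..n}. queue_iter i (\<lambda>j. I (i + 1 - j)))"


section \<open>Measures\<close>

definition increasing_means :: "nat \<Rightarrow> (nat \<Rightarrow> real) set" where
  "increasing_means n = {\<rho> \<in> {1..n} \<rightarrow>\<^sub>E {0<..}. strict_mono_on {1..n} \<rho>}"

text \<open>\<^const>\<open>exponential_density\<close> is parametrised by the rate, the reciprocal of the mean.\<close>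

definition nu :: "nat \<Rightarrow> (nat \<Rightarrow> real) \<Rightarrow> (nat \<Rightarrow> int \<Rightarrow> real) measure" where
  "nu n \<rho> = (\<Pi>\<^sub>M i\<in>{1..n}. \<Pi>\<^sub>M k\<in>(UNIV :: int set).
     density lborel (\<lambda>x. ennreal (exponential_density (1 / \<rho> i) x)))"

text \<open>The image of \<open>nu n \<rho>\<close> under \<open>multi_queue_map n\<close>, as a Borel measure on \<open>X_space n\<close>. The
  image is formed in the ambient space and then restricted, because for \<open>n = 1\<close> the set
  \<open>Y_space 1\<close> contains all nonnegative sequences, so that \<open>multi_queue_map 1\<close> takes values in
  \<open>X_space 1\<close> only almost surely.\<close>

definition mu :: "nat \<Rightarrow> (nat \<Rightarrow> real) \<Rightarrow> (nat \<Rightarrow> int \<Rightarrow> real) measure" where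
  "mu n \<rho> = restrict_space
     (distr (restrict_space (nu n \<rho>) (Y_space n)) borel (multi_queue_map n)) (X_space n)"

definition translate :: "nat \<Rightarrow> int \<Rightarrow> (nat \<Rightarrow> int \<Rightarrow> real) \<Rightarrow> nat \<Rightarrow> int \<Rightarrow> real" where
  "translate n l \<eta> = (\<lambda>i\<in>{1..n}. \<lambda>k. \<eta> i (k + l))"

definition translation_ergodic :: "nat \<Rightarrow> (nat \<Rightarrow> int \<Rightarrow> real) measure \<Rightarrow> bool" where
  "translation_ergodic n Q \<longleftrightarrow>
     prob_space Q \<and> sets Q = sets (X_borel n) \<and>
     (\<forall>l. distr Q (X_borel n) (translate n l) = Q) \<and>
     (\<forall>A\<in>sets (X_borel n). (\<forall>l. translate n l -` A \<inter> X_space n = A) \<longrightarrow> measure Q A \<in> {0, 1})"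

definition weakly_continuous_on ::
    "'p::topological_space set \<Rightarrow> 'a::topological_space set \<Rightarrow> ('p \<Rightarrow> 'a measure) \<Rightarrow> bool" where
  "weakly_continuous_on R X M \<longleftrightarrow>
     (\<forall>f :: 'a \<Rightarrow> real. continuous_on X f \<and> bounded (f ` X) \<longrightarrow>
        continuous_on R (\<lambda>r. \<integral>x. f x \<partial>M r))"

definition delete_coord :: "nat \<Rightarrow> nat \<Rightarrow> (nat \<Rightarrow> 'a) \<Rightarrow> nat \<Rightarrow> 'a" where
  "delete_coord n j v = (\<lambda>i\<in>{1..n - 1}. if i < j then v i else v (i + 1))"

end

theory Submission
  imports Defs
begin

text \<open>For arrivals \<open>I\<close> and services \<open>\<omega>\<close> let \<open>G\<close> and \<open>\<Omega>\<close> be their partial sums and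
  \<open>Z l\<close> the maximum of \<open>G k - \<Omega> (k - 1)\<close> over \<open>k \<le> l\<close>. The departure process \<open>D(I, \<omega>)\<close> has partial
  sums \<open>\<Omega> + Z\<close>, and the dual service process \<open>R(I, \<omega>)\<close> has partial sums \<open>G - Z\<close>.

  Ergodicity: the product measure is mixing and the multi-queue map commutes with translations.

  Continuity: realise \<open>\<nu>\<^sup>\<rho>\<close> as \<open>\<rho>\<^sub>i e\<^sub>i\<close> with \<open>e\<close> independent exponential of mean one. By the strong law the averages
  of these sequences converge uniformly for parameters near \<open>\<rho>\<close>. This uniformity passes through the queueing
  map, and it confines all maxima to a common finite window, where they depend continuously on \<open>\<rho>\<close>.

  Consistency: replacing adjacent lines \<open>(I\<^sub>j\<^sub>+\<^sub>1, I\<^sub>j)\<close> by \<open>(R, D)\<close> of this pair changes none of the later outputs, because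
  \<open>D(D(B, A), C) = D(D(B, R(A, C)), D(A, C))\<close>, and turns the output of line \<open>j + 1\<close> into that of line \<open>j\<close>.
  By Burke's theorem the effect on the law is to exchange the two means. Repeating this moves
  the mean to be deleted to the last line, which no other output uses.\<close>

section \<open>The queueing map as a running maximum\<close>

text \<open>A running maximum looks at the whole past: it exists only if the walk under it drifts to
  minus infinity, and pointwise convergence of the inputs does not make it converge. Both problems
  are governed by averages at minus infinity, and a stable queue passes the average of its arrivals
  on to its departures. Strictly ordered averages thus survive every server, and the pathwise
  statements are proved for fixed sequences with such averages; probability enters through the
  strong law, mixing and Burke's theorem. Behind Burke's theorem lies the equilibrium sojourn time,
  exponential with rate \<open>1 / a - 1 / b\<close> for services of mean \<open>a\<close> and
  arrivals of mean \<open>b\<close>: one step of the queue then maps three independent exponential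
  variables to three with the same laws. An exchange of means spoils the order of the averages: line
  \<open>j + 1\<close> now arrives faster than server \<open>j\<close> works, and its output has no
  meaning. This is harmless, because exactly that output is the one to be deleted.\<close>

definition psum :: "(int \<Rightarrow> real) \<Rightarrow> int \<Rightarrow> real" where
  "psum x k = (\<Sum>i\<in>{1..k}. x i) - (\<Sum>i\<in>{k+1..0}. x i)"

lemma psum_diff: "psum x k - psum x (k - 1) = x k"
proof (cases "k \<ge> 1")
  case True
  then have "{1..k} = insert k {1..k-1}" by auto
  with True show ?thesis by (simp add: psum_def)
next
  case False
  then have "{k..0} = insert k {k+1..0}" by auto
  with False show ?thesis by (simp add: psum_def)
qed

lemma is_potential_psum: "is_potential x (psum x)"
  by (simp add: is_potential_def psum_diff)

lemma psum_zero [simp]: "psum x 0 = 0"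
  by (simp add: psum_def)

lemma sum_interval_psum:
  assumes "k \<le> l + 1"
  shows "(\<Sum>i\<in>{k..l}. x i) = psum x l - psum x (k - 1)"
  using assms
proof (induction k rule: int_le_induct)
  case base
  show ?case by simp
next
  case (step k)
  then have "{k-1..l} = insert (k-1) {k..l}" by auto
  with step psum_diff[of x "k - 1"] show ?case by simp
qed

lemma psum_unique:
  assumes "\<And>k. x k = G k - G (k - 1)"
  shows "psum x k = G k - G 0"
  using potential_unique[of x G "psum x" k] assms is_potential_psum
  by (simp add: is_potential_def)

lemma psum_add: "psum (\<lambda>k. x (k + l)) m = psum x (m + l) - psum x l"
proof -
  have "x (k + l) = psum x (k + l) - psum x (k - 1 + l)" for k
    using psum_diff[of x "k + l"] by (simp add: add_diff_eq diff_add_eq)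
  then show ?thesis by (subst psum_unique[where G="\<lambda>k. psum x (k + l)"]) auto
qed

text \<open>Subtracting \<open>psum \<omega> l\<close> from the expression under the supremum in
  \<open>departures\<close> removes its dependence on \<open>l\<close>; this walk is what
  remains.\<close>

definition zdiff :: "(int \<Rightarrow> real) \<Rightarrow> (int \<Rightarrow> real) \<Rightarrow> int \<Rightarrow> real" where
  "zdiff I \<omega> k = psum I k - psum \<omega> (k - 1)"

text \<open>The supremum over all \<open>k \<le> l\<close> is written as a limit of finite maxima, so that it is
  measurable on the whole space, without a boundedness condition.\<close>

definition rmax :: "(int \<Rightarrow> real) \<Rightarrow> (int \<Rightarrow> real) \<Rightarrow> int \<Rightarrow> real" where
  "rmax I \<omega> l = lim (\<lambda>N. Max (zdiff I \<omega> ` {l - int N..l}))"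

definition qD :: "(int \<Rightarrow> real) \<Rightarrow> (int \<Rightarrow> real) \<Rightarrow> int \<Rightarrow> real" where
  "qD I \<omega> l = \<omega> l + (rmax I \<omega> l - rmax I \<omega> (l - 1))"

text \<open>The dual service process; customer \<open>l\<close> receives \<open>min (I l) (soj I \<omega> (l - 1))\<close>, see \<open>qR_soj\<close>.\<close>

definition qR :: "(int \<Rightarrow> real) \<Rightarrow> (int \<Rightarrow> real) \<Rightarrow> int \<Rightarrow> real" where
  "qR I \<omega> l = I l - (rmax I \<omega> l - rmax I \<omega> (l - 1))"

definition adm :: "(int \<Rightarrow> real) \<Rightarrow> (int \<Rightarrow> real) \<Rightarrow> bool" where
  "adm I \<omega> \<longleftrightarrow> filterlim (zdiff I \<omega>) at_bot at_bot"

text \<open>The sum in \<open>queue_admissible\<close> telescopes to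
  \<open>zdiff I \<omega> m\<close> minus the constant \<open>psum I 1\<close>.\<close>

lemma adm_iff_queue_admissible: "adm I \<omega> \<longleftrightarrow> queue_admissible I \<omega>"
proof -
  have "(\<Sum>i\<in>{m..0}. \<omega> i - I (i + 1)) = zdiff I \<omega> m - psum I 1" if "m \<le> 0" for m
    using that potential_sum[OF is_potential_psum, of m I] sum_interval_psum[of m 0 \<omega>]
    by (simp add: sum_subtractf zdiff_def)
  then have ev: "eventually (\<lambda>m. (\<Sum>i\<in>{m..0}. \<omega> i - I (i + 1)) = - psum I 1 + zdiff I \<omega> m) at_bot"
    by (intro eventually_at_bot_linorderI[of 0]) simp
  have 1: "queue_admissible I \<omega> \<longleftrightarrow> filterlim (\<lambda>m. - psum I 1 + zdiff I \<omega> m) at_bot at_bot"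
    unfolding queue_admissible_def by (rule filterlim_cong[OF refl refl ev])
  have shift: "filterlim (\<lambda>m. c + f m) at_bot F" if "filterlim f at_bot F"
    for c :: real and f and F :: "int filter"
    unfolding filterlim_at_bot
  proof
    fix Z
    have "\<forall>\<^sub>F x in F. f x \<le> Z - c" using that unfolding filterlim_at_bot by blast
    then show "\<forall>\<^sub>F x in F. c + f x \<le> Z" by eventually_elim simp
  qed
  show ?thesis
    unfolding 1 adm_def using shift[of "zdiff I \<omega>" at_bot "- psum I 1"]
      shift[of "\<lambda>m. - psum I 1 + zdiff I \<omega> m" at_bot "psum I 1"] by auto
qed

text \<open>The walk tends to minus infinity in the past, so far enough to the left it stays below
  its value at \<open>l\<close>; the finite maxima are then constant and the supremum is
  attained.\<close>

lemma rmax_max: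
  assumes "adm I \<omega>"
  shows "\<exists>k\<le>l. rmax I \<omega> l = zdiff I \<omega> k" and "k \<le> l \<Longrightarrow> zdiff I \<omega> k \<le> rmax I \<omega> l"
proof -
  let ?z = "zdiff I \<omega>"
  obtain K where K: "\<And>k. k \<le> K \<Longrightarrow> ?z k \<le> ?z l"
    using assms unfolding adm_def filterlim_at_bot eventually_at_bot_linorder by blast
  define K' where "K' = min K l"
  define m where "m = Max (?z ` {K'..l})"
  have ne: "?z ` {K'..l} \<noteq> {}" by (auto simp: K'_def)
  have m_in: "m \<in> ?z ` {K'..l}" unfolding m_def by (rule Max_in) (use ne in auto)
  have lm: "?z l \<le> m" unfolding m_def by (rule Max_ge) (auto simp: K'_def)
  have ub: "?z k \<le> m" if "k \<le> l" for k
  proof (cases "k \<le> K'")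
    case True
    then show ?thesis using K[of k] lm by (auto simp: K'_def)
  next
    case False
    then show ?thesis using that unfolding m_def by (intro Max_ge) auto
  qed
  have "Max (?z ` {l - int N..l}) = m" if "N \<ge> nat (l - K')" for N
  proof (rule Max_eqI)
    have "{K'..l} \<subseteq> {l - int N..l}" using that by auto
    then show "m \<in> ?z ` {l - int N..l}" using m_in by blast
  qed (use ub in auto)
  then have "eventually (\<lambda>N. Max (?z ` {l - int N..l}) = m) sequentially"
    by (intro eventually_sequentiallyI)
  then have "(\<lambda>N. Max (?z ` {l - int N..l})) \<longlonglongrightarrow> m" by (rule tendsto_eventually)
  then have eq: "rmax I \<omega> l = m" unfolding rmax_def by (rule limI)
  show "\<exists>k\<le>l. rmax I \<omega> l = ?z k" using m_in eq by auto
  show "k \<le> l \<Longrightarrow> ?z k \<le> rmax I \<omega> l" using ub eq by simp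
qed

lemma rmax_eqI:
  assumes "adm I \<omega>" "k \<le> l" "zdiff I \<omega> k = m" "\<And>k. k \<le> l \<Longrightarrow> zdiff I \<omega> k \<le> m"
  shows "rmax I \<omega> l = m"
proof -
  obtain j where "j \<le> l" "rmax I \<omega> l = zdiff I \<omega> j" using rmax_max(1)[OF assms(1)] by blast
  with assms(4)[of j] rmax_max(2)[OF assms(1,2)] assms(3) show ?thesis by simp
qed

lemma rmax_step:
  assumes "adm I \<omega>"
  shows "rmax I \<omega> l = max (rmax I \<omega> (l - 1)) (zdiff I \<omega> l)"
proof -
  obtain j where j: "j \<le> l - 1" "rmax I \<omega> (l - 1) = zdiff I \<omega> j" using rmax_max(1)[OF assms] by blast
  have le: "zdiff I \<omega> k \<le> max (rmax I \<omega> (l - 1)) (zdiff I \<omega> l)" if "k \<le> l" for k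
    using rmax_max(2)[OF assms, of k "l - 1"] that by (cases "k = l") auto
  show ?thesis
  proof (cases "rmax I \<omega> (l - 1) \<le> zdiff I \<omega> l")
    case True
    then show ?thesis using le by (intro rmax_eqI[OF assms, of l]) auto
  next
    case False
    then show ?thesis using le j by (intro rmax_eqI[OF assms, of j]) auto
  qed
qed

section \<open>Agreement with the queueing map on admissible pairs\<close>

lemma departures_eq:
  assumes "adm I \<omega>" "is_potential I G"
  shows "departures G \<omega> l = G 0 + psum \<omega> l + rmax I \<omega> l"
proof -
  have eq: "G k + (\<Sum>i\<in>{k..l}. \<omega> i) = G 0 + psum \<omega> l + zdiff I \<omega> k" if "k \<le> l" for k
    using potential_unique[OF is_potential_psum assms(2), of k] sum_interval_psum[of k l \<omega>] that
    by (simp add: zdiff_def)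
  obtain j where j: "j \<le> l" "rmax I \<omega> l = zdiff I \<omega> j" using rmax_max(1)[OF assms(1)] by blast
  show ?thesis unfolding departures_def
  proof (rule cSup_eq_maximum)
    show "G 0 + psum \<omega> l + rmax I \<omega> l \<in> (\<lambda>k. G k + (\<Sum>i\<in>{k..l}. \<omega> i)) ` {..l}"
      using j eq[of j] by (intro image_eqI[of _ _ j]) auto
  next
    fix y assume "y \<in> (\<lambda>k. G k + (\<Sum>i\<in>{k..l}. \<omega> i)) ` {..l}"
    then show "y \<le> G 0 + psum \<omega> l + rmax I \<omega> l"
      using eq rmax_max(2)[OF assms(1)] by auto
  qed
qed

lemma queue_map_eq_qD:
  assumes "adm I \<omega>"
  shows "queue_map I \<omega> = qD I \<omega>"
proof
  fix l
  have "queue_map I \<omega> l = departures (psum I) \<omega> l - departures (psum I) \<omega> (l - 1)"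
    using assms is_potential_psum adm_iff_queue_admissible by (intro queue_map_eq) auto
  then show "queue_map I \<omega> l = qD I \<omega> l"
    using psum_diff[of \<omega> l] by (simp add: departures_eq[OF assms is_potential_psum] qD_def)
qed

lemma psum_qD: "psum (qD I \<omega>) k = psum \<omega> k + rmax I \<omega> k - rmax I \<omega> 0"
proof -
  have "qD I \<omega> k = (psum \<omega> k + rmax I \<omega> k) - (psum \<omega> (k - 1) + rmax I \<omega> (k - 1))" for k
    using psum_diff[of \<omega> k] by (simp add: qD_def)
  then show ?thesis by (subst psum_unique[where G="\<lambda>k. psum \<omega> k + rmax I \<omega> k"]) auto
qed

lemma psum_qR: "psum (qR I \<omega>) k = psum I k - rmax I \<omega> k + rmax I \<omega> 0"
proof -
  have "qR I \<omega> k = (psum I k - rmax I \<omega> k) - (psum I (k - 1) - rmax I \<omega> (k - 1))" for k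
    using psum_diff[of I k] by (simp add: qR_def)
  then show ?thesis by (subst psum_unique[where G="\<lambda>k. psum I k - rmax I \<omega> k"]) auto
qed

text \<open>The sojourn time of customer \<open>l\<close>: departure time
  \<open>psum \<omega> l + rmax I \<omega> l\<close> minus arrival time
  \<open>psum I l\<close>.\<close>

definition soj :: "(int \<Rightarrow> real) \<Rightarrow> (int \<Rightarrow> real) \<Rightarrow> int \<Rightarrow> real" where
  "soj I \<omega> l = psum \<omega> l - psum I l + rmax I \<omega> l"

text \<open>Lindley's recursion: what is left of the previous sojourn after the interarrival time is
  the waiting time, to which the service is added.\<close>

lemma soj_step:
  assumes "adm I \<omega>"
  shows "soj I \<omega> l = \<omega> l + max 0 (soj I \<omega> (l - 1) - I l)"
  using rmax_step[OF assms, of l] psum_diff[of I l] psum_diff[of \<omega> l]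
  by (auto simp: soj_def zdiff_def max_def)

text \<open>The second summand is the idle time of the server. Together with \<open>soj_step\<close>
  and \<open>qR_soj\<close> this makes one step of the queue a function of \<open>I l\<close>,
  \<open>\<omega> l\<close> and the previous sojourn time only.\<close>

lemma qD_soj:
  assumes "adm I \<omega>"
  shows "qD I \<omega> l = \<omega> l + max 0 (I l - soj I \<omega> (l - 1))"
  using rmax_step[OF assms, of l] psum_diff[of I l]
  by (auto simp: soj_def zdiff_def max_def qD_def)

lemma qR_soj:
  assumes "adm I \<omega>"
  shows "qR I \<omega> l = min (I l) (soj I \<omega> (l - 1))"
  using rmax_step[OF assms, of l] psum_diff[of I l]
  by (auto simp: soj_def zdiff_def max_def qR_def)

lemma qD_ge: "adm I \<omega> \<Longrightarrow> \<omega> l \<le> qD I \<omega> l"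
  by (simp add: qD_soj)

text \<open>The sojourn time is the largest value over \<open>k \<le> l\<close> of the services in
  \<open>{k..l}\<close> minus the interarrival times in \<open>{k+1..l}\<close>; longer interarrival
  times lower each candidate. The comparison is made at the maximiser for \<open>I'\<close>.\<close>

lemma soj_antimono:
  assumes "adm I \<omega>" "adm I' \<omega>" "\<And>k. I k \<le> I' k"
  shows "soj I' \<omega> l \<le> soj I \<omega> l"
proof -
  obtain k where k: "k \<le> l" "rmax I' \<omega> l = zdiff I' \<omega> k" using rmax_max(1)[OF assms(2)] by blast
  have "zdiff I \<omega> k \<le> rmax I \<omega> l" using rmax_max(2)[OF assms(1) k(1)] .
  moreover have "psum I l - psum I k \<le> psum I' l - psum I' k"
  proof -
    have "(\<Sum>i\<in>{k+1..l}. I i) \<le> (\<Sum>i\<in>{k+1..l}. I' i)" by (intro sum_mono assms(3))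
    then show ?thesis using k(1) by (simp add: sum_interval_psum)
  qed
  ultimately show ?thesis using k(2) by (simp add: soj_def zdiff_def)
qed

lemma qD_mono:
  assumes "adm I \<omega>" "adm I' \<omega>" "\<And>k. I k \<le> I' k"
  shows "qD I \<omega> l \<le> qD I' \<omega> l"
  using soj_antimono[OF assms, of "l - 1"] assms(3)[of l] by (simp add: qD_soj[OF assms(1)] qD_soj[OF assms(2)])

text \<open>The two-line last-passage value is invariant under replacing the pair \<open>(A, C)\<close> by
  \<open>(qR A C, qD A C)\<close>. The invariance reduces to this identity between running maxima.\<close>

lemma Pitman_max_identity:
  fixes z Z :: "int \<Rightarrow> real"
  assumes Z: "\<And>m. Z m = max (Z (m - 1)) (z m)" and "k \<le> l"
  shows "Max (z ` {k..l}) = Z (k - 1) + Z l + Max ((\<lambda>m. z m - Z m - Z (m - 1)) ` {k..l}) \<and>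
    Z l = max (Z (k - 1)) (Max (z ` {k..l}))"
  using assms(2)
proof (induction l rule: int_ge_induct)
  case base
  then show ?case using Z[of k] by simp
next
  case (step l)
  have ins: "{k..l + 1} = insert (l + 1) {k..l}" using step(1) by auto
  have ne: "f ` {k..l} \<noteq> {}" for f :: "int \<Rightarrow> real" using step(1) by auto
  have M: "Max (f ` {k..l+1}) = max (f (l + 1)) (Max (f ` {k..l}))" for f :: "int \<Rightarrow> real"
    unfolding ins image_insert by (rule Max_insert) (use ne in auto)
  \<comment> \<open>The cases are whether the new value \<open>z'\<close> is a record of
    \<open>Z\<close>; the second half of the induction hypothesis relates \<open>Zl\<close> to
    \<open>M\<close>.\<close>
  have key: "max z' M = Z0 + Z1 + max (z' - Z1 - Zl) N \<and> Z1 = max Z0 (max z' M)"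
    if "M = Z0 + Zl + N" "Zl = max Z0 M" "Z1 = max Zl z'" for z' M N Z0 Z1 Zl :: real
  proof (cases "z' \<le> Zl")
    case True
    with that show ?thesis by linarith
  next
    case False
    with that show ?thesis by linarith
  qed
  have "Z (l + 1) = max (Z l) (z (l + 1))" using Z[of "l + 1"] by simp
  from key[OF conjunct1[OF step(2)] conjunct2[OF step(2)] this] show ?case
    unfolding M add_diff_cancel_right' .
qed

text \<open>Unfolding the two running maxima gives last passage through three rows: a path follows
  \<open>B\<close> up to \<open>k\<close>, \<open>A\<close> from \<open>k\<close> to
  \<open>m\<close> and \<open>C\<close> from \<open>m\<close> to \<open>l\<close>. The value is
  attained and is an upper bound; \<open>rmax B A 0\<close> compensates for the normalisation of
  \<open>psum (qD B A)\<close> at 0.\<close>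

lemma tandem_rmax:
  assumes BA: "adm B A" and BAC: "adm (qD B A) C"
  shows "\<exists>k m. k \<le> m \<and> m \<le> l \<and> psum C l + rmax (qD B A) C l + rmax B A 0 =
      psum B k - psum A (k - 1) + psum A m - psum C (m - 1) + psum C l"
    and "k \<le> m \<Longrightarrow> m \<le> l \<Longrightarrow> psum B k - psum A (k - 1) + psum A m - psum C (m - 1) + psum C l
      \<le> psum C l + rmax (qD B A) C l + rmax B A 0"
proof -
  obtain m where m: "m \<le> l" "rmax (qD B A) C l = zdiff (qD B A) C m" using rmax_max(1)[OF BAC] by blast
  obtain k where k: "k \<le> m" "rmax B A m = zdiff B A k" using rmax_max(1)[OF BA] by blast
  have "psum C l + rmax (qD B A) C l + rmax B A 0 =
      psum B k - psum A (k - 1) + psum A m - psum C (m - 1) + psum C l"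
    unfolding m(2) zdiff_def[of "qD B A"] psum_qD[of B] k(2) by (simp add: zdiff_def)
  with m(1) k(1) show "\<exists>k m. k \<le> m \<and> m \<le> l \<and> psum C l + rmax (qD B A) C l + rmax B A 0 =
      psum B k - psum A (k - 1) + psum A m - psum C (m - 1) + psum C l" by blast
next
  assume "k \<le> m" "m \<le> l"
  then show "psum B k - psum A (k - 1) + psum A m - psum C (m - 1) + psum C l
      \<le> psum C l + rmax (qD B A) C l + rmax B A 0"
    using rmax_max(2)[OF BAC, of m l] rmax_max(2)[OF BA, of k m]
    unfolding zdiff_def[of "qD B A"] psum_qD[of B] by (simp add: zdiff_def)
qed

text \<open>For fixed \<open>k\<close> and \<open>l\<close> only the maxima over \<open>m\<close>
  agree, not the terms themselves; hence two inequalities, in each of which the maximising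
  \<open>m\<close> is replaced by another one while \<open>k\<close> is kept.\<close>

lemma qD_interchange:
  assumes AC: "adm A C" and BA: "adm B A" and BAC: "adm (qD B A) C"
    and BR: "adm B (qR A C)" and BRD: "adm (qD B (qR A C)) (qD A C)"
  shows "qD (qD B A) C = qD (qD B (qR A C)) (qD A C)"
proof -
  let ?R = "qR A C" and ?D = "qD A C"
  let ?z = "zdiff A C" and ?Z = "rmax A C"
  let ?F = "\<lambda>k m l. psum B k - psum A (k - 1) + psum A m - psum C (m - 1) + psum C l"
  let ?F' = "\<lambda>k m l. psum B k - psum ?R (k - 1) + psum ?R m - psum ?D (m - 1) + psum ?D l"
  note dep = tandem_rmax[OF BA BAC] and dep' = tandem_rmax[OF BR BRD]
  \<comment> \<open>The row \<open>B\<close> enters both values only through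
    \<open>psum B k - psum A (k - 1)\<close>; what depends on \<open>m\<close> is one side of
    \<open>Pitman_max_identity\<close> for the walk \<open>?z\<close>.\<close>
  have F: "?F k m l = psum B k - psum A (k - 1) + psum C l + ?z m"
    and F': "?F' k m l = psum B k - psum A (k - 1) + psum C l + (?Z (k - 1) + ?Z l + (?z m - ?Z m - ?Z (m - 1)))" for k m l
    by (simp_all add: psum_qD psum_qR zdiff_def)
  have ident: "Max (?z ` {k..l}) = ?Z (k - 1) + ?Z l + Max ((\<lambda>m. ?z m - ?Z m - ?Z (m - 1)) ` {k..l})"
    if "k \<le> l" for k l
    using Pitman_max_identity[of ?Z ?z k l] rmax_step[OF AC] that by blast
  have maxE: "\<exists>m\<in>{k..l}. Max (f ` {k..l}) = f m" if "k \<le> l" for f :: "int \<Rightarrow> real" and k l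
  proof -
    have "Max (f ` {k..l}) \<in> f ` {k..l}" using that by (intro Max_in) auto
    then show ?thesis by auto
  qed
  have same: "psum C l + rmax (qD B A) C l + rmax B A 0 = psum ?D l + rmax (qD B ?R) ?D l + rmax B ?R 0" for l
  proof (rule antisym)
    obtain k m where km: "k \<le> m" "m \<le> l" "psum C l + rmax (qD B A) C l + rmax B A 0 = ?F k m l" using dep(1) by blast
    obtain m' where m': "m' \<in> {k..l}" "Max ((\<lambda>m. ?z m - ?Z m - ?Z (m - 1)) ` {k..l}) = ?z m' - ?Z m' - ?Z (m' - 1)"
      using maxE[of k l "\<lambda>m. ?z m - ?Z m - ?Z (m - 1)"] km by auto
    have "?z m \<le> Max (?z ` {k..l})" using km by (intro Max_ge) auto
    then have "?F k m l \<le> ?F' k m' l" unfolding F F' using ident[of k l] km m'(2) by linarith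
    with dep'(2)[of k m' l] m'(1) km(3)
    show "psum C l + rmax (qD B A) C l + rmax B A 0 \<le> psum ?D l + rmax (qD B ?R) ?D l + rmax B ?R 0" by auto
  next
    obtain k m where km: "k \<le> m" "m \<le> l" "psum ?D l + rmax (qD B ?R) ?D l + rmax B ?R 0 = ?F' k m l" using dep'(1) by blast
    obtain m' where m': "m' \<in> {k..l}" "Max (?z ` {k..l}) = ?z m'" using maxE[of k l ?z] km by auto
    have "?z m - ?Z m - ?Z (m - 1) \<le> Max ((\<lambda>m. ?z m - ?Z m - ?Z (m - 1)) ` {k..l})"
      using km by (intro Max_ge) auto
    then have "?F' k m l \<le> ?F k m' l" unfolding F F' using ident[of k l] km m'(2) by linarith
    with dep(2)[of k m' l] m'(1) km(3)
    show "psum ?D l + rmax (qD B ?R) ?D l + rmax B ?R 0 \<le> psum C l + rmax (qD B A) C l + rmax B A 0" by auto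
  qed
  show ?thesis
  proof
    fix l
    \<comment> \<open>The normalising constants \<open>rmax B A 0\<close> and
      \<open>rmax B ?R 0\<close> cancel in the increment from \<open>l - 1\<close> to
      \<open>l\<close>.\<close>
    show "qD (qD B A) C l = qD (qD B ?R) ?D l"
      using same[of l] same[of "l - 1"] psum_diff[of C l] psum_diff[of ?D l]
      unfolding qD_def[of "qD B A"] qD_def[of "qD B ?R"] by linarith
  qed
qed

section \<open>Averages\<close>

text \<open>For \<open>m < 0\<close> numerator and denominator both carry a minus sign, so this is
  the average over \<open>{m+1..0}\<close>; \<open>left_avg\<close> uses the window
  \<open>{m..0}\<close>.\<close>

definition has_avg :: "(int \<Rightarrow> real) \<Rightarrow> real \<Rightarrow> bool" where
  "has_avg x a \<longleftrightarrow> ((\<lambda>m. psum x m / real_of_int m) \<longlongrightarrow> a) at_bot"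

text \<open>Convergence along the product filter says that the averages converge uniformly over the
  members of the family that are close to the limit of \<open>F\<close>.\<close>

definition uavg :: "'r filter \<Rightarrow> ('r \<Rightarrow> int \<Rightarrow> real) \<Rightarrow> real \<Rightarrow> bool" where
  "uavg F x a \<longleftrightarrow> ((\<lambda>(r, m). psum (x r) m / real_of_int m) \<longlongrightarrow> a) (F \<times>\<^sub>F at_bot)"

text \<open>The property that a queue reproduces (\<open>cavg_qD\<close>), so that an induction
  along a tandem can carry it; pointwise convergence alone is lost at the first maximum over an
  infinite past.\<close>

definition cavg :: "'r filter \<Rightarrow> ('r \<Rightarrow> int \<Rightarrow> real) \<Rightarrow> (int \<Rightarrow> real) \<Rightarrow> real \<Rightarrow> bool" where
  "cavg F x x' a \<longleftrightarrow> uavg F x a \<and> has_avg x' a \<and> (\<forall>k. ((\<lambda>r. x r k) \<longlongrightarrow> x' k) F)"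

section \<open>Limits at minus infinity over the integers\<close>

lemma filterlim_real_of_int_at_bot: "filterlim real_of_int at_bot at_bot"
  unfolding filterlim_at_bot
proof
  fix Z :: real
  show "\<forall>\<^sub>F x in at_bot. real_of_int x \<le> Z"
    by (intro eventually_at_bot_linorderI[of "\<lfloor>Z\<rfloor>"]) linarith
qed

lemma tendsto_divide_int_at_bot: "((\<lambda>m. c / real_of_int m) \<longlongrightarrow> 0) at_bot"
  by (intro tendsto_divide_0[OF tendsto_const] filterlim_at_bot_imp_at_infinity filterlim_real_of_int_at_bot)

lemma tendsto_shift_ratio: "((\<lambda>m. real_of_int (m + c) / real_of_int m) \<longlongrightarrow> 1) at_bot"
proof -
  have "((\<lambda>m. 1 + real_of_int c / real_of_int m) \<longlongrightarrow> 1 + 0) at_bot"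
    by (intro tendsto_add tendsto_const tendsto_divide_int_at_bot)
  moreover have "eventually (\<lambda>m. 1 + real_of_int c / real_of_int m = real_of_int (m + c) / real_of_int m) at_bot"
    by (intro eventually_at_bot_linorderI[of "-1"]) (simp add: field_simps)
  ultimately show ?thesis by (simp add: tendsto_cong)
qed

lemma filterlim_shift_at_bot: "filterlim (\<lambda>m::int. m + c) at_bot at_bot"
  unfolding filterlim_at_bot
proof
  fix Z :: int
  show "\<forall>\<^sub>F m in at_bot. m + c \<le> Z" by (intro eventually_at_bot_linorderI[of "Z - c"]) simp
qed

lemma left_avg_psum: "m < 0 \<Longrightarrow> left_avg x m = psum x (m - 1) / real_of_int m"
  by (simp add: left_avg_def sum_interval_psum)

lemma left_avg_iff_has_avg: "(left_avg x \<longlongrightarrow> a) at_bot \<longleftrightarrow> has_avg x a"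
proof
  assume "(left_avg x \<longlongrightarrow> a) at_bot"
  then have "((\<lambda>m. left_avg x (m + 1) * (real_of_int (m + 1) / real_of_int m)) \<longlongrightarrow> a * 1) at_bot"
    by (intro tendsto_mult tendsto_shift_ratio filterlim_compose[OF _ filterlim_shift_at_bot])
  moreover have "eventually (\<lambda>m. left_avg x (m + 1) * (real_of_int (m + 1) / real_of_int m) = psum x m / real_of_int m) at_bot"
    by (intro eventually_at_bot_linorderI[of "-2"]) (simp add: left_avg_psum)
  ultimately show "has_avg x a" unfolding has_avg_def mult_1_right by (rule Lim_transform_eventually)
next
  assume "has_avg x a"
  then have "((\<lambda>m. psum x (m + (-1)) / real_of_int (m + (-1)) * (real_of_int (m + (-1)) / real_of_int m)) \<longlongrightarrow> a * 1) at_bot"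
    unfolding has_avg_def
    by (intro tendsto_mult tendsto_shift_ratio filterlim_compose[OF _ filterlim_shift_at_bot])
  moreover have "eventually (\<lambda>m. psum x (m + (-1)) / real_of_int (m + (-1)) * (real_of_int (m + (-1)) / real_of_int m) = left_avg x m) at_bot"
    by (intro eventually_at_bot_linorderI[of "-2"]) (simp add: left_avg_psum)
  ultimately show "(left_avg x \<longlongrightarrow> a) at_bot" unfolding mult_1_right by (rule Lim_transform_eventually)
qed

text \<open>The principal filter at one point makes a single sequence a constant family, so facts on
  \<open>has_avg\<close> become special cases of those on \<open>uavg\<close>.\<close>

lemma has_avg_iff_uavg: "has_avg x a \<longleftrightarrow> uavg (principal {()}) (\<lambda>_. x) a"
  by (simp add: has_avg_def uavg_def prod_filter_principal_singleton filterlim_filtermap)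

lemma has_avg_iff_cavg: "has_avg x a \<longleftrightarrow> cavg (principal {()}) (\<lambda>_. x) x a"
  by (auto simp: cavg_def has_avg_iff_uavg)

lemma uavg_zdiff:
  assumes "uavg F I b" "uavg F \<omega> a"
  shows "((\<lambda>(r, m). zdiff (I r) (\<omega> r) m / real_of_int m) \<longlongrightarrow> b - a) (F \<times>\<^sub>F at_bot)"
proof -
  have sh: "filterlim (\<lambda>p. (fst p, snd p + (-1))) (F \<times>\<^sub>F at_bot) (F \<times>\<^sub>F (at_bot :: int filter))"
    by (intro filterlim_Pair filterlim_fst filterlim_compose[OF filterlim_shift_at_bot filterlim_snd])
  have rat: "((\<lambda>p. real_of_int (snd p + (-1)) / real_of_int (snd p)) \<longlongrightarrow> 1) (F \<times>\<^sub>F at_bot)"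
    by (rule filterlim_compose[OF tendsto_shift_ratio filterlim_snd])
  \<comment> \<open>The factor \<open>(m - 1) / m\<close> accounts for the index
    \<open>k - 1\<close> of the services in \<open>zdiff\<close>.\<close>
  have "((\<lambda>p. psum (I (fst p)) (snd p) / real_of_int (snd p) -
      psum (\<omega> (fst p)) (snd p + (-1)) / real_of_int (snd p + (-1)) *
      (real_of_int (snd p + (-1)) / real_of_int (snd p))) \<longlongrightarrow> b - a * 1) (F \<times>\<^sub>F at_bot)"
    using assms(1) filterlim_compose[OF assms(2)[unfolded uavg_def] sh] unfolding uavg_def
    by (intro tendsto_diff tendsto_mult rat) (auto simp: case_prod_unfold)
  moreover have "eventually (\<lambda>p. snd p \<le> -2) (F \<times>\<^sub>F (at_bot::int filter))"
    using eventually_le_at_bot filterlim_snd by (rule eventually_compose_filterlim)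
  then have "eventually (\<lambda>p. psum (I (fst p)) (snd p) / real_of_int (snd p) -
      psum (\<omega> (fst p)) (snd p + (-1)) / real_of_int (snd p + (-1)) *
      (real_of_int (snd p + (-1)) / real_of_int (snd p)) =
     (case p of (r, m) \<Rightarrow> zdiff (I r) (\<omega> r) m / real_of_int m)) (F \<times>\<^sub>F at_bot)"
  proof eventually_elim
    case (elim p)
    have "A / m - B / n * (n / m) = (A - B) / m" if "n \<noteq> 0" for A B m n :: real
      using that by (simp add: diff_divide_distrib)
    with elim show ?case
      by (simp add: zdiff_def case_prod_unfold) (rule diff_divide_distrib[symmetric])
  qed
  ultimately show ?thesis unfolding mult_1_right by (rule Lim_transform_eventually)
qed

text \<open>As \<open>m\<close> is negative, the larger slope \<open>b - a + e\<close> gives the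
  lower bound. One cutoff \<open>N\<close> serves all members of the family near the limit.\<close>

lemma uavg_zdiff_bound:
  assumes "uavg F I b" "uavg F \<omega> a" "e > 0"
  shows "\<exists>N<0. \<forall>\<^sub>F r in F. \<forall>m\<le>N. (b - a + e) * real_of_int m < zdiff (I r) (\<omega> r) m \<and>
    zdiff (I r) (\<omega> r) m < (b - a - e) * real_of_int m"
proof -
  have "\<forall>\<^sub>F p in F \<times>\<^sub>F at_bot. dist (case p of (r, m) \<Rightarrow> zdiff (I r) (\<omega> r) m / real_of_int m) (b - a) < e"
    using uavg_zdiff[OF assms(1,2)] assms(3) by (rule tendstoD)
  then obtain Pf Pg where P: "eventually Pf F" "eventually Pg at_bot"
    "\<And>r m. Pf r \<Longrightarrow> Pg m \<Longrightarrow> dist (zdiff (I r) (\<omega> r) m / real_of_int m) (b - a) < e"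
    unfolding eventually_prod_filter by auto
  from P(2) obtain N0 where N0: "\<And>m. m \<le> N0 \<Longrightarrow> Pg m" unfolding eventually_at_bot_linorder by blast
  define N where "N = min N0 (-1)"
  have "(b - a + e) * real_of_int m < zdiff (I r) (\<omega> r) m \<and>
    zdiff (I r) (\<omega> r) m < (b - a - e) * real_of_int m" if "Pf r" "m \<le> N" for r m
  proof -
    have "m < 0" using that by (simp add: N_def)
    moreover have "\<bar>zdiff (I r) (\<omega> r) m / real_of_int m - (b - a)\<bar> < e"
      using P(3)[OF that(1) N0, of m] that(2) by (simp add: N_def dist_real_def)
    then have "b - a - e < zdiff (I r) (\<omega> r) m / real_of_int m" "zdiff (I r) (\<omega> r) m / real_of_int m < b - a + e"
      by linarith+
    ultimately show ?thesis by (simp add: field_simps)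
  qed
  then show ?thesis using eventually_mono[OF P(1)] by (intro exI[of _ N]) (auto simp: N_def)
qed

lemma adm_of_linear_bound:
  assumes "d > 0" "\<And>m. m \<le> N \<Longrightarrow> zdiff I \<omega> m < d * real_of_int m"
  shows "adm I \<omega>"
  unfolding adm_def filterlim_at_bot
proof
  fix Z
  have "filterlim (\<lambda>m. d * real_of_int m) at_bot at_bot"
    using assms(1) filterlim_real_of_int_at_bot by (rule filterlim_tendsto_pos_mult_at_bot[OF tendsto_const])
  then have "\<forall>\<^sub>F m in at_bot. d * real_of_int m \<le> Z" by (simp add: filterlim_at_bot)
  with eventually_le_at_bot[of N] show "\<forall>\<^sub>F m in at_bot. zdiff I \<omega> m \<le> Z"
    by eventually_elim (use assms(2) in force)
qed

lemma has_avg_adm: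
  assumes "has_avg I b" "has_avg \<omega> a" "a < b"
  shows "adm I \<omega>"
proof -
  from uavg_zdiff_bound[OF assms(1,2)[unfolded has_avg_iff_uavg], of "(b - a) / 2"] assms(3)
  obtain N where "\<And>m. m \<le> N \<Longrightarrow> zdiff I \<omega> m < (b - a - (b - a) / 2) * real_of_int m"
    by (auto simp: eventually_principal)
  with assms(3) show ?thesis by (intro adm_of_linear_bound[of "b - a - (b - a) / 2" N]) auto
qed

text \<open>The running maximum is trapped between the same two lines as the walk: it is at least
  the walk at \<open>m\<close>, and its maximiser \<open>k \<le> m\<close> lies below the upper
  line, which increases.\<close>

lemma uavg_rmax:
  assumes "uavg F I b" "uavg F \<omega> a" "a < b"
  shows "((\<lambda>(r, m). rmax (I r) (\<omega> r) m / real_of_int m) \<longlongrightarrow> b - a) (F \<times>\<^sub>F at_bot)"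
proof (rule tendstoI)
  fix e :: real assume "e > 0"
  \<comment> \<open>The bound \<open>(b - a) / 2\<close> keeps the slope \<open>b - a - e'\<close>
    positive.\<close>
  define e' where "e' = min e ((b - a) / 2)"
  have e': "e' > 0" "e' \<le> e" "b - a - e' > 0"
    using \<open>e > 0\<close> assms(3) unfolding e'_def by (auto simp: min_def field_simps)
  obtain N where N: "N < 0" and ev: "\<forall>\<^sub>F r in F. \<forall>m\<le>N. (b - a + e') * real_of_int m < zdiff (I r) (\<omega> r) m \<and>
    zdiff (I r) (\<omega> r) m < (b - a - e') * real_of_int m"
    using uavg_zdiff_bound[OF assms(1,2) e'(1)] by blast
  have "\<forall>\<^sub>F p in F \<times>\<^sub>F at_bot. (\<forall>m\<le>N. (b - a + e') * real_of_int m < zdiff (I (fst p)) (\<omega> (fst p)) m \<and>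
    zdiff (I (fst p)) (\<omega> (fst p)) m < (b - a - e') * real_of_int m) \<and> snd p \<le> N"
    by (rule eventually_prodI[OF ev eventually_le_at_bot])
  then show "\<forall>\<^sub>F p in F \<times>\<^sub>F at_bot. dist (case p of (r, m) \<Rightarrow> rmax (I r) (\<omega> r) m / real_of_int m) (b - a) < e"
  proof eventually_elim
    case (elim p)
    obtain r m where p: "p = (r, m)" by force
    have z: "(b - a + e') * real_of_int k < zdiff (I r) (\<omega> r) k"
      "zdiff (I r) (\<omega> r) k < (b - a - e') * real_of_int k" if "k \<le> N" for k
      using elim that by (auto simp: p)
    have m: "m \<le> N" using elim by (simp add: p)
    have adm: "adm (I r) (\<omega> r)" using e'(3) z(2) by (rule adm_of_linear_bound)
    obtain k where k: "k \<le> m" "rmax (I r) (\<omega> r) m = zdiff (I r) (\<omega> r) k" using rmax_max(1)[OF adm] by blast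
    have "rmax (I r) (\<omega> r) m < (b - a - e') * real_of_int k" using k z(2)[of k] m by simp
    also have "\<dots> \<le> (b - a - e') * real_of_int m" using e'(3) k(1) by simp
    finally have 1: "rmax (I r) (\<omega> r) m < (b - a - e') * real_of_int m" .
    have 2: "(b - a + e') * real_of_int m < rmax (I r) (\<omega> r) m"
      using z(1)[OF m] rmax_max(2)[OF adm order_refl, of m] by linarith
    have "b - a - e' < rmax (I r) (\<omega> r) m / real_of_int m" "rmax (I r) (\<omega> r) m / real_of_int m < b - a + e'"
      using 1 2 m N by (simp_all add: field_simps)
    then show ?case using e'(2) by (simp add: p dist_real_def abs_less_iff)
  qed
qed

lemma tendsto_psum:
  assumes "\<And>k. ((\<lambda>r. x r k) \<longlongrightarrow> x' k) F"
  shows "((\<lambda>r. psum (x r) k) \<longlongrightarrow> psum x' k) F"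
  unfolding psum_def by (intro tendsto_intros assms)

lemma cavg_rmax_tendsto:
  assumes I: "cavg F I I' b" and \<omega>: "cavg F \<omega> \<omega>' a" and ab: "a < b"
  shows "((\<lambda>r. rmax (I r) (\<omega> r) l) \<longlongrightarrow> rmax I' \<omega>' l) F"
proof (rule tendstoI)
  fix e :: real assume e: "e > 0"
  define d where "d = (b - a) / 2"
  have d: "d > 0" "b - a - d = d" using ab by (auto simp: d_def field_simps)
  have adm': "adm I' \<omega>'" using I \<omega> ab by (intro has_avg_adm) (auto simp: cavg_def)
  have zlim: "((\<lambda>r. zdiff (I r) (\<omega> r) k) \<longlongrightarrow> zdiff I' \<omega>' k) F" for k
    unfolding zdiff_def using I \<omega> by (intro tendsto_diff tendsto_psum) (auto simp: cavg_def)
  obtain N where N: "N < 0" "\<forall>\<^sub>F r in F. \<forall>m\<le>N. zdiff (I r) (\<omega> r) m < d * real_of_int m"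
  proof -
    from uavg_zdiff_bound[of F I b \<omega> a d] I \<omega> d(1)
    obtain N where N: "N < 0" and ev: "\<forall>\<^sub>F r in F. \<forall>m\<le>N. (b - a + d) * real_of_int m < zdiff (I r) (\<omega> r) m \<and>
      zdiff (I r) (\<omega> r) m < (b - a - d) * real_of_int m" by (auto simp: cavg_def)
    from ev have "\<forall>\<^sub>F r in F. \<forall>m\<le>N. zdiff (I r) (\<omega> r) m < d * real_of_int m"
      unfolding d(2) by (rule eventually_mono) blast
    with N show ?thesis by (rule that)
  qed
  \<comment> \<open>No value up to \<open>c\<close> can be a maximum: the limit walk at
    \<open>l\<close> is \<open>c + 1\<close>, and nearby walks are within 1 of it there. Left of
    \<open>K\<close> the limit walk is at most \<open>c\<close> by admissibility and nearby walks by
    their common line of slope \<open>d\<close>, so every maximiser lies in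
    \<open>{K..l}\<close>.\<close>
  define c where "c = zdiff I' \<omega>' l - 1"
  have "\<forall>\<^sub>F k in at_bot. zdiff I' \<omega>' k \<le> c"
    using adm' unfolding adm_def filterlim_at_bot by blast
  moreover have "filterlim (\<lambda>m. d * real_of_int m) at_bot at_bot"
    using d(1) filterlim_real_of_int_at_bot by (rule filterlim_tendsto_pos_mult_at_bot[OF tendsto_const])
  then have "\<forall>\<^sub>F m in at_bot. d * real_of_int m \<le> c" by (simp add: filterlim_at_bot)
  ultimately have "\<forall>\<^sub>F k in at_bot. zdiff I' \<omega>' k \<le> c \<and> d * real_of_int k \<le> c \<and> k \<le> N \<and> k \<le> l"
    by (intro eventually_conj eventually_le_at_bot)
  then obtain K where K: "\<And>k. k \<le> K \<Longrightarrow> zdiff I' \<omega>' k \<le> c \<and> d * real_of_int k \<le> c \<and> k \<le> N \<and> k \<le> l"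
    unfolding eventually_at_bot_linorder by blast
  have "\<forall>\<^sub>F r in F. \<forall>k\<in>{K..l}. dist (zdiff (I r) (\<omega> r) k) (zdiff I' \<omega>' k) < min e 1"
    using e by (intro eventually_ball_finite ballI tendstoD[OF zlim]) auto
  with N(2) show "\<forall>\<^sub>F r in F. dist (rmax (I r) (\<omega> r) l) (rmax I' \<omega>' l) < e"
  proof eventually_elim
    case (elim r)
    have adm: "adm (I r) (\<omega> r)" using d(1) elim(1) by (intro adm_of_linear_bound) auto
    have near: "\<bar>zdiff (I r) (\<omega> r) k - zdiff I' \<omega>' k\<bar> < e" "\<bar>zdiff (I r) (\<omega> r) k - zdiff I' \<omega>' k\<bar> < 1"
      if "K \<le> k" "k \<le> l" for k
      using elim(2) that by (auto simp: dist_real_def)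
    have Kl: "K \<le> l" using K[of K] by simp
    obtain k where k: "k \<le> l" "rmax (I r) (\<omega> r) l = zdiff (I r) (\<omega> r) k" using rmax_max(1)[OF adm] by blast
    obtain k' where k': "k' \<le> l" "rmax I' \<omega>' l = zdiff I' \<omega>' k'" using rmax_max(1)[OF adm'] by blast
    have "\<not> k < K"
    proof
      assume "k < K"
      then have "zdiff (I r) (\<omega> r) k < c" using K[of k] elim(1) by force
      moreover have "c < zdiff (I r) (\<omega> r) l" using near(2)[OF Kl order_refl] unfolding c_def by linarith
      ultimately show False using rmax_max(2)[OF adm order_refl, of l] k(2) by linarith
    qed
    moreover have "\<not> k' < K"
      using K[of k'] rmax_max(2)[OF adm' order_refl, of l] k'(2) unfolding c_def by force
    ultimately show ?case
      using near(1)[of k] near(1)[of k'] k k' rmax_max(2)[OF adm k'(1)] rmax_max(2)[OF adm' k(1)]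
      by (auto simp: dist_real_def)
  qed
qed

lemma tendsto_fst_divide_snd:
  assumes "(f \<longlongrightarrow> (c::real)) F"
  shows "((\<lambda>(r, m). f r / real_of_int m) \<longlongrightarrow> 0) (F \<times>\<^sub>F at_bot)"
proof -
  have "((\<lambda>p. f (fst p) * (1 / real_of_int (snd p))) \<longlongrightarrow> c * 0) (F \<times>\<^sub>F at_bot)"
    by (intro tendsto_mult filterlim_compose[OF assms filterlim_fst]
        filterlim_compose[OF tendsto_divide_int_at_bot filterlim_snd])
  then show ?thesis by (simp add: case_prod_unfold)
qed

text \<open>\<open>rmax\<close> has slope \<open>b - a\<close>: added to the services and taken from
  the arrivals, it exchanges the two averages. Its value at 0, which stems from the normalisation of
  \<open>psum\<close>, is negligible uniformly because it converges.\<close>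

lemma uavg_queue:
  assumes I: "cavg F I I' b" and \<omega>: "cavg F \<omega> \<omega>' a" and ab: "a < b"
  shows "uavg F (\<lambda>r. qD (I r) (\<omega> r)) b" "uavg F (\<lambda>r. qR (I r) (\<omega> r)) a"
proof -
  have u: "uavg F I b" "uavg F \<omega> a" using I \<omega> by (auto simp: cavg_def)
  note r = uavg_rmax[OF u ab] tendsto_fst_divide_snd[OF cavg_rmax_tendsto[OF I \<omega> ab, of 0]]
  have "((\<lambda>p. psum (\<omega> (fst p)) (snd p) / real_of_int (snd p) + rmax (I (fst p)) (\<omega> (fst p)) (snd p) / real_of_int (snd p)
      - rmax (I (fst p)) (\<omega> (fst p)) 0 / real_of_int (snd p)) \<longlongrightarrow> a + (b - a) - 0) (F \<times>\<^sub>F at_bot)"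
    by (intro tendsto_add tendsto_diff u(2)[unfolded uavg_def case_prod_unfold] r[unfolded case_prod_unfold])
  then show "uavg F (\<lambda>r. qD (I r) (\<omega> r)) b"
    by (simp add: uavg_def case_prod_unfold psum_qD add_divide_distrib diff_divide_distrib)
  have "((\<lambda>p. psum (I (fst p)) (snd p) / real_of_int (snd p) - rmax (I (fst p)) (\<omega> (fst p)) (snd p) / real_of_int (snd p)
      + rmax (I (fst p)) (\<omega> (fst p)) 0 / real_of_int (snd p)) \<longlongrightarrow> b - (b - a) + 0) (F \<times>\<^sub>F at_bot)"
    by (intro tendsto_add tendsto_diff u(1)[unfolded uavg_def case_prod_unfold] r[unfolded case_prod_unfold])
  then show "uavg F (\<lambda>r. qR (I r) (\<omega> r)) a"
    by (simp add: uavg_def case_prod_unfold psum_qR add_divide_distrib diff_divide_distrib)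
qed

lemma has_avg_queue:
  assumes "has_avg I b" "has_avg \<omega> a" "a < b"
  shows "has_avg (qD I \<omega>) b" "has_avg (qR I \<omega>) a"
  using uavg_queue[OF assms(1,2)[unfolded has_avg_iff_cavg] assms(3)] by (simp_all add: has_avg_iff_uavg)

lemma cavg_qD:
  assumes I: "cavg F I I' b" and \<omega>: "cavg F \<omega> \<omega>' a" and ab: "a < b"
  shows "cavg F (\<lambda>r. qD (I r) (\<omega> r)) (qD I' \<omega>') b"
proof -
  have "((\<lambda>r. qD (I r) (\<omega> r) k) \<longlongrightarrow> qD I' \<omega>' k) F" for k
    unfolding qD_def using \<omega> by (intro tendsto_intros cavg_rmax_tendsto[OF I \<omega> ab]) (simp add: cavg_def)
  with uavg_queue(1)[OF assms] has_avg_queue(1)[of I' b \<omega>' a] I \<omega> ab show ?thesis by (auto simp: cavg_def)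
qed

section \<open>Partial sums and product measures under componentwise maps\<close>

lemma psum_measurable [measurable]:
  assumes [measurable]: "\<And>k. (\<lambda>x. f x k) \<in> borel_measurable M"
  shows "(\<lambda>x. psum (f x) k) \<in> borel_measurable M"
  unfolding psum_def by measurable

text \<open>The preimage of a cylinder is the cylinder of the preimages, so both sides agree on
  cylinders. \<open>I\<close> may be infinite: the lemma serves the coordinates of one line as well
  as the finitely many lines.\<close>

lemma distr_PiM_componentwise:
  assumes "\<And>i. i \<in> I \<Longrightarrow> prob_space (M i)" and f: "\<And>i. i \<in> I \<Longrightarrow> f i \<in> measurable (M i) (N i)"
  shows "distr (PiM I M) (PiM I N) (\<lambda>x. \<lambda>i\<in>I. f i (x i)) = PiM I (\<lambda>i. distr (M i) (N i) (f i))"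
proof (rule measure_eqI_PiM_infinite[symmetric, where M=N and I=I])
  have meas: "(\<lambda>x. \<lambda>i\<in>I. f i (x i)) \<in> measurable (PiM I M) (PiM I N)"
  proof (rule measurable_restrict)
    fix i assume i: "i \<in> I"
    show "(\<lambda>x. f i (x i)) \<in> measurable (PiM I M) (N i)"
      by (rule measurable_compose[OF measurable_component_singleton[OF i, where M=M] f[OF i]])
  qed
  have pr: "prob_space (distr (M i) (N i) (f i))" if "i \<in> I" for i
    using that assms by (intro prob_space.prob_space_distr) auto
  interpret P: prob_space "PiM I (\<lambda>i. distr (M i) (N i) (f i))" by (rule prob_space_PiM[OF pr])
  show "finite_measure (PiM I (\<lambda>i. distr (M i) (N i) (f i)))" by unfold_locales
  show "sets (PiM I (\<lambda>i. distr (M i) (N i) (f i))) = sets (PiM I N)"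
    by (intro sets_PiM_cong) auto
  fix A J assume J: "finite J" "J \<subseteq> I" and A: "\<And>i. i \<in> J \<Longrightarrow> A i \<in> sets (N i)"
  have "emeasure (distr (PiM I M) (PiM I N) (\<lambda>x. \<lambda>i\<in>I. f i (x i))) (prod_emb I N J (Pi\<^sub>E J A)) =
      emeasure (PiM I M) ((\<lambda>x. \<lambda>i\<in>I. f i (x i)) -` prod_emb I N J (Pi\<^sub>E J A) \<inter> space (PiM I M))"
    using J A by (intro emeasure_distr meas sets_PiM_I) auto
  also have "(\<lambda>x. \<lambda>i\<in>I. f i (x i)) -` prod_emb I N J (Pi\<^sub>E J A) \<inter> space (PiM I M) =
      prod_emb I M J (Pi\<^sub>E J (\<lambda>i. f i -` A i \<inter> space (M i)))"
  proof (rule set_eqI)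
    fix x
    have sp: "f i (x i) \<in> space (N i)" if "x \<in> space (PiM I M)" "i \<in> I" for i
      using that f[THEN measurable_space] by (auto simp: space_PiM PiE_iff)
    have "(\<lambda>i\<in>I. f i (x i)) \<in> prod_emb I N J (Pi\<^sub>E J A) \<longleftrightarrow> (\<forall>i\<in>J. f i (x i) \<in> A i)" if "x \<in> space (PiM I M)"
    proof -
      have "I \<inter> J = J" using J(2) by auto
      then show ?thesis using J(2) sp[OF that] by (auto simp: prod_emb_iff restrict_PiE_iff)
    qed
    moreover have "x \<in> prod_emb I M J (Pi\<^sub>E J (\<lambda>i. f i -` A i \<inter> space (M i))) \<longleftrightarrow>
        x \<in> space (PiM I M) \<and> (\<forall>i\<in>J. f i (x i) \<in> A i)"
      using J(2) by (auto simp: prod_emb_iff space_PiM PiE_iff subset_iff)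
    ultimately show "x \<in> (\<lambda>x. \<lambda>i\<in>I. f i (x i)) -` prod_emb I N J (Pi\<^sub>E J A) \<inter> space (PiM I M) \<longleftrightarrow>
        x \<in> prod_emb I M J (Pi\<^sub>E J (\<lambda>i. f i -` A i \<inter> space (M i)))"
      by auto
  qed
  also have "emeasure (PiM I M) \<dots> = (\<Prod>i\<in>J. emeasure (M i) (f i -` A i \<inter> space (M i)))"
    using J f A by (intro emeasure_PiM_emb assms measurable_sets[of "f _"]) auto
  also have "\<dots> = (\<Prod>i\<in>J. emeasure (distr (M i) (N i) (f i)) (A i))"
    using J f A by (intro prod.cong refl emeasure_distr[symmetric]) auto
  also have "\<dots> = emeasure (PiM I (\<lambda>i. distr (M i) (N i) (f i))) (prod_emb I (\<lambda>i. distr (M i) (N i) (f i)) J (Pi\<^sub>E J A))"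
    using J A by (intro emeasure_PiM_emb[symmetric] pr) auto
  also have "prod_emb I (\<lambda>i. distr (M i) (N i) (f i)) J (Pi\<^sub>E J A) = prod_emb I N J (Pi\<^sub>E J A)"
    by (simp add: prod_emb_def)
  finally show "emeasure (PiM I (\<lambda>i. distr (M i) (N i) (f i))) (prod_emb I N J (Pi\<^sub>E J A)) =
     emeasure (distr (PiM I M) (PiM I N) (\<lambda>x. \<lambda>i\<in>I. f i (x i))) (prod_emb I N J (Pi\<^sub>E J A))" by (rule sym)
qed simp

section \<open>Sequences of independent exponential variables\<close>

definition expm :: "real \<Rightarrow> real measure" where
  "expm r = density lborel (\<lambda>x. ennreal (exponential_density (1 / r) x))"

abbreviation line :: "real \<Rightarrow> (int \<Rightarrow> real) measure" where
  "line r \<equiv> (\<Pi>\<^sub>M k\<in>UNIV. expm r)"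

lemma sets_expm [simp, measurable_cong]: "sets (expm r) = sets borel"
  by (simp add: expm_def)

lemma space_expm [simp]: "space (expm r) = UNIV"
  by (simp add: expm_def)

lemma prob_space_expm: "r > 0 \<Longrightarrow> prob_space (expm r)"
  unfolding expm_def by (intro prob_space_exponential_density) simp

lemma space_line [simp]: "space (line r) = UNIV"
  by (simp add: space_PiM)

lemma sets_line: "sets (line r) = sets (PiM UNIV (\<lambda>_. borel))"
  by (intro sets_PiM_cong) auto

lemma prob_space_line: "r > 0 \<Longrightarrow> prob_space (line r)"
  by (intro prob_space_PiM prob_space_expm)

lemma nn_integral_expm:
  assumes [measurable]: "f \<in> borel_measurable borel"
  shows "(\<integral>\<^sup>+x. f x \<partial>expm r) = (\<integral>\<^sup>+x. ennreal (exponential_density (1 / r) x) * f x \<partial>lborel)"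
  unfolding expm_def by (subst nn_integral_density) auto

lemma expm_scale:
  assumes r: "r > 0"
  shows "distr (expm 1) borel (\<lambda>x. r * x) = expm r"
proof (rule measure_eqI)
  fix B assume "B \<in> sets (distr (expm 1) borel (\<lambda>x. r * x))"
  then have [measurable]: "B \<in> sets borel" by simp
  have *: "ennreal r * (ennreal (exponential_density (1 / r) (0 + r * x)) * indicator B (0 + r * x)) =
      ennreal (exponential_density 1 x) * indicator B (r * x)" for x
  proof -
    have "r * exponential_density (1 / r) (r * x) = exponential_density 1 x"
      using r by (auto simp: exponential_density_def mult_less_0_iff)
    then have "ennreal r * ennreal (exponential_density (1 / r) (r * x)) = ennreal (exponential_density 1 x)"
      using r by (subst ennreal_mult'[symmetric]) auto
    then show ?thesis by (simp add: mult.assoc[symmetric])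
  qed
  have "emeasure (expm r) B = (\<integral>\<^sup>+x. ennreal (exponential_density (1 / r) x) * indicator B x \<partial>lborel)"
    by (simp add: nn_integral_expm[symmetric])
  also have "\<dots> = ennreal r * (\<integral>\<^sup>+x. ennreal (exponential_density (1 / r) (0 + r * x)) * indicator B (0 + r * x) \<partial>lborel)"
    using r by (subst nn_integral_real_affine[where c=r and t=0]) auto
  also have "\<dots> = (\<integral>\<^sup>+x. ennreal (exponential_density 1 x) * indicator B (r * x) \<partial>lborel)"
    unfolding *[symmetric] by (rule nn_integral_cmult[symmetric]) measurable
  also have "\<dots> = (\<integral>\<^sup>+x. indicator B (r * x) \<partial>expm 1)" by (simp add: nn_integral_expm)
  also have "\<dots> = (\<integral>\<^sup>+y. indicator B y \<partial>distr (expm 1) borel (\<lambda>x. r * x))"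
    by (rule nn_integral_distr[symmetric]) auto
  also have "\<dots> = emeasure (distr (expm 1) borel (\<lambda>x. r * x)) B" by simp
  finally show "emeasure (distr (expm 1) borel (\<lambda>x. r * x)) B = emeasure (expm r) B" by simp
qed simp

lemma line_scale:
  assumes "r > 0"
  shows "distr (line 1) (line r) (\<lambda>x k. r * x k) = line r"
proof -
  have "distr (PiM UNIV (\<lambda>_::int. expm 1)) (PiM UNIV (\<lambda>_::int. borel)) (\<lambda>x. \<lambda>k\<in>UNIV. r * x k) =
      PiM UNIV (\<lambda>_. distr (expm 1) borel (\<lambda>x. r * x))"
    by (rule distr_PiM_componentwise) (auto intro: prob_space_expm)
  then show ?thesis unfolding expm_scale[OF assms] restrict_UNIV
    by (subst distr_cong[OF refl sets_line refl])
qed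

lemma line_shift:
  assumes "r > 0"
  shows "distr (line r) (line r) (\<lambda>x k. x (k + l)) = line r"
  using distr_PiM_reindex[of UNIV "\<lambda>_. expm r" "\<lambda>k. k + l" UNIV] prob_space_expm[OF assms]
  by (simp add: restrict_UNIV)

text \<open>The tilt by \<open>exp (t * x)\<close> turns the density of rate \<open>1 / r\<close>
  into a multiple of the density of rate \<open>s = 1 / r - t\<close>, which has total mass
  one.\<close>

lemma exp_moment_expm:
  assumes r: "r > 0" and t: "t * r < 1"
  shows "(\<integral>\<^sup>+x. ennreal (exp (t * x)) \<partial>expm r) = ennreal (1 / (1 - t * r))"
proof -
  define s where "s = 1 / r - t"
  have s: "s > 0" using r t by (simp add: s_def field_simps)
  have eq: "exponential_density (1 / r) x * exp (t * x) = 1 / (1 - t * r) * exponential_density s x" for x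
  proof -
    have "1 / r * exp (- x * (1 / r)) * exp (t * x) = 1 / (1 - t * r) * (s * exp (- x * s))"
    proof -
      have "1 / (1 - t * r) * s = 1 / r" using r t by (simp add: s_def field_simps)
      moreover have "exp (- x * (1 / r)) * exp (t * x) = exp (- x * s)"
        by (simp add: exp_add[symmetric] s_def algebra_simps)
      ultimately show ?thesis by (metis mult.assoc)
    qed
    then show ?thesis by (simp add: exponential_density_def)
  qed
  interpret prob_space "density lborel (exponential_density s)"
    by (rule prob_space_exponential_density[OF s])
  have "(\<integral>\<^sup>+x. ennreal (exp (t * x)) \<partial>expm r) = (\<integral>\<^sup>+x. ennreal (1 / (1 - t * r)) * ennreal (exponential_density s x) \<partial>lborel)"
    using r t s by (simp add: nn_integral_expm ennreal_mult'[symmetric] ennreal_mult''[symmetric] eq exponential_density_nonneg)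
  also have "\<dots> = ennreal (1 / (1 - t * r)) * (\<integral>\<^sup>+x. ennreal (exponential_density s x) \<partial>lborel)"
    by (rule nn_integral_cmult) measurable
  also have "(\<integral>\<^sup>+x. ennreal (exponential_density s x) \<partial>lborel) = 1"
    using emeasure_space_1 by (simp add: emeasure_density)
  finally show ?thesis by simp
qed

lemma nn_integral_line_prod:
  assumes r: "r > 0" and J: "finite J" and [measurable]: "f \<in> borel_measurable borel"
  shows "(\<integral>\<^sup>+x. (\<Prod>k\<in>J. f (x k)) \<partial>line r) = (\<Prod>k\<in>J. \<integral>\<^sup>+y. f y \<partial>expm r)"
proof -
  interpret prob_space "expm r" by (rule prob_space_expm[OF r])
  interpret product_prob_space "\<lambda>_::int. expm r" UNIV by unfold_locales
  have "(\<integral>\<^sup>+x. (\<Prod>k\<in>J. f (x k)) \<partial>line r) = (\<integral>\<^sup>+x. (\<Prod>k\<in>J. f (restrict x J k)) \<partial>line r)"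
    by (intro nn_integral_cong prod.cong) auto
  also have "\<dots> = (\<integral>\<^sup>+x. (\<Prod>k\<in>J. f (x k)) \<partial>distr (line r) (PiM J (\<lambda>_. expm r)) (\<lambda>x. restrict x J))"
    by (subst nn_integral_distr) auto
  also have "\<dots> = (\<integral>\<^sup>+x. (\<Prod>k\<in>J. f (x k)) \<partial>PiM J (\<lambda>_. expm r))"
    using J by (subst distr_PiM_restrict_finite) auto
  also have "\<dots> = (\<Prod>k\<in>J. \<integral>\<^sup>+y. f y \<partial>expm r)"
    using J by (intro product_nn_integral_prod) auto
  finally show ?thesis .
qed

section \<open>The strong law by exponential moments\<close>

lemma one_add_less_exp:
  fixes e :: real
  assumes "e > -1" "e \<noteq> 0"
  shows "1 + e < exp e"
proof -
  have "0 < e * e" using assms(2) by (metis not_real_square_gt_zero)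
  \<comment> \<open>Strictness: the square exceeds \<open>1 + e\<close> by
    \<open>e * e / 4\<close>.\<close>
  then have "1 + e < (1 + e / 2)\<^sup>2" by (simp add: power2_eq_square algebra_simps)
  also have "\<dots> \<le> (exp (e / 2))\<^sup>2"
    using assms(1) exp_ge_add_one_self[of "e / 2"] by (intro power_mono) auto
  also have "\<dots> = exp e" by (simp add: exp_double[symmetric])
  finally show ?thesis .
qed

abbreviation past_sum :: "(int \<Rightarrow> real) \<Rightarrow> nat \<Rightarrow> real" where
  "past_sum x n \<equiv> \<Sum>k\<in>{- int n + 1..0}. x k"

text \<open>Chernoff bound, for upper deviations (\<open>e > 0\<close>) and lower deviations (\<open>-1 < e < 0\<close>) at once:
  the sign of \<open>e\<close> is the sign of the exponential tilt.\<close>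

lemma line_deviation:
  assumes r: "r > 0" and e: "e > -1" "e \<noteq> 0"
  shows "AE x in line r. \<forall>\<^sub>F n in sequentially.
    e * past_sum x n < e * (r * (1 + e) * real n)"
proof -
  interpret prob_space "line r" by (rule prob_space_line[OF r])
  \<comment> \<open>This tilt makes the tilted mean \<open>r / (1 - t * r)\<close> equal to the
    target \<open>r * (1 + e)\<close>, so it is the optimal one; \<open>q\<close> is the resulting
    Chernoff factor per variable.\<close>
  define t where "t = e / (r * (1 + e))"
  define q where "q = (1 + e) * exp (- e)"
  have q: "0 < q" "q < 1"
    using one_add_less_exp[OF e] e(1) by (auto simp: q_def exp_minus field_simps)
  have tr: "t * r = e / (1 + e)" "t * r < 1" "1 / (1 - t * r) = 1 + e"
  proof -
    show 1: "t * r = e / (1 + e)" using r by (simp add: t_def)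
    show "t * r < 1" "1 / (1 - t * r) = 1 + e" unfolding 1 using e(1) by (auto simp: divide_simps)
  qed
  define A where "A n = {x. t * past_sum x n \<ge> e * real n}" for n
  have Am [measurable]: "A n \<in> sets (line r)" for n
  proof -
    have "A n = {x\<in>space (line r). t * past_sum x n \<ge> e * real n}" by (simp add: A_def)
    also have "\<dots> \<in> sets (line r)" by measurable
    finally show ?thesis .
  qed
  have bound: "emeasure (line r) (A n) \<le> ennreal (q ^ n)" for n
  proof -
    have "emeasure (line r) (A n) = (\<integral>\<^sup>+x. indicator (A n) x \<partial>line r)" by simp
    also have "\<dots> \<le> (\<integral>\<^sup>+x. ennreal (exp (- e * real n)) * (\<Prod>k\<in>{- int n + 1..0}. ennreal (exp (t * x k))) \<partial>line r)"
    proof (rule nn_integral_mono)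
      fix x
      show "indicator (A n) x \<le> ennreal (exp (- e * real n)) * (\<Prod>k\<in>{- int n + 1..0}. ennreal (exp (t * x k)))"
      proof (cases "x \<in> A n")
        case True
        then have "1 \<le> exp (- e * real n + t * past_sum x n)" by (simp add: A_def)
        also have "\<dots> = exp (- e * real n) * (\<Prod>k\<in>{- int n + 1..0}. exp (t * x k))"
          by (simp only: exp_add sum_distrib_left exp_sum finite_atLeastAtMost_int)
        finally show ?thesis
          using True by (simp add: prod_ennreal ennreal_mult'[symmetric] prod_nonneg)
      qed simp
    qed
    also have "\<dots> = ennreal (exp (- e * real n)) * (\<integral>\<^sup>+x. (\<Prod>k\<in>{- int n + 1..0}. ennreal (exp (t * x k))) \<partial>line r)"
      by (rule nn_integral_cmult) measurable
    also have "(\<integral>\<^sup>+x. (\<Prod>k\<in>{- int n + 1..0}. ennreal (exp (t * x k))) \<partial>line r) = ennreal (1 + e) ^ n"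
      using nn_integral_line_prod[OF r, of "{- int n + 1..0}" "\<lambda>y. ennreal (exp (t * y))"]
      by (simp add: exp_moment_expm[OF r tr(2)] tr(3))
    also have "ennreal (exp (- e * real n)) * ennreal (1 + e) ^ n = ennreal (q ^ n)"
    proof -
      have "exp (- e * real n) = exp (- e) ^ n" by (metis exp_of_nat_mult mult.commute)
      then have "exp (- e * real n) * (1 + e) ^ n = q ^ n" by (simp only: q_def power_mult_distrib mult.commute)
      then show ?thesis using e(1) by (simp only: ennreal_power ennreal_mult''[symmetric] zero_le_power)
    qed
    finally show ?thesis .
  qed
  have "AE x in line r. \<forall>\<^sub>F n in sequentially. x \<in> space (line r) - A n"
  proof (rule borel_cantelli_AE1)
    show "emeasure (line r) (A n) < \<infinity>" for n by (simp add: less_top[symmetric])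
    have "measure (line r) (A n) \<le> q ^ n" for n
      using bound[of n] q by (simp add: emeasure_eq_measure)
    then show "summable (\<lambda>n. measure (line r) (A n))"
      using q by (intro summable_comparison_test'[OF summable_geometric[of q], of 0]) auto
  qed measurable
  then show ?thesis
  proof eventually_elim
    case (elim x)
    then show ?case
    proof eventually_elim
      case (elim n)
      then have "t * past_sum x n < e * real n" by (simp add: A_def)
      then have "r * (1 + e) * (t * past_sum x n) < r * (1 + e) * (e * real n)"
        using r e(1) by (intro mult_strict_left_mono) auto
      moreover have "r * (1 + e) * (t * S) = e * S" for S
      proof -
        have "r * (1 + e) * t = e" using r e(1) by (simp add: t_def)
        then show ?thesis by (simp only: mult.assoc[symmetric])
      qed
      moreover have "r * (1 + e) * (e * real n) = e * (r * (1 + e) * real n)" by (simp only: mult_ac)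
      ultimately show ?case by (simp only:)
    qed
  qed
qed

lemma has_avg_iff_seq: "has_avg x a \<longleftrightarrow> (\<lambda>n. past_sum x n / real n) \<longlonglongrightarrow> a"
proof -
  have eq: "past_sum x n / real n = psum x (- int n) / real_of_int (- int n)" for n
    by (simp add: sum_interval_psum)
  have lim: "filterlim (\<lambda>n. - int n) at_bot sequentially"
    unfolding filterlim_at_bot
  proof
    fix Z show "\<forall>\<^sub>F n in sequentially. - int n \<le> Z"
      by (intro eventually_sequentiallyI[of "nat (- Z)"]) auto
  qed
  show ?thesis
  proof
    assume "has_avg x a"
    then show "(\<lambda>n. past_sum x n / real n) \<longlonglongrightarrow> a"
      unfolding eq has_avg_def by (rule filterlim_compose[OF _ lim])
  next
    assume L: "(\<lambda>n. past_sum x n / real n) \<longlonglongrightarrow> a"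
    have "filterlim (\<lambda>m::int. nat (- m)) sequentially at_bot"
      unfolding filterlim_at_top
    proof
      fix Z show "\<forall>\<^sub>F m in at_bot. Z \<le> nat (- m)"
        by (intro eventually_at_bot_linorderI[of "- int Z"]) auto
    qed
    from filterlim_compose[OF L this]
    have "((\<lambda>m. psum x (- int (nat (- m))) / real_of_int (- int (nat (- m)))) \<longlongrightarrow> a) at_bot"
      unfolding eq .
    moreover have "\<forall>\<^sub>F m in at_bot. psum x (- int (nat (- m))) / real_of_int (- int (nat (- m))) = psum x m / real_of_int m"
      by (intro eventually_at_bot_linorderI[of 0]) auto
    ultimately show "has_avg x a" unfolding has_avg_def by (rule Lim_transform_eventually)
  qed
qed

lemma line_has_avg:
  assumes r: "r > 0"
  shows "AE x in line r. has_avg x r"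
proof -
  \<comment> \<open>Countably many deviations \<open>1 / (j + 2)\<close> are enough; the
    denominators start at 2 so that the negative ones stay above -1.\<close>
  have "AE x in line r. \<forall>j. \<forall>\<^sub>F n in sequentially.
    (1 / real (j + 2)) * past_sum x n < (1 / real (j + 2)) * (r * (1 + (1 / real (j + 2))) * real n)"
    unfolding AE_all_countable by (intro allI line_deviation r) (auto intro: less_le_trans[of "-1" 0])
  moreover have "AE x in line r. \<forall>j. \<forall>\<^sub>F n in sequentially.
    (- 1 / real (j + 2)) * past_sum x n < (- 1 / real (j + 2)) * (r * (1 + (- 1 / real (j + 2))) * real n)"
    unfolding AE_all_countable by (intro allI line_deviation r) (auto simp: field_simps)
  ultimately show ?thesis
  proof eventually_elim
    case (elim x)
    show ?case unfolding has_avg_iff_seq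
    proof (rule LIMSEQ_I)
      fix e :: real assume e: "e > 0"
      obtain j where j: "inverse (real (Suc j)) < e / r" using reals_Archimedean[of "e / r"] e r by auto
      define d where "d = 1 / real (j + 2)"
      have d: "d > 0" "r * d < e"
      proof -
        show "d > 0" by (simp add: d_def)
        have "d < inverse (real (Suc j))" by (simp add: d_def field_simps)
        with j have "d < e / r" by simp
        then show "r * d < e" using r by (simp add: field_simps)
      qed
      have "\<forall>\<^sub>F n in sequentially. d * past_sum x n < d * (r * (1 + d) * real n)"
        using elim(1) unfolding d_def by blast
      moreover have "\<forall>\<^sub>F n in sequentially. - d * past_sum x n < - d * (r * (1 + - d) * real n)"
        using elim(2) unfolding d_def minus_divide_left by blast
      moreover have "\<forall>\<^sub>F n in sequentially. n > (0::nat)" by (rule eventually_gt_at_top)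
      ultimately have "\<forall>\<^sub>F n in sequentially. norm (past_sum x n / real n - r) < e"
      proof eventually_elim
        case (elim n)
        have "past_sum x n < r * (1 + d) * real n" "r * (1 - d) * real n < past_sum x n"
          using elim(1,2) d(1) by auto
        then have "past_sum x n / real n < r * (1 + d)" "r * (1 - d) < past_sum x n / real n"
          using elim(3) by (simp_all add: field_simps)
        then show ?case using d(2) by (auto simp: algebra_simps abs_less_iff)
      qed
      then show "\<exists>no. \<forall>n\<ge>no. norm (past_sum x n / real n - r) < e" unfolding eventually_sequentially .
    qed
  qed
qed

lemma line_nonneg: "r > 0 \<Longrightarrow> AE x in line r. \<forall>k. 0 \<le> x k"
proof -
  assume r: "r > 0"
  have "AE y in expm r. 0 \<le> y"
    unfolding expm_def by (subst AE_density) (auto simp: exponential_density_def)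
  then have "AE x in line r. 0 \<le> x k" for k
    using prob_space_expm[OF r] by (intro AE_PiM_component) auto
  then show ?thesis unfolding AE_all_countable by blast
qed

section \<open>Mixing\<close>

text \<open>The sets along which \<open>u N\<close> converges form a Dynkin system: complements by
  the limit of the total mass, disjoint unions by Tannery's theorem with the summable majorant
  \<open>measure M (A i)\<close>. The set function is abstract because mixing needs the argument
  once for each of its two sets.\<close>

lemma setwise_limit_generator:
  fixes u :: "nat \<Rightarrow> 'a set \<Rightarrow> real"
  assumes "prob_space M"
    and gen: "sets M = sigma_sets (space M) G" "Int_stable G" "G \<subseteq> Pow (space M)"
    and bnd: "\<And>N A. A \<in> sets M \<Longrightarrow> 0 \<le> u N A \<and> u N A \<le> measure M A"
    and compl: "\<And>N A. A \<in> sets M \<Longrightarrow> u N (space M - A) = u N (space M) - u N A"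
    and add: "\<And>N A. range A \<subseteq> sets M \<Longrightarrow> disjoint_family A \<Longrightarrow> (\<lambda>i. u N (A i)) sums u N (\<Union>i. A i)"
    and top: "(\<lambda>N. u N (space M)) \<longlonglongrightarrow> c"
    and G: "\<And>A. A \<in> G \<Longrightarrow> (\<lambda>N. u N A) \<longlonglongrightarrow> c * measure M A"
    and A: "A \<in> sets M"
  shows "(\<lambda>N. u N A) \<longlonglongrightarrow> c * measure M A"
proof -
  interpret prob_space M by fact
  from A have "A \<in> sigma_sets (space M) G" using gen(1) by simp
  with gen(2,3) show ?thesis
  proof (induction rule: sigma_sets_induct_disjoint)
    case (basic A)
    then show ?case by (rule G)
  next
    case empty
    have "u N {} = 0" for N using bnd[of "{}" N] by simp
    then show ?case by simp
  next
    case (compl A)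
    then have A: "A \<in> sets M" using gen(1) by simp
    have "(\<lambda>N. u N (space M) - u N A) \<longlonglongrightarrow> c - c * measure M A"
      by (intro tendsto_diff top compl.IH)
    then show ?case using A by (simp add: assms(6) prob_compl algebra_simps)
  next
    case (union A)
    then have A: "range A \<subseteq> sets M" using gen(1) by simp
    have s: "(\<lambda>i. measure M (A i)) sums measure M (\<Union>i. A i)"
      by (rule finite_measure_UNION[OF A union(1)])
    have "((\<lambda>N. \<Sum>i. u N (A i)) \<longlonglongrightarrow> (\<Sum>i. c * measure M (A i)))"
    proof (intro tannerys_theorem[THEN conjunct2, THEN conjunct2] union.IH)
      show "\<forall>\<^sub>F (i, N) in sequentially \<times>\<^sub>F sequentially. norm (u N (A i)) \<le> measure M (A i)"
        using bnd A by (intro always_eventually) auto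
      show "summable (\<lambda>i. measure M (A i))" using s by (rule sums_summable)
    qed simp
    moreover have "(\<Sum>i. u N (A i)) = u N (\<Union>i. A i)" for N
      using add[OF A union(1)] by (rule sums_unique[symmetric])
    moreover have "(\<Sum>i. c * measure M (A i)) = c * measure M (\<Union>i. A i)"
      using sums_mult[OF s, of c] by (rule sums_unique[symmetric])
    ultimately show ?case by simp
  qed
qed

text \<open>Used in place of ergodicity because it can be checked on a generator and is inherited by
  finite products.\<close>

definition mixing :: "'a measure \<Rightarrow> (nat \<Rightarrow> 'a \<Rightarrow> 'a) \<Rightarrow> bool" where
  "mixing M \<tau> \<longleftrightarrow> (\<forall>B\<in>sets M. \<forall>C\<in>sets M.
     (\<lambda>N. measure M (B \<inter> (\<tau> N -` C \<inter> space M))) \<longlonglongrightarrow> measure M B * measure M C)"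

text \<open>The two sets are generalised from \<open>G\<close> one after the other. For the second
  one, invariance of \<open>M\<close> under \<open>\<tau> N\<close> supplies the majorant
  \<open>measure M A\<close>.\<close>

lemma mixing_generator:
  assumes "prob_space M"
    and gen: "sets M = sigma_sets (space M) G" "Int_stable G" "G \<subseteq> Pow (space M)"
    and \<tau> [measurable]: "\<And>N. \<tau> N \<in> measurable M M"
    and pres: "\<And>N. distr M M (\<tau> N) = M"
    and G: "\<And>B C. B \<in> G \<Longrightarrow> C \<in> G \<Longrightarrow>
      (\<lambda>N. measure M (B \<inter> (\<tau> N -` C \<inter> space M))) \<longlonglongrightarrow> measure M B * measure M C"
  shows "mixing M \<tau>"
proof -
  let ?T = "\<lambda>N C. \<tau> N -` C \<inter> space M"
  interpret prob_space M by fact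
  have pre: "?T N C \<in> sets M" if "C \<in> sets M" for N C
    using that by measurable
  have mpre: "measure M (?T N C) = measure M C" if "C \<in> sets M" for N C
    using measure_distr[OF \<tau>[of N] that] by (simp add: pres)
  have step1: "(\<lambda>N. measure M (B \<inter> ?T N C)) \<longlonglongrightarrow> measure M C * measure M B"
    if B: "B \<in> sets M" and C: "C \<in> G" for B C
  proof (rule setwise_limit_generator[OF assms(1) gen _ _ _ _ _ B])
    have C': "C \<in> sets M" using C gen(1) by auto
    note [simp] = pre[OF C']
    show "0 \<le> measure M (A \<inter> ?T N C) \<and> measure M (A \<inter> ?T N C) \<le> measure M A"
      if "A \<in> sets M" for N A
      using that by (auto intro!: finite_measure_mono)
    show "measure M ((space M - A) \<inter> ?T N C) =
        measure M (space M \<inter> ?T N C) - measure M (A \<inter> ?T N C)"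
      if "A \<in> sets M" for N A
      using that by (subst finite_measure_Diff[symmetric]) (auto intro!: arg_cong[where f="measure M"])
    show "(\<lambda>i. measure M (A i \<inter> ?T N C)) sums measure M ((\<Union>i. A i) \<inter> ?T N C)"
      if A: "range A \<subseteq> sets M" "disjoint_family A" for N and A :: "nat \<Rightarrow> 'a set"
    proof -
      have "(\<lambda>i. measure M (A i \<inter> ?T N C)) sums measure M (\<Union>i. A i \<inter> ?T N C)"
        using A by (intro finite_measure_UNION) (auto simp: disjoint_family_on_def)
      then show ?thesis by simp
    qed
    show "(\<lambda>N. measure M (space M \<inter> ?T N C)) \<longlonglongrightarrow> measure M C"
      using mpre[OF C'] by (simp add: Int_absorb1)
    show "(\<lambda>N. measure M (A \<inter> ?T N C)) \<longlonglongrightarrow> measure M C * measure M A" if "A \<in> G" for A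
      using G[OF that C] by (simp add: mult.commute)
  qed
  show ?thesis unfolding mixing_def
  proof (intro ballI)
    fix B C assume B: "B \<in> sets M" and C: "C \<in> sets M"
    show "(\<lambda>N. measure M (B \<inter> ?T N C)) \<longlonglongrightarrow> measure M B * measure M C"
    proof (rule setwise_limit_generator[OF assms(1) gen _ _ _ _ _ C])
      show "0 \<le> measure M (B \<inter> ?T N A) \<and> measure M (B \<inter> ?T N A) \<le> measure M A"
        if "A \<in> sets M" for N A
        using that B pre[OF that] unfolding mpre[OF that, of N, symmetric] by (auto intro!: finite_measure_mono)
      show "measure M (B \<inter> ?T N (space M - A)) =
          measure M (B \<inter> ?T N (space M)) - measure M (B \<inter> ?T N A)"
        if "A \<in> sets M" for N A
        using that B pre[OF that] pre[OF sets.top]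
        by (subst finite_measure_Diff[symmetric])
          (auto intro!: arg_cong[where f="measure M"] dest: sets.sets_into_space)
      show "(\<lambda>i. measure M (B \<inter> ?T N (A i))) sums measure M (B \<inter> ?T N (\<Union>i. A i))"
        if A: "range A \<subseteq> sets M" "disjoint_family A" for N and A :: "nat \<Rightarrow> 'a set"
      proof -
        have "(\<lambda>i. measure M (B \<inter> ?T N (A i))) sums measure M (\<Union>i. B \<inter> ?T N (A i))"
          using A B pre by (intro finite_measure_UNION) (auto simp: disjoint_family_on_def)
        moreover have "(\<Union>i. B \<inter> ?T N (A i)) = B \<inter> ?T N (\<Union>i. A i)" by auto
        ultimately show ?thesis by simp
      qed
      have "B \<inter> ?T N (space M) = B" for N
        using sets.sets_into_space[OF B] measurable_space[OF \<tau>] by auto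
      then show "(\<lambda>N. measure M (B \<inter> ?T N (space M))) \<longlonglongrightarrow> measure M B" by simp
      show "(\<lambda>N. measure M (B \<inter> ?T N A)) \<longlonglongrightarrow> measure M B * measure M A" if "A \<in> G" for A
        using step1[OF B that] by (simp add: mult.commute)
    qed
  qed
qed

text \<open>For an invariant set mixing reads \<open>p = p * p\<close>. Invariance is asked almost
  everywhere, because the sets in question are preimages under a map that is known to commute with
  translations almost surely.\<close>

lemma mixing_invariant:
  assumes "prob_space M" "mixing M \<tau>" "A \<in> sets M"
    and inv: "\<And>N. AE x in M. \<tau> N x \<in> A \<longleftrightarrow> x \<in> A" and \<tau>: "\<And>N. \<tau> N \<in> measurable M M"
  shows "measure M A \<in> {0, 1}"
proof -
  interpret prob_space M by fact
  have "measure M (A \<inter> (\<tau> N -` A \<inter> space M)) = measure M A" for N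
    using inv[of N] assms(3) measurable_sets[OF \<tau> assms(3)] by (intro finite_measure_eq_AE) auto
  moreover have "(\<lambda>N. measure M (A \<inter> (\<tau> N -` A \<inter> space M))) \<longlonglongrightarrow> measure M A * measure M A"
    using assms(2,3) by (auto simp: mixing_def)
  ultimately have "measure M A = measure M A * measure M A" by (simp add: LIMSEQ_const_iff)
  then show ?thesis by auto
qed

lemma measure_PiM_cylinder:
  assumes "prob_space P" "finite J" "\<And>j. j \<in> J \<Longrightarrow> E j \<in> sets P"
  shows "measure (PiM UNIV (\<lambda>_. P)) {x \<in> space (PiM UNIV (\<lambda>_. P)). \<forall>j\<in>J. x j \<in> E j} = (\<Prod>j\<in>J. measure P (E j))"
proof -
  interpret P: prob_space P by fact
  interpret Q: product_prob_space "\<lambda>_. P" UNIV by unfold_locales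
  have "emeasure (PiM UNIV (\<lambda>_. P)) {x \<in> space (PiM UNIV (\<lambda>_. P)). \<forall>j\<in>J. x j \<in> E j} = ennreal (\<Prod>j\<in>J. measure P (E j))"
    using Q.emeasure_PiM_Collect[of J E] assms(2,3)
    by (simp add: P.emeasure_eq_measure prod_ennreal)
  then show ?thesis by (simp add: measure_def[of "PiM _ _"] prod_nonneg)
qed

text \<open>Once \<open>N\<close> is large, the shifted coordinates of the second cylinder avoid
  those of the first, and independence gives the product exactly.\<close>

lemma PiM_shift_mixing:
  assumes "prob_space P"
  shows "mixing (PiM (UNIV::int set) (\<lambda>_. P)) (\<lambda>N x k. x (k + int N))"
proof (rule mixing_generator[where G="prod_algebra UNIV (\<lambda>_. P)"])
  interpret prob_space P by fact
  let ?M = "PiM (UNIV::int set) (\<lambda>_. P)"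
  show "prob_space ?M" by (intro prob_space_PiM assms)
  show "sets ?M = sigma_sets (space ?M) (prod_algebra UNIV (\<lambda>_. P))" by (simp add: sets_PiM space_PiM)
  show "Int_stable (prod_algebra (UNIV::int set) (\<lambda>_. P))" by (rule Int_stable_prod_algebra)
  show "prod_algebra UNIV (\<lambda>_. P) \<subseteq> Pow (space ?M)" using prod_algebra_sets_into_space by (simp add: space_PiM)
  show "(\<lambda>x k. x (k + int N)) \<in> measurable ?M ?M" for N
    using measurable_restrict[of UNIV "\<lambda>k x. x (k + int N)" ?M "\<lambda>_. P"] by (simp add: restrict_UNIV)
  show "distr ?M ?M (\<lambda>x k. x (k + int N)) = ?M" for N
    using distr_PiM_reindex[of UNIV "\<lambda>_. P" "\<lambda>k. k + int N" UNIV] assms by (simp add: restrict_UNIV)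
  fix B C assume "B \<in> prod_algebra (UNIV::int set) (\<lambda>_. P)" "C \<in> prod_algebra (UNIV::int set) (\<lambda>_. P)"
  then obtain J E K F where J: "finite J" "\<And>j. j \<in> J \<Longrightarrow> E j \<in> sets P" and K: "finite K" "\<And>j. j \<in> K \<Longrightarrow> F j \<in> sets P"
    and B: "B = prod_emb UNIV (\<lambda>_. P) J (Pi\<^sub>E J E)" and C: "C = prod_emb UNIV (\<lambda>_. P) K (Pi\<^sub>E K F)"
    by (elim prod_algebraE) blast
  have B: "B = {x \<in> space ?M. \<forall>j\<in>J. x j \<in> E j}" and C: "C = {x \<in> space ?M. \<forall>j\<in>K. x j \<in> F j}"
    unfolding B C by (auto simp: prod_emb_def space_PiM)
  have "\<forall>\<^sub>F N in sequentially. \<forall>j\<in>J. \<forall>k\<in>K. k + int N \<noteq> j"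
  proof (intro eventually_ball_finite ballI J(1) K(1))
    fix j k :: int
    show "\<forall>\<^sub>F N in sequentially. k + int N \<noteq> j"
      by (intro eventually_sequentiallyI[of "nat (j - k) + 1"]) auto
  qed
  then have "\<forall>\<^sub>F N in sequentially. measure ?M B * measure ?M C = measure ?M (B \<inter> ((\<lambda>x k. x (k + int N)) -` C \<inter> space ?M))"
  proof eventually_elim
    case (elim N)
    let ?K = "(\<lambda>k. k + int N) ` K"
    \<comment> \<open>\<open>H\<close> merges the constraints on the disjoint index sets
      \<open>J\<close> and \<open>?K\<close> into one cylinder.\<close>
    define H where "H j = (if j \<in> J then E j else F (j - int N))" for j
    have disj: "J \<inter> ?K = {}" using elim by auto
    have "B \<inter> ((\<lambda>x k. x (k + int N)) -` C \<inter> space ?M) = {x \<in> space ?M. \<forall>j\<in>J \<union> ?K. x j \<in> H j}"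
      using elim unfolding B C H_def by (auto simp: space_PiM PiE_iff ball_Un)
    also have "measure ?M \<dots> = (\<Prod>j\<in>J \<union> ?K. measure P (H j))"
      using J K by (intro measure_PiM_cylinder assms) (auto simp: H_def)
    also have "\<dots> = (\<Prod>j\<in>J. measure P (H j)) * (\<Prod>j\<in>?K. measure P (H j))"
      using J K disj by (intro prod.union_disjoint) auto
    also have "(\<Prod>j\<in>J. measure P (H j)) = measure ?M B"
      unfolding B using J by (subst measure_PiM_cylinder[OF assms]) (auto simp: H_def)
    also have "(\<Prod>j\<in>?K. measure P (H j)) = (\<Prod>k\<in>K. measure P (F k))"
      using elim by (subst prod.reindex) (auto simp: H_def inj_on_def intro!: prod.cong)
    also have "\<dots> = measure ?M C"
      unfolding C using K by (subst measure_PiM_cylinder[OF assms]) auto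
    finally show ?case by simp
  qed
  then show "(\<lambda>N. measure ?M (B \<inter> ((\<lambda>x k. x (k + int N)) -` C \<inter> space ?M))) \<longlonglongrightarrow> measure ?M B * measure ?M C"
    by (rule Lim_transform_eventually[OF tendsto_const])
qed

lemma measure_PiM_PiE:
  assumes M: "\<And>i. i \<in> I \<Longrightarrow> prob_space (M i)" and I: "finite I" and A: "\<And>i. i \<in> I \<Longrightarrow> A i \<in> sets (M i)"
  shows "emeasure (PiM I M) (Pi\<^sub>E I A) = (\<Prod>i\<in>I. emeasure (M i) (A i))"
    "measure (PiM I M) (Pi\<^sub>E I A) = (\<Prod>i\<in>I. measure (M i) (A i))"
proof -
  have "prod_emb I M I (Pi\<^sub>E I A) = Pi\<^sub>E I A"
    using A by (intro prod_emb_PiE_same_index sets.sets_into_space)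
  with emeasure_PiM_emb[of I M I A] assms
  show eq: "emeasure (PiM I M) (Pi\<^sub>E I A) = (\<Prod>i\<in>I. emeasure (M i) (A i))" by simp
  have "(\<Prod>i\<in>I. emeasure (M i) (A i)) = (\<Prod>i\<in>I. ennreal (measure (M i) (A i)))"
    using M by (intro prod.cong refl finite_measure.emeasure_eq_measure) (auto simp: prob_space_def)
  then show "measure (PiM I M) (Pi\<^sub>E I A) = (\<Prod>i\<in>I. measure (M i) (A i))"
    using eq by (simp add: prod_ennreal measure_def[of "PiM _ _"] prod_nonneg)
qed

text \<open>On boxes the measure of the intersection is a finite product over the lines, and the
  limit is taken factor by factor.\<close>

lemma PiM_mixing:
  assumes M: "\<And>i. i \<in> I \<Longrightarrow> prob_space (M i)" and I: "finite I"
    and \<tau>: "\<And>i N. i \<in> I \<Longrightarrow> \<tau> i N \<in> measurable (M i) (M i)"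
    and pres: "\<And>i N. i \<in> I \<Longrightarrow> distr (M i) (M i) (\<tau> i N) = M i"
    and mix: "\<And>i. i \<in> I \<Longrightarrow> mixing (M i) (\<tau> i)"
  shows "mixing (PiM I M) (\<lambda>N x. \<lambda>i\<in>I. \<tau> i N (x i))"
proof (rule mixing_generator[where G="prod_algebra I M"])
  show "prob_space (PiM I M)" by (intro prob_space_PiM M)
  show "sets (PiM I M) = sigma_sets (space (PiM I M)) (prod_algebra I M)" by (simp add: sets_PiM space_PiM)
  show "Int_stable (prod_algebra I M)" by (rule Int_stable_prod_algebra)
  show "prod_algebra I M \<subseteq> Pow (space (PiM I M))" using prod_algebra_sets_into_space by (simp add: space_PiM)
  show "(\<lambda>x. \<lambda>i\<in>I. \<tau> i N (x i)) \<in> measurable (PiM I M) (PiM I M)" for N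
  proof (rule measurable_restrict)
    fix i assume i: "i \<in> I"
    show "(\<lambda>x. \<tau> i N (x i)) \<in> measurable (PiM I M) (M i)"
      by (rule measurable_compose[OF measurable_component_singleton[OF i, where M=M] \<tau>[OF i]])
  qed
  show "distr (PiM I M) (PiM I M) (\<lambda>x. \<lambda>i\<in>I. \<tau> i N (x i)) = PiM I M" for N
    using distr_PiM_componentwise[of I M "\<lambda>i. \<tau> i N" M] M \<tau> pres by (simp cong: PiM_cong)
  fix B C assume "B \<in> prod_algebra I M" "C \<in> prod_algebra I M"
  then obtain E F where B: "B = Pi\<^sub>E I E" and C: "C = Pi\<^sub>E I F"
    and EF: "\<And>i. i \<in> I \<Longrightarrow> E i \<in> sets (M i)" "\<And>i. i \<in> I \<Longrightarrow> F i \<in> sets (M i)"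
    unfolding prod_algebra_eq_finite[OF I] by blast
  have "B \<inter> ((\<lambda>x. \<lambda>i\<in>I. \<tau> i N (x i)) -` C \<inter> space (PiM I M)) =
      Pi\<^sub>E I (\<lambda>i. E i \<inter> (\<tau> i N -` F i \<inter> space (M i)))" for N
  proof (rule set_eqI)
    fix x
    have "x i \<in> space (M i)" if "x \<in> Pi\<^sub>E I E" "i \<in> I" for i
      using that EF(1)[OF that(2), THEN sets.sets_into_space] by (auto simp: PiE_iff)
    then show "x \<in> B \<inter> ((\<lambda>x. \<lambda>i\<in>I. \<tau> i N (x i)) -` C \<inter> space (PiM I M)) \<longleftrightarrow>
      x \<in> Pi\<^sub>E I (\<lambda>i. E i \<inter> (\<tau> i N -` F i \<inter> space (M i)))"
      unfolding B C by (auto simp: space_PiM PiE_iff)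
  qed
  moreover have "\<tau> i N -` F i \<inter> space (M i) \<in> sets (M i)" if "i \<in> I" for i N
    using EF(2)[OF that] by (rule measurable_sets[OF \<tau>[OF that]])
  ultimately have eq: "measure (PiM I M) (B \<inter> ((\<lambda>x. \<lambda>i\<in>I. \<tau> i N (x i)) -` C \<inter> space (PiM I M))) =
      (\<Prod>i\<in>I. measure (M i) (E i \<inter> (\<tau> i N -` F i \<inter> space (M i))))" for N
    using EF(1) by (simp add: measure_PiM_PiE(2)[OF M I])
  have "(\<lambda>N. \<Prod>i\<in>I. measure (M i) (E i \<inter> (\<tau> i N -` F i \<inter> space (M i)))) \<longlonglongrightarrow>
      (\<Prod>i\<in>I. measure (M i) (E i) * measure (M i) (F i))"
    using mix EF by (intro tendsto_prod) (auto simp: mixing_def)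
  then show "(\<lambda>N. measure (PiM I M) (B \<inter> ((\<lambda>x. \<lambda>i\<in>I. \<tau> i N (x i)) -` C \<inter> space (PiM I M)))) \<longlonglongrightarrow>
      measure (PiM I M) B * measure (PiM I M) C"
    unfolding eq using EF by (simp add: B C measure_PiM_PiE(2)[OF M I] prod.distrib)
qed

section \<open>Burke's theorem\<close>

text \<open>Each of the regions \<open>x < i\<close> and \<open>i \<le> x\<close>, with indicators
  \<open>ind\<close> and \<open>jnd\<close>, is mapped to itself by a permutation of coordinates and
  a shift of one of them; Fubini's theorem and translation invariance therefore suffice.\<close>

lemma lborel_queue_invariant:
  fixes H :: "real \<times> real \<times> real \<Rightarrow> ennreal"
  assumes [measurable]: "H \<in> borel_measurable (borel \<Otimes>\<^sub>M borel \<Otimes>\<^sub>M borel)"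
  shows "(\<integral>\<^sup>+x. \<integral>\<^sup>+i. \<integral>\<^sup>+w. H (w + max 0 (i - x), w + max 0 (x - i), min i x) \<partial>lborel \<partial>lborel \<partial>lborel) =
    (\<integral>\<^sup>+x. \<integral>\<^sup>+i. \<integral>\<^sup>+w. H (i, x, w) \<partial>lborel \<partial>lborel \<partial>lborel)"
proof -
  let ?L3 = "\<lambda>F :: real \<Rightarrow> real \<Rightarrow> real \<Rightarrow> ennreal. \<integral>\<^sup>+x. \<integral>\<^sup>+i. \<integral>\<^sup>+w. F x i w \<partial>lborel \<partial>lborel \<partial>lborel"
  define ind :: "real \<Rightarrow> real \<Rightarrow> ennreal" where "ind x i = (if x < i then 1 else 0)" for x i
  define jnd :: "real \<Rightarrow> real \<Rightarrow> ennreal" where "jnd x i = (if i \<le> x then 1 else 0)" for x i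
  have [measurable]: "(\<lambda>p. ind (f p) (g p)) \<in> borel_measurable M" "(\<lambda>p. jnd (f p) (g p)) \<in> borel_measurable M"
    if [measurable]: "f \<in> borel_measurable M" "g \<in> borel_measurable M" for f g and M :: "'z measure"
    unfolding ind_def jnd_def by measurable
  have shift: "(\<integral>\<^sup>+y. f y \<partial>lborel) = (\<integral>\<^sup>+y. f (t + y) \<partial>lborel)"
    if "f \<in> borel_measurable borel" for f :: "real \<Rightarrow> ennreal" and t
    using nn_integral_real_affine[OF that, of 1 t] by simp
  have 1: "?L3 (\<lambda>x i w. ind x i * H (w + i - x, w, x)) =
    ?L3 (\<lambda>x i w. ind x i * H (i, x, w))"
  proof -
    have "?L3 (\<lambda>x i w. ind x i * H (w + i - x, w, x)) =
        ?L3 (\<lambda>x w i. ind x i * H (w + i - x, w, x))"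
      by (rule nn_integral_cong, rule lborel_pair.Fubini') measurable
    \<comment> \<open>Translating \<open>i\<close> by \<open>w - x\<close> makes the departure
      coordinate \<open>w + i - x\<close> a free variable and turns the condition
      \<open>x < i\<close> into \<open>w < i\<close>.\<close>
    also have "\<dots> = ?L3 (\<lambda>x w i. ind w i * H (i, w, x))"
    proof (rule nn_integral_cong, rule nn_integral_cong)
      fix x w :: real
      have "(\<integral>\<^sup>+i. ind w i * H (i, w, x) \<partial>lborel) = (\<integral>\<^sup>+i. ind w (w - x + i) * H (w - x + i, w, x) \<partial>lborel)"
        by (rule shift) measurable
      also have "\<dots> = (\<integral>\<^sup>+i. ind x i * H (w + i - x, w, x) \<partial>lborel)"
        by (intro nn_integral_cong) (auto simp: ind_def algebra_simps)
      finally show "(\<integral>\<^sup>+i. ind x i * H (w + i - x, w, x) \<partial>lborel) = (\<integral>\<^sup>+i. ind w i * H (i, w, x) \<partial>lborel)" by simp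
    qed
    also have "\<dots> = ?L3 (\<lambda>w x i. ind w i * H (i, w, x))"
      by (rule lborel_pair.Fubini') measurable
    also have "\<dots> = ?L3 (\<lambda>w i x. ind w i * H (i, w, x))"
      by (rule nn_integral_cong, rule lborel_pair.Fubini') measurable
    finally show ?thesis .
  qed
  have 2: "?L3 (\<lambda>x i w. jnd x i * H (w, w + x - i, i)) =
    ?L3 (\<lambda>x i w. jnd x i * H (i, x, w))"
  proof -
    have "?L3 (\<lambda>x i w. jnd x i * H (w, w + x - i, i)) =
        ?L3 (\<lambda>i x w. jnd x i * H (w, w + x - i, i))"
      by (rule lborel_pair.Fubini') measurable
    also have "\<dots> = ?L3 (\<lambda>i w x. jnd x i * H (w, w + x - i, i))"
      by (rule nn_integral_cong, rule lborel_pair.Fubini') measurable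
    also have "\<dots> = ?L3 (\<lambda>i w x. jnd x w * H (w, x, i))"
    proof (rule nn_integral_cong, rule nn_integral_cong)
      fix i w :: real
      have "(\<integral>\<^sup>+x. jnd x w * H (w, x, i) \<partial>lborel) = (\<integral>\<^sup>+x. jnd (w - i + x) w * H (w, w - i + x, i) \<partial>lborel)"
        by (rule shift) measurable
      also have "\<dots> = (\<integral>\<^sup>+x. jnd x i * H (w, w + x - i, i) \<partial>lborel)"
        by (intro nn_integral_cong) (auto simp: jnd_def algebra_simps)
      finally show "(\<integral>\<^sup>+x. jnd x i * H (w, w + x - i, i) \<partial>lborel) = (\<integral>\<^sup>+x. jnd x w * H (w, x, i) \<partial>lborel)" by simp
    qed
    also have "\<dots> = ?L3 (\<lambda>w i x. jnd x w * H (w, x, i))"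
      by (rule lborel_pair.Fubini') measurable
    also have "\<dots> = ?L3 (\<lambda>w x i. jnd x w * H (w, x, i))"
      by (rule nn_integral_cong, rule lborel_pair.Fubini') measurable
    also have "\<dots> = ?L3 (\<lambda>x w i. jnd x w * H (w, x, i))"
      by (rule lborel_pair.Fubini') measurable
    finally show ?thesis .
  qed
  have split: "?L3 (\<lambda>x i w. K (x, i, w) + L (x, i, w)) =
      ?L3 (\<lambda>x i w. K (x, i, w)) + ?L3 (\<lambda>x i w. L (x, i, w))"
    if [measurable]: "K \<in> borel_measurable (borel \<Otimes>\<^sub>M borel \<Otimes>\<^sub>M borel)"
      "L \<in> borel_measurable (borel \<Otimes>\<^sub>M borel \<Otimes>\<^sub>M borel)"
    for K L :: "real \<times> real \<times> real \<Rightarrow> ennreal"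
    by (simp add: nn_integral_add)
  have "?L3 (\<lambda>x i w. H (w + max 0 (i - x), w + max 0 (x - i), min i x)) =
    ?L3 (\<lambda>x i w. ind x i * H (w + i - x, w, x) + jnd x i * H (w, w + x - i, i))"
    by (intro nn_integral_cong) (auto simp: ind_def jnd_def max_def min_def algebra_simps)
  also have "\<dots> = ?L3 (\<lambda>x i w. ind x i * H (i, x, w) + jnd x i * H (i, x, w))"
    using split[of "\<lambda>(x, i, w). ind x i * H (w + i - x, w, x)" "\<lambda>(x, i, w). jnd x i * H (w, w + x - i, i)"]
      split[of "\<lambda>(x, i, w). ind x i * H (i, x, w)" "\<lambda>(x, i, w). jnd x i * H (i, x, w)"]
    by (simp add: 1 2)
  also have "\<dots> = ?L3 (\<lambda>x i w. H (i, x, w))"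
    by (intro nn_integral_cong) (auto simp: ind_def jnd_def)
  finally show ?thesis .
qed

text \<open>One step of the queue in equilibrium: interarrival time \<open>i\<close>, sojourn time \<open>x\<close> and service
  time \<open>w\<close> of the previous step are mapped, by a volume-preserving involution of the octant that
  leaves the joint density unchanged, to interdeparture time, new sojourn time and dual service.\<close>

lemma expm_queue_step:
  assumes a: "0 < a" "a < b" and c: "1 / c = 1 / a - 1 / b"
    and [measurable]: "A \<in> sets borel" "B \<in> sets borel" "g \<in> borel_measurable borel"
  shows "(\<integral>\<^sup>+x. \<integral>\<^sup>+i. \<integral>\<^sup>+w. indicator A (w + max 0 (i - x)) * indicator B (min i x) * g (w + max 0 (x - i))
      \<partial>expm a \<partial>expm b \<partial>expm c) = emeasure (expm b) A * emeasure (expm a) B * (\<integral>\<^sup>+x. g x \<partial>expm c)"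
proof -
  let ?e = "\<lambda>r x. ennreal (exponential_density (1 / r) x)"
  define H where "H = (\<lambda>(i, x, w). ?e c x * (?e b i * (?e a w * (indicator A i * indicator B w * g x))))"
  have [measurable]: "H \<in> borel_measurable (borel \<Otimes>\<^sub>M borel \<Otimes>\<^sub>M borel)"
    unfolding H_def by measurable
  have cpos: "c > 0"
  proof -
    have "1 / c > 0" unfolding c using a by (simp add: field_simps)
    then show ?thesis by simp
  qed
  have pos: "0 \<le> exponential_density (1 / r) x" if "r > 0" for r x
    using that by (intro exponential_density_nonneg) simp
  \<comment> \<open>The coefficient of \<open>w\<close> in the exponents shows where the law of the
    sojourn time comes from: \<open>1 / a = 1 / b + 1 / c\<close>. Outside the octant both sides
    vanish, since some image coordinate is negative as well.\<close>
  have dens: "exponential_density (1 / c) x * (exponential_density (1 / b) i * exponential_density (1 / a) w) =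
      exponential_density (1 / c) (w + max 0 (x - i)) * (exponential_density (1 / b) (w + max 0 (i - x)) * exponential_density (1 / a) (min i x))"
    for x i w
  proof (cases "x \<ge> 0 \<and> i \<ge> 0 \<and> w \<ge> 0")
    case True
    have "- x * (1 / c) + (- i * (1 / b) + - w * (1 / a)) =
      - (w + max 0 (x - i)) * (1 / c) + (- (w + max 0 (i - x)) * (1 / b) + - min i x * (1 / a))"
      unfolding c by (cases "x < i") (simp_all add: max_def min_def algebra_simps add_divide_distrib)
    then have expeq: "exp (- x * (1 / c)) * (exp (- i * (1 / b)) * exp (- w * (1 / a))) =
      exp (- (w + max 0 (x - i)) * (1 / c)) * (exp (- (w + max 0 (i - x)) * (1 / b)) * exp (- min i x * (1 / a)))"
      by (simp only: exp_add[symmetric])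
    have e: "exponential_density r y = r * exp (- y * r)" if "\<not> y < 0" for r y
      using that by (simp add: exponential_density_def)
    have nonneg: "\<not> x < 0" "\<not> i < 0" "\<not> w < 0" "\<not> w + max 0 (x - i) < 0" "\<not> w + max 0 (i - x) < 0" "\<not> min i x < 0"
      using True by auto
    have "p * E1 * (q * E2 * (r * E3)) = p * F1 * (q * F2 * (r * F3))"
      if "E1 * (E2 * E3) = F1 * (F2 * F3)" for p q r E1 E2 E3 F1 F2 F3 :: real
    proof -
      have "p * X1 * (q * X2 * (r * X3)) = p * q * r * (X1 * (X2 * X3))" for X1 X2 X3 :: real
        by (simp only: mult_ac)
      then show ?thesis using that by simp
    qed
    from this[OF expeq] show ?thesis unfolding e[OF nonneg(1)] e[OF nonneg(2)] e[OF nonneg(3)]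
      e[OF nonneg(4)] e[OF nonneg(5)] e[OF nonneg(6)] .
  next
    case False
    then have "w + max 0 (x - i) < 0 \<or> w + max 0 (i - x) < 0 \<or> min i x < 0"
      by (auto simp: max_def min_def)
    with False show ?thesis by (auto simp: exponential_density_def)
  qed
  have edens: "?e c x * (?e b i * ?e a w) =
      ?e c (w + max 0 (x - i)) * (?e b (w + max 0 (i - x)) * ?e a (min i x))" for x i w
  proof -
    have "ennreal X * (ennreal Y * ennreal Z) = ennreal (X * (Y * Z))" if "0 \<le> X" "0 \<le> Y" "0 \<le> Z" for X Y Z
      using that by (simp add: ennreal_mult)
    from this[OF pos pos pos] show ?thesis using a cpos by (simp only: dens[of x i w])
  qed
  have "(\<integral>\<^sup>+x. \<integral>\<^sup>+i. \<integral>\<^sup>+w. indicator A (w + max 0 (i - x)) * indicator B (min i x) * g (w + max 0 (x - i))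
      \<partial>expm a \<partial>expm b \<partial>expm c) = (\<integral>\<^sup>+x. \<integral>\<^sup>+i. \<integral>\<^sup>+w. ?e c x * (?e b i * (?e a w * (indicator A (w + max 0 (i - x)) * indicator B (min i x) * g (w + max 0 (x - i)))))
      \<partial>lborel \<partial>lborel \<partial>lborel)"
    by (simp add: nn_integral_expm nn_integral_cmult)
  also have "\<dots> = (\<integral>\<^sup>+x. \<integral>\<^sup>+i. \<integral>\<^sup>+w. H (w + max 0 (i - x), w + max 0 (x - i), min i x) \<partial>lborel \<partial>lborel \<partial>lborel)"
  proof (intro nn_integral_cong)
    fix x i w :: real
    have "p * (q * (r * s)) = p' * (q' * (r' * s))" if "p * (q * r) = p' * (q' * r')" for p q r s p' q' r' :: ennreal
    proof -
      have assoc: "p * (q * (r * s)) = p * (q * r) * s" for p q r by (simp add: mult.assoc)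
      show ?thesis unfolding assoc that ..
    qed
    from this[OF edens]
    show "?e c x * (?e b i * (?e a w * (indicator A (w + max 0 (i - x)) * indicator B (min i x) * g (w + max 0 (x - i))))) =
      H (w + max 0 (i - x), w + max 0 (x - i), min i x)"
      unfolding H_def prod.case .
  qed
  also have "\<dots> = (\<integral>\<^sup>+x. \<integral>\<^sup>+i. \<integral>\<^sup>+w. H (i, x, w) \<partial>lborel \<partial>lborel \<partial>lborel)"
    by (rule lborel_queue_invariant) measurable
  also have "\<dots> = (\<integral>\<^sup>+x. \<integral>\<^sup>+i. \<integral>\<^sup>+w. indicator A i * indicator B w * g x \<partial>expm a \<partial>expm b \<partial>expm c)"
    unfolding H_def by (simp add: nn_integral_expm nn_integral_cmult)
  also have "\<dots> = (\<integral>\<^sup>+x. \<integral>\<^sup>+i. (emeasure (expm a) B * g x) * indicator A i \<partial>expm b \<partial>expm c)"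
  proof (rule nn_integral_cong, rule nn_integral_cong)
    fix x i :: real
    have "(\<integral>\<^sup>+w. indicator A i * indicator B w * g x \<partial>expm a) = (\<integral>\<^sup>+w. (indicator A i * g x) * indicator B w \<partial>expm a)"
      by (intro nn_integral_cong) (simp add: mult_ac)
    also have "\<dots> = indicator A i * g x * emeasure (expm a) B" by (subst nn_integral_cmult_indicator) auto
    finally show "(\<integral>\<^sup>+w. indicator A i * indicator B w * g x \<partial>expm a) = (emeasure (expm a) B * g x) * indicator A i"
      by (simp add: mult_ac)
  qed
  also have "\<dots> = (\<integral>\<^sup>+x. emeasure (expm b) A * emeasure (expm a) B * g x \<partial>expm c)"
    by (rule nn_integral_cong, subst nn_integral_cmult_indicator) (auto simp: mult_ac)
  also have "\<dots> = emeasure (expm b) A * emeasure (expm a) B * (\<integral>\<^sup>+x. g x \<partial>expm c)"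
    by (rule nn_integral_cmult) measurable
  finally show ?thesis .
qed

section \<open>Measurability of the queue\<close>

lemma zdiff_measurable [measurable]:
  assumes [measurable]: "\<And>k. (\<lambda>p. f p k) \<in> borel_measurable M" "\<And>k. (\<lambda>p. g p k) \<in> borel_measurable M"
  shows "(\<lambda>p. zdiff (f p) (g p) k) \<in> borel_measurable M"
  unfolding zdiff_def by measurable

lemma rmax_measurable [measurable]:
  assumes [measurable]: "\<And>k. (\<lambda>p. f p k) \<in> borel_measurable M" "\<And>k. (\<lambda>p. g p k) \<in> borel_measurable M"
  shows "(\<lambda>p. rmax (f p) (g p) k) \<in> borel_measurable M"
  unfolding rmax_def by (intro borel_measurable_lim_metric borel_measurable_Max) measurable

lemma qD_measurable [measurable]:
  assumes [measurable]: "\<And>k. (\<lambda>p. f p k) \<in> borel_measurable M" "\<And>k. (\<lambda>p. g p k) \<in> borel_measurable M"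
  shows "(\<lambda>p. qD (f p) (g p) k) \<in> borel_measurable M"
  unfolding qD_def by measurable

lemma qR_measurable [measurable]:
  assumes [measurable]: "\<And>k. (\<lambda>p. f p k) \<in> borel_measurable M" "\<And>k. (\<lambda>p. g p k) \<in> borel_measurable M"
  shows "(\<lambda>p. qR (f p) (g p) k) \<in> borel_measurable M"
  unfolding qR_def by measurable

lemma measurable_into_line:
  assumes "\<And>k. (\<lambda>p. f p k) \<in> borel_measurable M"
  shows "f \<in> measurable M (line r)"
proof -
  have "(\<lambda>p. \<lambda>k\<in>UNIV. f p k) \<in> measurable M (PiM UNIV (\<lambda>_. borel))"
    by (intro measurable_restrict assms)
  then show ?thesis by (simp add: restrict_UNIV measurable_cong_sets[OF refl sets_line])
qed

text \<open>\<open>wl n s x\<close> is the sojourn time of customer \<open>s + n\<close> when that of customer \<open>s\<close> is \<open>x\<close>.\<close>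

fun wl :: "(int \<Rightarrow> real) \<Rightarrow> (int \<Rightarrow> real) \<Rightarrow> nat \<Rightarrow> int \<Rightarrow> real \<Rightarrow> real" where
  "wl I \<omega> 0 s x = x"
| "wl I \<omega> (Suc n) s x = wl I \<omega> n (s + 1) (\<omega> (s + 1) + max 0 (x - I (s + 1)))"

text \<open>Lindley's recursion unrolled: the initial value \<open>x\<close> adds one candidate to
  the maximum of the walk over the window. With \<open>Suc n\<close> steps the window is
  nonempty.\<close>

lemma wl_formula:
  "wl I \<omega> (Suc n) s x = psum \<omega> (s + 1 + int n) - psum I (s + 1 + int n) +
    max (x + psum I s - psum \<omega> s) (Max (zdiff I \<omega> ` {s+1..s + 1 + int n}))"
proof (induction n arbitrary: s x)
  case 0
  show ?case using psum_diff[of I "s + 1"] psum_diff[of \<omega> "s + 1"] by (simp add: zdiff_def max_def)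
next
  case (Suc n)
  have ins: "{s+1..s + 1 + int (Suc n)} = insert (s + 1) {s+1+1..s+1+1+int n}" by auto
  have "wl I \<omega> (Suc (Suc n)) s x = wl I \<omega> (Suc n) (s + 1) (\<omega> (s + 1) + max 0 (x - I (s + 1)))"
    by simp
  also have "\<dots> = psum \<omega> (s+1+1+int n) - psum I (s+1+1+int n) +
      max (\<omega> (s + 1) + max 0 (x - I (s + 1)) + psum I (s+1) - psum \<omega> (s+1)) (Max (zdiff I \<omega> ` {s+1+1..s+1+1+int n}))"
    by (rule Suc.IH)
  also have "\<omega> (s + 1) + max 0 (x - I (s + 1)) + psum I (s+1) - psum \<omega> (s+1) =
      max (x + psum I s - psum \<omega> s) (zdiff I \<omega> (s + 1))"
    using psum_diff[of I "s + 1"] psum_diff[of \<omega> "s + 1"] by (simp add: zdiff_def max_def)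
  also have "max (max (x + psum I s - psum \<omega> s) (zdiff I \<omega> (s + 1))) (Max (zdiff I \<omega> ` {s+1+1..s+1+1+int n})) =
      max (x + psum I s - psum \<omega> s) (Max (zdiff I \<omega> ` {s+1..s+1+int (Suc n)}))"
    unfolding ins by (simp add: max.assoc)
  also have "s + 1 + 1 + int n = s + 1 + int (Suc n)" by simp
  finally show ?case .
qed

text \<open>As the start moves into the past, the candidate that carries \<open>x\<close> falls with
  the walk while the maximiser for \<open>t\<close> enters the window. From then on the start is
  forgotten exactly.\<close>

lemma wl_coalescence:
  assumes adm: "adm I \<omega>" and nn: "\<And>k. 0 \<le> \<omega> k"
  shows "\<forall>\<^sub>F n in sequentially. wl I \<omega> n (t - int n) x = soj I \<omega> t"
proof -
  obtain k where k: "k \<le> t" "rmax I \<omega> t = zdiff I \<omega> k" using rmax_max(1)[OF adm] by blast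
  have "\<forall>\<^sub>F m in at_bot. zdiff I \<omega> m \<le> rmax I \<omega> t - x"
    using adm unfolding adm_def filterlim_at_bot by blast
  then obtain K where K: "\<And>m. m \<le> K \<Longrightarrow> zdiff I \<omega> m \<le> rmax I \<omega> t - x"
    unfolding eventually_at_bot_linorder by blast
  \<comment> \<open>\<open>t - K\<close> puts the start where the walk is at most
    \<open>rmax I \<omega> t - x\<close>; \<open>t - k\<close> puts the maximiser \<open>k\<close>
    into the window.\<close>
  have "wl I \<omega> n (t - int n) x = soj I \<omega> t" if n: "n \<ge> nat (t - K) + nat (t - k) + 1" for n
  proof -
    obtain n' where n': "n = Suc n'" using n by (cases n) auto
    let ?s = "t - int n"
    have st: "?s + 1 + int n' = t" using n' by simp
    have sk: "?s + 1 \<le> k" "?s \<le> K" using n by auto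
    have "Max (zdiff I \<omega> ` {?s+1..t}) = rmax I \<omega> t"
    proof (rule Max_eqI)
      show "rmax I \<omega> t \<in> zdiff I \<omega> ` {?s+1..t}" using k sk by auto
      show "y \<le> rmax I \<omega> t" if "y \<in> zdiff I \<omega> ` {?s+1..t}" for y
        using that rmax_max(2)[OF adm] by auto
    qed simp
    \<comment> \<open>\<open>zdiff\<close> has \<open>psum \<omega> (?s - 1)\<close> where this
      candidate has \<open>psum \<omega> ?s\<close>; nonnegative services close the gap.\<close>
    moreover have "x + psum I ?s - psum \<omega> ?s \<le> rmax I \<omega> t"
      using K[OF sk(2)] nn[of ?s] psum_diff[of \<omega> ?s] by (simp add: zdiff_def)
    ultimately show ?thesis
      unfolding n' wl_formula unfolding n'[symmetric] st by (simp add: soj_def max_def)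
  qed
  then show ?thesis by (intro eventually_sequentiallyI)
qed

text \<open>The event that customers \<open>s + 1, \<dots>, s + n\<close> have interdeparture times in \<open>A\<close> and dual service times
  in \<open>B\<close>, as a recursion in the sojourn time \<open>x\<close> of customer \<open>s\<close>; Fubini then integrates out one customer at a time.\<close>

fun burke_ind :: "(int \<Rightarrow> real set) \<Rightarrow> (int \<Rightarrow> real set) \<Rightarrow> nat \<Rightarrow> int \<Rightarrow> real \<Rightarrow> (int \<Rightarrow> real) \<Rightarrow> (int \<Rightarrow> real) \<Rightarrow> ennreal" where
  "burke_ind A B 0 s x I \<omega> = 1"
| "burke_ind A B (Suc n) s x I \<omega> =
    indicator (A (s + 1)) (\<omega> (s + 1) + max 0 (I (s + 1) - x)) * indicator (B (s + 1)) (min (I (s + 1)) x) *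
    burke_ind A B n (s + 1) (\<omega> (s + 1) + max 0 (x - I (s + 1))) I \<omega>"

lemma burke_ind_measurable [measurable (raw)]:
  assumes [measurable]: "\<And>k. A k \<in> sets borel" "\<And>k. B k \<in> sets borel"
  assumes "f \<in> borel_measurable M" and [measurable]: "\<And>k. (\<lambda>p. g p k) \<in> borel_measurable M" "\<And>k. (\<lambda>p. h p k) \<in> borel_measurable M"
  shows "(\<lambda>p. burke_ind A B n s (f p) (g p) (h p)) \<in> borel_measurable M"
  using assms(3)
proof (induction n arbitrary: s f)
  case (Suc n)
  note [measurable] = Suc.prems
  have [measurable]: "(\<lambda>p. burke_ind A B n (s + 1) (h p (s + 1) + max 0 (f p - g p (s + 1))) (g p) (h p)) \<in> borel_measurable M"
    by (rule Suc.IH) measurable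
  show ?case unfolding burke_ind.simps by measurable
qed simp

text \<open>Only customers after \<open>s\<close> are read; this separates a coordinate from the
  recursion that starts there.\<close>

lemma burke_ind_cong:
  assumes "\<And>k. k > s \<Longrightarrow> I k = I' k" "\<And>k. k > s \<Longrightarrow> \<omega> k = \<omega>' k"
  shows "burke_ind A B n s x I \<omega> = burke_ind A B n s x I' \<omega>'"
  using assms by (induction n arbitrary: s x) auto

lemma burke_ind_le_1: "burke_ind A B n s x I \<omega> \<le> 1"
proof (induction n arbitrary: s x)
  case (Suc n)
  then show ?case by (auto simp: indicator_def)
qed simp

text \<open>Started from the true sojourn time, the recursion evaluates exactly the right-hand sides
  of \<open>qD_soj\<close>, \<open>qR_soj\<close> and \<open>soj_step\<close>.\<close>

lemma burke_ind_soj: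
  assumes "adm I \<omega>"
  shows "burke_ind A B n s (soj I \<omega> s) I \<omega> =
    (if \<forall>k\<in>{s+1..s + int n}. qD I \<omega> k \<in> A k \<and> qR I \<omega> k \<in> B k then 1 else 0)"
proof (induction n arbitrary: s)
  case (Suc n)
  have ins: "{s+1..s + int (Suc n)} = insert (s + 1) {s+1+1..s + 1 + int n}" by auto
  show ?case
    unfolding burke_ind.simps ins ball_simps
    using Suc[of "s + 1"] qD_soj[OF assms, of "s + 1"] qR_soj[OF assms, of "s + 1"] soj_step[OF assms, of "s + 1"]
    by (auto simp: indicator_def)
qed simp

text \<open>Unconstrained customers only propagate the sojourn time, so they act as a warm-up of
  length \<open>n\<close>.\<close>

lemma burke_ind_prefix:
  assumes "\<And>k. k \<le> s + int n \<Longrightarrow> A k = UNIV \<and> B k = UNIV"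
  shows "burke_ind A B (n + m) s x I \<omega> = burke_ind A B m (s + int n) (wl I \<omega> n s x) I \<omega>"
  using assms
proof (induction n arbitrary: s x)
  case (Suc n)
  then show ?case using Suc.IH[of "s + 1"] by (simp add: add.assoc add.commute add.left_commute)
qed simp

section \<open>Integrating out one coordinate\<close>

lemma nn_integral_PiM_insert:
  assumes M: "\<And>i. i \<in> I \<Longrightarrow> prob_space (M i)" "prob_space (M j)"
    and f: "f \<in> borel_measurable (PiM (insert j I) M)"
  shows "(\<integral>\<^sup>+x. f x \<partial>PiM (insert j I) M) = (\<integral>\<^sup>+y. \<integral>\<^sup>+x. f (x(j := y)) \<partial>PiM I M \<partial>M j)"
proof -
  interpret I: prob_space "PiM I M" using M(1) by (rule prob_space_PiM)
  have m: "(\<lambda>(y, x). x(j := y)) \<in> measurable (M j \<Otimes>\<^sub>M PiM I M) (PiM (insert j I) M)"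
    unfolding case_prod_unfold by (rule measurable_fun_upd[where J=I]) auto
  have "(\<integral>\<^sup>+x. f x \<partial>PiM (insert j I) M) = (\<integral>\<^sup>+p. f (case p of (y, x) \<Rightarrow> x(j := y)) \<partial>(M j \<Otimes>\<^sub>M PiM I M))"
    using f distr_pair_PiM_eq_PiM[where M=M and I=I and i'=j] M nn_integral_distr[OF m, of f] by simp
  also have "\<dots> = (\<integral>\<^sup>+y. \<integral>\<^sup>+x. f (x(j := y)) \<partial>PiM I M \<partial>M j)"
    using measurable_compose[OF m f] by (subst I.nn_integral_fst[symmetric]) (auto simp: case_prod_unfold)
  finally show ?thesis .
qed

text \<open>The index \<open>k\<close> already belongs to \<open>UNIV\<close>: its coordinate is
  overwritten by an independent variable of the same law, which does not change the law of the
  sequence.\<close>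

lemma nn_integral_line_split:
  assumes "r > 0" "f \<in> borel_measurable (line r)"
  shows "(\<integral>\<^sup>+X. f X \<partial>line r) = (\<integral>\<^sup>+y. \<integral>\<^sup>+X. f (X(k := y)) \<partial>line r \<partial>expm r)"
  using nn_integral_PiM_insert[of UNIV "\<lambda>_. expm r" k f] assms prob_space_expm by simp

lemma AE_pair_fst_snd:
  assumes "prob_space M" "prob_space N"
  shows "AE x in M. P x \<Longrightarrow> AE p in M \<Otimes>\<^sub>M N. P (fst p)"
    "AE y in N. Q y \<Longrightarrow> AE p in M \<Otimes>\<^sub>M N. Q (snd p)"
proof -
  interpret M: prob_space M by fact
  interpret N: prob_space N by fact
  show "AE p in M \<Otimes>\<^sub>M N. P (fst p)" if "AE x in M. P x"
  proof -
    from that obtain Z where Z: "Z \<in> null_sets M" "{x\<in>space M. \<not> P x} \<subseteq> Z"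
      unfolding eventually_ae_filter by blast
    then have "Z \<times> space N \<in> null_sets (M \<Otimes>\<^sub>M N)"
      by (auto simp: null_sets_def N.emeasure_pair_measure_Times)
    then show ?thesis by (rule AE_I') (use Z(2) in \<open>auto simp: space_pair_measure\<close>)
  qed
  show "AE p in M \<Otimes>\<^sub>M N. Q (snd p)" if "AE y in N. Q y"
  proof -
    from that obtain Z where Z: "Z \<in> null_sets N" "{x\<in>space N. \<not> Q x} \<subseteq> Z"
      unfolding eventually_ae_filter by blast
    then have "space M \<times> Z \<in> null_sets (M \<Otimes>\<^sub>M N)"
      by (auto simp: null_sets_def N.emeasure_pair_measure_Times)
    then show ?thesis by (rule AE_I') (use Z(2) in \<open>auto simp: space_pair_measure\<close>)
  qed
qed

lemma line_component_measurable: "(\<lambda>x. x k) \<in> borel_measurable (line r)"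
  by measurable

lemma queue_pair_measurable:
  "(\<lambda>p. (qD (fst p) (snd p), qR (fst p) (snd p))) \<in> measurable (line b \<Otimes>\<^sub>M line a) (line b' \<Otimes>\<^sub>M line a')"
  by (intro measurable_Pair measurable_into_line) measurable

section \<open>One stable queue with exponential arrivals and services\<close>

locale stable_queue =
  fixes a b :: real
  assumes a: "0 < a" "a < b"
begin

lemma b: "0 < b"
  using a by simp

sublocale La: prob_space "line a" by (rule prob_space_line[OF a(1)])
sublocale Lb: prob_space "line b" by (rule prob_space_line[OF b])
sublocale Ea: prob_space "expm a" by (rule prob_space_expm[OF a(1)])
sublocale Eb: prob_space "expm b" by (rule prob_space_expm[OF b])
sublocale LbEa: pair_sigma_finite "line b" "expm a" by unfold_locales
sublocale Q: prob_space "line b \<Otimes>\<^sub>M line a" by (intro prob_space_pair) unfold_locales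

text \<open>\<open>expm_queue_step\<close> splits off the factors of customer \<open>s + 1\<close>
  and returns a sojourn time that again has law \<open>expm c\<close>; the induction hypothesis then
  applies from \<open>s + 1\<close>.\<close>

lemma burke_window:
  assumes c: "1 / c = 1 / a - 1 / b"
    and [measurable]: "\<And>k. A k \<in> sets borel" "\<And>k. B k \<in> sets borel"
  shows "(\<integral>\<^sup>+x. \<integral>\<^sup>+I. \<integral>\<^sup>+\<omega>. burke_ind A B n s x I \<omega> \<partial>line a \<partial>line b \<partial>expm c) =
    (\<Prod>k\<in>{s+1..s + int n}. emeasure (expm b) (A k) * emeasure (expm a) (B k))"
proof -
  have cpos: "c > 0"
  proof -
    have "1 / c > 0" unfolding c using a by (simp add: field_simps)
    then show ?thesis by simp
  qed
  interpret Ec: prob_space "expm c" by (rule prob_space_expm[OF cpos])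
  show ?thesis
  proof (induction n arbitrary: s)
    case 0
    then show ?case by (simp add: La.emeasure_space_1[simplified] Lb.emeasure_space_1[simplified] Ec.emeasure_space_1[simplified])
  next
    case (Suc n)
    define g where "g y = (\<integral>\<^sup>+I. \<integral>\<^sup>+\<omega>. burke_ind A B n (s + 1) y I \<omega> \<partial>line a \<partial>line b)" for y
    have [measurable]: "(\<lambda>p. burke_ind A B n (s + 1) (fst p) (fst (snd p)) (snd (snd p)))
        \<in> borel_measurable (borel \<Otimes>\<^sub>M line b \<Otimes>\<^sub>M line a)"
      by measurable
    have gm [measurable]: "g \<in> borel_measurable borel"
      unfolding g_def by measurable
    let ?F = "\<lambda>x i w. indicator (A (s+1)) (w + max 0 (i - x)) * indicator (B (s+1)) (min i x) :: ennreal"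
    have step: "(\<integral>\<^sup>+I. \<integral>\<^sup>+\<omega>. burke_ind A B (Suc n) s x I \<omega> \<partial>line a \<partial>line b) =
        (\<integral>\<^sup>+i. \<integral>\<^sup>+w. ?F x i w * g (w + max 0 (x - i)) \<partial>expm a \<partial>expm b)" for x
    proof -
      let ?G = "\<lambda>i w I \<omega>. ?F x i w * burke_ind A B n (s + 1) (w + max 0 (x - i)) I \<omega>"
      \<comment> \<open>The new values at \<open>s + 1\<close> are used by the first customer only;
        the remaining window does not see the update.\<close>
      have upd: "burke_ind A B (Suc n) s x (fun_upd I (s + 1) i) (fun_upd \<omega> (s + 1) w) = ?G i w I \<omega>" for i w I \<omega>
        using burke_ind_cong[of "s + 1" "fun_upd I (s + 1) i" I "fun_upd \<omega> (s + 1) w" \<omega>] by simp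
      have "(\<integral>\<^sup>+I. \<integral>\<^sup>+\<omega>. burke_ind A B (Suc n) s x I \<omega> \<partial>line a \<partial>line b) =
          (\<integral>\<^sup>+I. \<integral>\<^sup>+w. \<integral>\<^sup>+\<omega>. burke_ind A B (Suc n) s x I (fun_upd \<omega> (s + 1) w) \<partial>line a \<partial>expm a \<partial>line b)"
        by (rule nn_integral_cong, rule nn_integral_line_split[OF a(1)]) measurable
      also have "\<dots> = (\<integral>\<^sup>+i. \<integral>\<^sup>+I. \<integral>\<^sup>+w. \<integral>\<^sup>+\<omega>. burke_ind A B (Suc n) s x (fun_upd I (s + 1) i) (fun_upd \<omega> (s + 1) w) \<partial>line a \<partial>expm a \<partial>line b \<partial>expm b)"
        by (rule nn_integral_line_split[OF b]) measurable
      also have "\<dots> = (\<integral>\<^sup>+i. \<integral>\<^sup>+w. \<integral>\<^sup>+I. \<integral>\<^sup>+\<omega>. ?G i w I \<omega> \<partial>line a \<partial>line b \<partial>expm a \<partial>expm b)"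
        unfolding upd by (rule nn_integral_cong, rule LbEa.Fubini'[symmetric]) measurable
      also have "\<dots> = (\<integral>\<^sup>+i. \<integral>\<^sup>+w. ?F x i w * g (w + max 0 (x - i)) \<partial>expm a \<partial>expm b)"
      proof (rule nn_integral_cong, rule nn_integral_cong)
        fix i w :: real
        show "(\<integral>\<^sup>+I. \<integral>\<^sup>+\<omega>. ?G i w I \<omega> \<partial>line a \<partial>line b) = ?F x i w * g (w + max 0 (x - i))"
          unfolding g_def by ((subst nn_integral_cmult, measurable)+)
      qed
      finally show ?thesis .
    qed
    have ins: "{s+1..s + int (Suc n)} = insert (s + 1) {s+1+1..s + 1 + int n}" by auto
    have "(\<integral>\<^sup>+x. \<integral>\<^sup>+I. \<integral>\<^sup>+\<omega>. burke_ind A B (Suc n) s x I \<omega> \<partial>line a \<partial>line b \<partial>expm c) =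
        emeasure (expm b) (A (s+1)) * emeasure (expm a) (B (s+1)) * (\<integral>\<^sup>+x. g x \<partial>expm c)"
      unfolding step using a c by (intro expm_queue_step) auto
    also have "(\<integral>\<^sup>+x. g x \<partial>expm c) = (\<Prod>k\<in>{s+1+1..s + 1 + int n}. emeasure (expm b) (A k) * emeasure (expm a) (B k))"
      unfolding g_def by (rule Suc.IH)
    finally show ?case unfolding ins by simp
  qed
qed

text \<open>Starting the queue at time \<open>t - n\<close> with an independent stationary sojourn time gives outputs with the right law for
  every \<open>n\<close>, and as \<open>n\<close> grows these coincide with the outputs of the two-sided queue.\<close>

lemma burke_limit:
  assumes [measurable]: "\<And>k. A k \<in> sets borel" "\<And>k. B k \<in> sets borel"
  shows "emeasure (line b \<Otimes>\<^sub>M line a) {p \<in> space (line b \<Otimes>\<^sub>M line a).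
      \<forall>k\<in>{t+1..t + int m}. qD (fst p) (snd p) k \<in> A k \<and> qR (fst p) (snd p) k \<in> B k} =
    (\<Prod>k\<in>{t+1..t + int m}. emeasure (expm b) (A k) * emeasure (expm a) (B k))"
proof -
  define c where "c = 1 / (1 / a - 1 / b)"
  have c: "1 / c = 1 / a - 1 / b" by (simp add: c_def)
  have cpos: "c > 0" unfolding c_def using a by (simp add: field_simps)
  interpret Ec: prob_space "expm c" by (rule prob_space_expm[OF cpos])
  interpret T: prob_space "expm c \<Otimes>\<^sub>M (line b \<Otimes>\<^sub>M line a)" by (intro prob_space_pair) unfold_locales
  let ?T = "expm c \<Otimes>\<^sub>M (line b \<Otimes>\<^sub>M line a)"
  \<comment> \<open>Customers up to \<open>t\<close> are unconstrained, so they contribute factors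
    one and the integral does not depend on \<open>n\<close>.\<close>
  define A' B' where "A' k = (if k \<le> t then UNIV else A k)" and "B' k = (if k \<le> t then UNIV else B k)" for k
  have [measurable]: "A' k \<in> sets borel" "B' k \<in> sets borel" for k by (simp_all add: A'_def B'_def)
  let ?Q = "line b \<Otimes>\<^sub>M line a"
  let ?R = "\<Prod>k\<in>{t+1..t + int m}. emeasure (expm b) (A k) * emeasure (expm a) (B k)"
  define S where "S = {p \<in> space ?Q. \<forall>k\<in>{t+1..t + int m}. qD (fst p) (snd p) k \<in> A k \<and> qR (fst p) (snd p) k \<in> B k}"
  have [measurable]: "S \<in> sets ?Q"
    unfolding S_def by measurable
  define f where "f n p = burke_ind A' B' (n + m) (t - int n) (fst p) (fst (snd p)) (snd (snd p))" for n p
  have fm [measurable]: "f n \<in> borel_measurable ?T" for n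
    unfolding f_def by measurable
  have int: "(\<integral>\<^sup>+p. f n p \<partial>?T) = ?R" for n
  proof -
    have "(\<integral>\<^sup>+p. f n p \<partial>?T) = (\<integral>\<^sup>+x. \<integral>\<^sup>+q. f n (x, q) \<partial>?Q \<partial>expm c)"
      by (rule Q.nn_integral_fst[symmetric]) (rule fm)
    also have "\<dots> = (\<integral>\<^sup>+x. \<integral>\<^sup>+I. \<integral>\<^sup>+\<omega>. f n (x, I, \<omega>) \<partial>line a \<partial>line b \<partial>expm c)"
      by (rule nn_integral_cong, rule La.nn_integral_fst[symmetric]) measurable
    also have "\<dots> = (\<Prod>k\<in>{t - int n + 1..t - int n + int (n + m)}. emeasure (expm b) (A' k) * emeasure (expm a) (B' k))"
      unfolding f_def fst_conv snd_conv using a c by (intro burke_window) auto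
    also have "\<dots> = (\<Prod>k\<in>{t+1..t + int m}. emeasure (expm b) (A' k) * emeasure (expm a) (B' k))"
      by (rule prod.mono_neutral_right)
        (auto simp: A'_def B'_def Ea.emeasure_space_1[simplified] Eb.emeasure_space_1[simplified])
    also have "\<dots> = ?R" by (intro prod.cong) (auto simp: A'_def B'_def)
    finally show ?thesis .
  qed
  have "AE q in ?Q. has_avg (fst q) b \<and> has_avg (snd q) a \<and> (\<forall>k. 0 \<le> snd q k)"
    using AE_pair_fst_snd(1)[OF Lb.prob_space_axioms La.prob_space_axioms line_has_avg[OF b]]
      AE_pair_fst_snd(2)[OF Lb.prob_space_axioms La.prob_space_axioms line_has_avg[OF a(1)]]
      AE_pair_fst_snd(2)[OF Lb.prob_space_axioms La.prob_space_axioms line_nonneg[OF a(1)]]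
    by eventually_elim blast
  from AE_pair_fst_snd(2)[OF Ec.prob_space_axioms Q.prob_space_axioms this]
  have "AE p in ?T. (\<lambda>n. f n p) \<longlonglongrightarrow> indicator S (snd p)"
    using AE_space
  proof eventually_elim
    case (elim p)
    obtain x I \<omega> where p: "p = (x, I, \<omega>)" by (metis prod.collapse)
    have adm: "adm I \<omega>" and nn: "\<And>k. 0 \<le> \<omega> k" using elim has_avg_adm[of I b \<omega> a] a by (auto simp: p)
    have "\<forall>\<^sub>F n in sequentially. indicator S (snd p) = f n p"
      using wl_coalescence[OF adm nn, of t x]
    proof eventually_elim
      case (elim n)
      have "f n p = burke_ind A' B' m (t - int n + int n) (wl I \<omega> n (t - int n) x) I \<omega>"
        unfolding f_def p fst_conv snd_conv by (rule burke_ind_prefix) (auto simp: A'_def B'_def)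
      also have "\<dots> = burke_ind A' B' m t (soj I \<omega> t) I \<omega>" using elim by simp
      also have "\<dots> = indicator S (snd p)"
        unfolding burke_ind_soj[OF adm] using \<open>p \<in> space _\<close>
        by (auto simp: p S_def A'_def B'_def indicator_def space_pair_measure)
      finally show ?case by simp
    qed
    then show ?case by (rule Lim_transform_eventually[OF tendsto_const])
  qed
  then have "(\<lambda>n. \<integral>\<^sup>+p. f n p \<partial>?T) \<longlonglongrightarrow> (\<integral>\<^sup>+p. indicator S (snd p) \<partial>?T)"
    by (intro nn_integral_dominated_convergence[where w="\<lambda>_. 1"])
      (auto simp: f_def burke_ind_le_1 T.emeasure_space_1)
  then have "?R = (\<integral>\<^sup>+p. indicator S (snd p) \<partial>?T)"
    unfolding int by (simp add: LIMSEQ_const_iff)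
  also have "\<dots> = (\<integral>\<^sup>+x. \<integral>\<^sup>+q. indicator S q \<partial>?Q \<partial>expm c)"
    by (subst Q.nn_integral_fst[symmetric]) auto
  also have "\<dots> = emeasure ?Q S" by (simp add: Ec.emeasure_space_1[simplified])
  finally show ?thesis unfolding S_def by simp
qed

text \<open>Products of two cylinders generate the sigma-algebra and are stable under intersection.
  Their finitely many indices fit into one window \<open>{- N..N}\<close>, where missing constraints
  are filled with \<open>UNIV\<close>, and \<open>burke_limit\<close> applies.\<close>

lemma burke: "distr (line b \<Otimes>\<^sub>M line a) (line b \<Otimes>\<^sub>M line a) (\<lambda>p. (qD (fst p) (snd p), qR (fst p) (snd p))) =
    line b \<Otimes>\<^sub>M line a"
proof -
  let ?Q = "line b \<Otimes>\<^sub>M line a"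
  let ?f = "\<lambda>p. (qD (fst p) (snd p), qR (fst p) (snd p))"
  let ?Ga = "prod_algebra (UNIV :: int set) (\<lambda>_. expm a)" and ?Gb = "prod_algebra (UNIV :: int set) (\<lambda>_. expm b)"
  let ?E = "{X \<times> Y | X Y. X \<in> ?Gb \<and> Y \<in> ?Ga}"
  have Ga: "?Ga \<subseteq> Pow (space (line a))" and Gb: "?Gb \<subseteq> Pow (space (line b))" by auto
  have E: "?E \<subseteq> Pow (space (line b) \<times> space (line a))" by auto
  have "sets ?Q = sets (sigma (space (line b) \<times> space (line a)) ?E)"
  proof (rule sets_pair_eq[where Ca="{space (line b)}" and Cb="{space (line a)}"])
    show "sets (line b) = sigma_sets (space (line b)) ?Gb" "sets (line a) = sigma_sets (space (line a)) ?Ga"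
      by (simp_all only: sets_PiM space_PiM)
    show "{space (line b)} \<subseteq> ?Gb" "{space (line a)} \<subseteq> ?Ga"
      using space_in_prod_algebra[of UNIV "\<lambda>_. expm b"] space_in_prod_algebra[of UNIV "\<lambda>_. expm a"]
      by (simp_all only: space_PiM) auto
  qed (use Ga Gb in auto)
  then have setsQ: "sets ?Q = sigma_sets (space (line b) \<times> space (line a)) ?E"
    using E by simp
  show ?thesis
  proof (rule measure_eqI_generator_eq[where \<Omega>="space (line b) \<times> space (line a)" and E="?E" and A="\<lambda>_. space (line b) \<times> space (line a)"])
    show "Int_stable ?E"
    proof (rule Int_stableI)
      fix U V assume "U \<in> ?E" "V \<in> ?E"
      then obtain X Y X' Y' where U: "U = X \<times> Y" "X \<in> ?Gb" "Y \<in> ?Ga" and V: "V = X' \<times> Y'" "X' \<in> ?Gb" "Y' \<in> ?Ga"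
        by blast
      have "U \<inter> V = (X \<inter> X') \<times> (Y \<inter> Y')" unfolding U V by auto
      moreover have "X \<inter> X' \<in> ?Gb" "Y \<inter> Y' \<in> ?Ga"
        using U V Int_stable_prod_algebra[THEN Int_stableD] by auto
      ultimately show "U \<inter> V \<in> ?E" by blast
    qed
    show "sets (distr ?Q ?Q ?f) = sigma_sets (space (line b) \<times> space (line a)) ?E"
      "sets ?Q = sigma_sets (space (line b) \<times> space (line a)) ?E"
      using setsQ by simp_all
    show "range (\<lambda>_. space (line b) \<times> space (line a)) \<subseteq> ?E"
      using space_in_prod_algebra[of UNIV "\<lambda>_. expm b"] space_in_prod_algebra[of UNIV "\<lambda>_. expm a"]
      unfolding space_PiM by blast
    interpret D: prob_space "distr ?Q ?Q ?f" by (rule Q.prob_space_distr[OF queue_pair_measurable])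
    show "emeasure (distr ?Q ?Q ?f) (space (line b) \<times> space (line a)) \<noteq> \<infinity>" by simp
    fix X assume "X \<in> ?E"
    then obtain X1 X2 where X: "X = X1 \<times> X2" "X1 \<in> ?Gb" "X2 \<in> ?Ga" by blast
    from X(2) obtain J F where J: "finite J" "\<And>j. j \<in> J \<Longrightarrow> F j \<in> sets borel"
      and X1: "X1 = prod_emb UNIV (\<lambda>_. expm b) J (Pi\<^sub>E J F)" by (elim prod_algebraE) auto
    from X(3) obtain K G where K: "finite K" "\<And>j. j \<in> K \<Longrightarrow> G j \<in> sets borel"
      and X2: "X2 = prod_emb UNIV (\<lambda>_. expm a) K (Pi\<^sub>E K G)" by (elim prod_algebraE) auto
    obtain N :: nat where N: "\<And>k. k \<in> J \<union> K \<Longrightarrow> \<bar>k\<bar> \<le> int N"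
    proof -
      have "\<bar>k\<bar> \<le> int (nat (Max (abs ` (J \<union> K))))" if "k \<in> J \<union> K" for k
      proof -
        have "\<bar>k\<bar> \<le> Max (abs ` (J \<union> K))" using that J K by (intro Max_ge) auto
        moreover from this have "0 \<le> Max (abs ` (J \<union> K))" using abs_ge_zero[of k] by linarith
        ultimately show ?thesis by simp
      qed
      then show ?thesis by (rule that)
    qed
    define t where "t = - int N - 1"
    define m where "m = 2 * N + 1"
    have win: "{t+1..t + int m} = {- int N..int N}" by (auto simp: t_def m_def)
    have JK: "J \<subseteq> {- int N..int N}" "K \<subseteq> {- int N..int N}" using N by force+
    define A B where "A k = (if k \<in> J then F k else UNIV)" and "B k = (if k \<in> K then G k else UNIV)" for k
    have AB: "A k \<in> sets borel" "B k \<in> sets borel" for k using J K by (auto simp: A_def B_def)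
    have mem: "y \<in> A k \<longleftrightarrow> (k \<in> J \<longrightarrow> y \<in> F k)" "y \<in> B k \<longleftrightarrow> (k \<in> K \<longrightarrow> y \<in> G k)" for k y
      by (auto simp: A_def B_def)
    have win_iff: "(\<forall>k\<in>{- int N..int N}. qD I \<omega> k \<in> A k \<and> qR I \<omega> k \<in> B k) \<longleftrightarrow>
        (\<forall>k\<in>J. qD I \<omega> k \<in> F k) \<and> (\<forall>k\<in>K. qR I \<omega> k \<in> G k)" for I \<omega>
      unfolding mem using JK by blast
    have Xs: "X \<in> sets ?Q" unfolding setsQ using \<open>X \<in> ?E\<close> by (rule sigma_sets.Basic)
    have "?f -` X \<inter> space ?Q = {p \<in> space ?Q. \<forall>k\<in>{t+1..t + int m}. qD (fst p) (snd p) k \<in> A k \<and> qR (fst p) (snd p) k \<in> B k}"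
      unfolding win win_iff X(1) X1 X2 by (auto simp: prod_emb_def space_pair_measure)
    then have "emeasure (distr ?Q ?Q ?f) X = (\<Prod>k\<in>{t+1..t + int m}. emeasure (expm b) (A k) * emeasure (expm a) (B k))"
      using burke_limit[OF AB, of t m] by (simp add: emeasure_distr[OF queue_pair_measurable Xs])
    also have "\<dots> = (\<Prod>k\<in>J. emeasure (expm b) (F k)) * (\<Prod>k\<in>K. emeasure (expm a) (G k))"
    proof -
      have "(\<Prod>k\<in>{- int N..int N}. emeasure (expm b) (A k)) = (\<Prod>k\<in>J. emeasure (expm b) (F k))"
        using JK by (intro prod.mono_neutral_cong_right) (auto simp: A_def Eb.emeasure_space_1[simplified])
      moreover have "(\<Prod>k\<in>{- int N..int N}. emeasure (expm a) (B k)) = (\<Prod>k\<in>K. emeasure (expm a) (G k))"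
        using JK by (intro prod.mono_neutral_cong_right) (auto simp: B_def Ea.emeasure_space_1[simplified])
      ultimately show ?thesis unfolding win by (simp add: prod.distrib)
    qed
    also have "\<dots> = emeasure (line b) X1 * emeasure (line a) X2"
      unfolding X1 X2 using J K by (simp add: emeasure_PiM_emb prob_space_expm a b)
    also have "\<dots> = emeasure ?Q X"
      unfolding X(1) using J K by (intro La.emeasure_pair_measure_Times[symmetric]) (auto simp: X1 X2)
    finally show "emeasure (distr ?Q ?Q ?f) X = emeasure ?Q X" .
  qed (use E in auto)
qed

end

text \<open>Fubini's theorem isolates the coordinates \<open>u\<close> and \<open>v\<close>, whose
  joint law \<open>burke\<close> preserves with line \<open>v\<close> as arrivals and line
  \<open>u\<close> as services; \<open>W\<close> is their part of the event, and the other lines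
  contribute a box. The departures, with the larger mean, go to position \<open>u\<close>.\<close>

lemma PiM_line_swap:
  assumes I: "finite I" "u \<in> I" "v \<in> I" "u \<noteq> v"
    and pos: "\<And>i. i \<in> I \<Longrightarrow> 0 < \<rho> i" and less: "\<rho> u < \<rho> v"
  defines "\<rho>' \<equiv> \<rho>(u := \<rho> v, v := \<rho> u)"
  shows "distr (PiM I (\<lambda>i. line (\<rho> i))) (PiM I (\<lambda>i. line (\<rho>' i)))
    (\<lambda>x. \<lambda>i\<in>I. if i = u then qD (x v) (x u) else if i = v then qR (x v) (x u) else x i) =
    PiM I (\<lambda>i. line (\<rho>' i))"
proof (rule measure_eqI_PiM_finite[where M="\<lambda>i. line (\<rho>' i)" and I=I and A="\<lambda>_. space (PiM I (\<lambda>i. line (\<rho>' i)))"])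
  let ?L = "\<lambda>i. line (\<rho> i)" and ?Q = "line (\<rho> v) \<Otimes>\<^sub>M line (\<rho> u)"
  let ?M = "PiM I ?L" and ?M' = "PiM I (\<lambda>i. line (\<rho>' i))"
  let ?S = "\<lambda>x. \<lambda>i\<in>I. if i = u then qD (x v) (x u) else if i = v then qR (x v) (x u) else x i"
  define K where "K = I - {u, v}"
  have IK: "I = insert u (insert v K)" using I by (auto simp: K_def)
  have pos': "\<And>i. i \<in> I \<Longrightarrow> 0 < \<rho>' i" using pos I by (auto simp: \<rho>'_def)
  have pr: "prob_space (line (\<rho> i))" if "i \<in> I" for i using pos[OF that] by (rule prob_space_line)
  have comp: "(\<lambda>x. x i k) \<in> borel_measurable ?M" if "i \<in> I" for i k
    by (rule measurable_compose[OF measurable_component_singleton[OF that] line_component_measurable])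
  have S: "?S \<in> measurable ?M ?M'"
  proof (rule measurable_restrict)
    fix i assume i: "i \<in> I"
    show "(\<lambda>x. if i = u then qD (x v) (x u) else if i = v then qR (x v) (x u) else x i) \<in> measurable ?M (line (\<rho>' i))"
    proof (rule measurable_into_line)
      fix k
      show "(\<lambda>x. (if i = u then qD (x v) (x u) else if i = v then qR (x v) (x u) else x i) k) \<in> borel_measurable ?M"
        using comp I i by (cases "i = u"; cases "i = v") (auto intro!: qD_measurable qR_measurable)
    qed
  qed
  interpret M: prob_space ?M using pr by (rule prob_space_PiM)
  interpret D: prob_space "distr ?M ?M' ?S" by (rule M.prob_space_distr[OF S])
  interpret Lu: prob_space "line (\<rho> u)" using I by (intro pr)
  interpret Lv: prob_space "line (\<rho> v)" using I by (intro pr)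
  interpret P: pair_sigma_finite "line (\<rho> v)" "line (\<rho> u)" by unfold_locales
  show "emeasure (distr ?M ?M' ?S) (space ?M') \<noteq> \<infinity>" by simp
  show "range (\<lambda>_. space ?M') \<subseteq> prod_algebra I (\<lambda>i. line (\<rho>' i))"
    unfolding space_PiM[of I] using space_in_prod_algebra[of I "\<lambda>i. line (\<rho>' i)"] by blast
  fix A assume A: "\<And>i. i \<in> I \<Longrightarrow> A i \<in> sets (line (\<rho>' i))"
  have As: "A i \<in> sets (line r)" if "i \<in> I" for i r using A[OF that] by (simp add: sets_line)
  let ?f = "\<lambda>p. (qD (fst p) (snd p), qR (fst p) (snd p))"
  define W where "W = ?f -` (A u \<times> A v) \<inter> space ?Q"
  define Z where "Z = ?S -` Pi\<^sub>E I A \<inter> space ?M"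
  have AA: "A u \<times> A v \<in> sets ?Q" using As I by auto
  have Wm [measurable]: "W \<in> sets ?Q"
    unfolding W_def using queue_pair_measurable AA by (rule measurable_sets)
  have W: "emeasure ?Q W = emeasure (line (\<rho> v)) (A u) * emeasure (line (\<rho> u)) (A v)"
  proof -
    have "emeasure ?Q W =
        emeasure (distr ?Q ?Q ?f) (A u \<times> A v)"
      unfolding W_def by (rule emeasure_distr[OF queue_pair_measurable AA, symmetric])
    also have "\<dots> = emeasure (line (\<rho> v)) (A u) * emeasure (line (\<rho> u)) (A v)"
      unfolding stable_queue.burke[OF stable_queue.intro[OF pos[OF I(2)] less]] using As I by (intro Lu.emeasure_pair_measure_Times) auto
    finally show ?thesis .
  qed
  have PiEm: "Pi\<^sub>E I A \<in> sets ?M'" using I(1) A by (rule sets_PiM_I_finite)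
  have Zm: "Z \<in> sets ?M" unfolding Z_def using S PiEm by (rule measurable_sets)
  have "emeasure (distr ?M ?M' ?S) (Pi\<^sub>E I A) = emeasure ?M Z"
    unfolding Z_def by (rule emeasure_distr[OF S PiEm])
  also have "\<dots> = (\<integral>\<^sup>+x. indicator Z x \<partial>?M)" using Zm by simp
  also have "\<dots> = (\<integral>\<^sup>+yu. \<integral>\<^sup>+x. indicator Z (x(u := yu)) \<partial>PiM (insert v K) ?L \<partial>line (\<rho> u))"
    using Zm pr I unfolding IK by (intro nn_integral_PiM_insert) (auto simp: K_def)
  also have "\<dots> = (\<integral>\<^sup>+yu. \<integral>\<^sup>+yv. \<integral>\<^sup>+x. indicator Z (x(v := yv, u := yu)) \<partial>PiM K ?L \<partial>line (\<rho> v) \<partial>line (\<rho> u))"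
  proof (rule nn_integral_cong)
    fix yu assume yu: "yu \<in> space (line (\<rho> u))"
    have "(\<lambda>x. x(u := yu)) \<in> measurable (PiM (insert v K) ?L) ?M"
      unfolding IK using yu by (intro measurable_fun_upd[where J="insert v K"]) auto
    then have "(\<lambda>x. indicator Z (x(u := yu)) :: ennreal) \<in> borel_measurable (PiM (insert v K) ?L)"
      by (rule measurable_compose) (use Zm in simp)
    then show "(\<integral>\<^sup>+x. indicator Z (x(u := yu)) \<partial>PiM (insert v K) ?L) =
      (\<integral>\<^sup>+yv. \<integral>\<^sup>+x. indicator Z (x(v := yv, u := yu)) \<partial>PiM K ?L \<partial>line (\<rho> v))"
      using pr I by (intro nn_integral_PiM_insert) (auto simp: K_def)
  qed
  also have "\<dots> = (\<integral>\<^sup>+yu. \<integral>\<^sup>+yv. indicator W (yv, yu) * (\<Prod>i\<in>K. emeasure (line (\<rho> i)) (A i)) \<partial>line (\<rho> v) \<partial>line (\<rho> u))"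
  proof (rule nn_integral_cong, rule nn_integral_cong)
    fix yu yv
    have "indicator Z (x(v := yv, u := yu)) = (indicator W (yv, yu) * indicator (Pi\<^sub>E K A) x :: ennreal)"
      if x: "x \<in> space (PiM K ?L)" for x
    proof -
      have "x(v := yv, u := yu) \<in> Z \<longleftrightarrow> (yv, yu) \<in> W \<and> x \<in> Pi\<^sub>E K A"
        using x I(4) unfolding Z_def W_def IK
        by (auto simp: space_PiM space_pair_measure PiE_iff extensional_def K_def)
      then show ?thesis by (simp add: indicator_def)
    qed
    then have "(\<integral>\<^sup>+x. indicator Z (x(v := yv, u := yu)) \<partial>PiM K ?L) =
      (\<integral>\<^sup>+x. indicator W (yv, yu) * indicator (Pi\<^sub>E K A) x \<partial>PiM K ?L)"
      by (rule nn_integral_cong)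
    also have "\<dots> = indicator W (yv, yu) * emeasure (PiM K ?L) (Pi\<^sub>E K A)"
      using As I by (intro nn_integral_cmult_indicator sets_PiM_I_finite) (auto simp: K_def)
    also have "emeasure (PiM K ?L) (Pi\<^sub>E K A) = (\<Prod>i\<in>K. emeasure (line (\<rho> i)) (A i))"
      using As I pr by (intro measure_PiM_PiE(1)) (auto simp: K_def)
    finally show "(\<integral>\<^sup>+x. indicator Z (x(v := yv, u := yu)) \<partial>PiM K ?L) =
      indicator W (yv, yu) * (\<Prod>i\<in>K. emeasure (line (\<rho> i)) (A i))" .
  qed
  also have "\<dots> = (\<integral>\<^sup>+p. indicator W p * (\<Prod>i\<in>K. emeasure (line (\<rho> i)) (A i)) \<partial>?Q)"
    by (subst P.nn_integral_snd[symmetric]) (auto simp: case_prod_unfold)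
  also have "\<dots> = emeasure (line (\<rho> v)) (A u) * emeasure (line (\<rho> u)) (A v) * (\<Prod>i\<in>K. emeasure (line (\<rho> i)) (A i))"
    by (subst nn_integral_multc) (auto simp: W)
  also have "\<dots> = (\<Prod>i\<in>I. emeasure (line (\<rho>' i)) (A i))"
  proof -
    have "(\<Prod>i\<in>K. emeasure (line (\<rho>' i)) (A i)) = (\<Prod>i\<in>K. emeasure (line (\<rho> i)) (A i))"
      by (rule prod.cong) (auto simp: \<rho>'_def K_def)
    moreover have "finite K" "u \<notin> insert v K" "v \<notin> K" using I by (auto simp: K_def)
    ultimately show ?thesis unfolding IK using I(4) by (simp add: \<rho>'_def mult.assoc)
  qed
  also have "\<dots> = emeasure ?M' (Pi\<^sub>E I A)"
    using I A pos' by (intro measure_PiM_PiE(1)[symmetric] prob_space_line) auto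
  finally show "emeasure (distr ?M ?M' ?S) (Pi\<^sub>E I A) = emeasure ?M' (Pi\<^sub>E I A)" .
qed (use I in auto)

section \<open>Queues in tandem\<close>

text \<open>The arrivals \<open>x\<close> pass through the servers \<open>I m, \<dots>, I 1\<close> in this order.\<close>

fun tandem :: "(nat \<Rightarrow> int \<Rightarrow> real) \<Rightarrow> (int \<Rightarrow> real) \<Rightarrow> nat \<Rightarrow> int \<Rightarrow> real" where
  "tandem I x 0 = x"
| "tandem I x (Suc m) = tandem I (qD x (I (Suc m))) m"

text \<open>\<open>multi_queue_map\<close> with \<open>qD\<close> for \<open>queue_map\<close>,
  hence without the choice of a potential and measurable everywhere. The recursion of
  \<open>tandem\<close> consumes the first server met, so inductions generalise over the
  arrivals.\<close>

definition mqD :: "nat \<Rightarrow> (nat \<Rightarrow> int \<Rightarrow> real) \<Rightarrow> nat \<Rightarrow> int \<Rightarrow> real" where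
  "mqD n I = (\<lambda>i\<in>{1..n}. tandem I (I i) (i - 1))"

lemma tandem_cong:
  assumes "\<And>j. 1 \<le> j \<Longrightarrow> j \<le> m \<Longrightarrow> I j = I' j"
  shows "tandem I x m = tandem I' x m"
  using assms by (induction m arbitrary: x) auto

lemma tandem_mono:
  assumes "has_avg x b" "has_avg y c" "\<And>k. x k \<le> y k"
    "\<And>j. 1 \<le> j \<Longrightarrow> j \<le> m \<Longrightarrow> has_avg (I j) (a j) \<and> a j < b \<and> a j < c"
  shows "tandem I x m k \<le> tandem I y m k"
  using assms
proof (induction m arbitrary: x y)
  case (Suc m)
  have av: "has_avg (I (Suc m)) (a (Suc m))" "a (Suc m) < b" "a (Suc m) < c" using Suc.prems(4)[of "Suc m"] by auto
  have "qD x (I (Suc m)) j \<le> qD y (I (Suc m)) j" for j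
    using Suc.prems(1-3) av by (intro qD_mono) (auto intro: has_avg_adm)
  moreover have "has_avg (qD x (I (Suc m))) b" "has_avg (qD y (I (Suc m))) c"
    using Suc.prems(1,2) av by (auto intro: has_avg_queue)
  ultimately show ?case using Suc.IH Suc.prems(4) by simp
qed simp

lemma tandem_nonneg:
  assumes "has_avg x b" "\<And>k. 0 \<le> x k"
    "\<And>j. 1 \<le> j \<Longrightarrow> j \<le> m \<Longrightarrow> has_avg (I j) (a j) \<and> a j < b \<and> (\<forall>k. 0 \<le> I j k)"
  shows "0 \<le> tandem I x m k"
  using assms
proof (induction m arbitrary: x)
  case (Suc m)
  have av: "has_avg (I (Suc m)) (a (Suc m))" "a (Suc m) < b" "\<And>k. 0 \<le> I (Suc m) k" using Suc.prems(3)[of "Suc m"] by auto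
  have "0 \<le> qD x (I (Suc m)) j" for j
    using av(3)[of j] qD_ge[of x "I (Suc m)" j] has_avg_adm[OF Suc.prems(1) av(1,2)] by linarith
  moreover have "has_avg (qD x (I (Suc m))) b"
    using Suc.prems(1) av by (auto intro: has_avg_queue)
  ultimately show ?case using Suc.IH Suc.prems(3) by simp
qed simp

text \<open>\<open>queue_iter\<close> adds servers at the end, \<open>tandem\<close> removes them at
  the front. The invariant says that after \<open>m\<close> servers the remaining ones complete the
  result; the average \<open>a i\<close> is carried along for stability.\<close>

lemma queue_iter_tandem:
  assumes "1 \<le> i" and av: "\<And>j. 1 \<le> j \<Longrightarrow> j \<le> i \<Longrightarrow> has_avg (I j) (a j)"
    and less: "\<And>j. 1 \<le> j \<Longrightarrow> j < i \<Longrightarrow> a j < a i"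
  shows "queue_iter i (\<lambda>j. I (i + 1 - j)) = tandem I (I i) (i - 1)"
proof -
  let ?\<zeta> = "\<lambda>j. I (i + 1 - j)"
  have "m < i \<Longrightarrow> has_avg (queue_iter (Suc m) ?\<zeta>) (a i) \<and>
      tandem I (queue_iter (Suc m) ?\<zeta>) (i - 1 - m) = tandem I (I i) (i - 1)" for m
  proof (induction m)
    case 0
    then show ?case using av[of i] assms(1) by simp
  next
    case (Suc m)
    let ?q = "queue_iter (Suc m) ?\<zeta>" and ?j = "i - 1 - m"
    have IH: "has_avg ?q (a i)" "tandem I ?q ?j = tandem I (I i) (i - 1)" using Suc by auto
    have j: "1 \<le> ?j" "?j < i" "?j = Suc (i - 1 - Suc m)" "i + 1 - Suc (Suc m) = ?j" using Suc.prems by auto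
    have avj: "has_avg (I ?j) (a ?j)" "a ?j < a i" using av less j by auto
    have eq: "queue_iter (Suc (Suc m)) ?\<zeta> = qD ?q (I ?j)"
      using queue_map_eq_qD[OF has_avg_adm[OF IH(1) avj]] j(4) by simp
    show ?case unfolding eq using has_avg_queue(1)[OF IH(1) avj] IH(2) j(3)
      by (metis tandem.simps(2))
  qed
  from this[of "i - 1"] show ?thesis using assms(1) by simp
qed

section \<open>The spaces\<close>

text \<open>What the pathwise arguments use of a sample of \<open>nu n a\<close>; it holds almost
  surely by \<open>AE_good\<close>.\<close>

definition good :: "nat \<Rightarrow> (nat \<Rightarrow> real) \<Rightarrow> (nat \<Rightarrow> int \<Rightarrow> real) \<Rightarrow> bool" where
  "good n a I \<longleftrightarrow> I \<in> nonneg_tuples n \<and> (\<forall>i\<in>{1..n}. has_avg (I i) (a i))"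

definition increasing_pos :: "nat \<Rightarrow> (nat \<Rightarrow> real) \<Rightarrow> bool" where
  "increasing_pos n a \<longleftrightarrow> (\<forall>i\<in>{1..n}. 0 < a i) \<and> strict_mono_on {1..n} a"

lemma increasing_means_iff: "\<rho> \<in> increasing_means n \<longleftrightarrow> \<rho> \<in> extensional {1..n} \<and> increasing_pos n \<rho>"
  by (auto simp: increasing_means_def increasing_pos_def PiE_iff)

lemma multi_queue_map_eq_mqD:
  assumes "good n a I" "increasing_pos n a"
  shows "multi_queue_map n I = mqD n I"
  unfolding multi_queue_map_def mqD_def
proof (rule restrict_ext)
  fix i assume "i \<in> {1..n}"
  then show "queue_iter i (\<lambda>j. I (i + 1 - j)) = tandem I (I i) (i - 1)"
    using assms by (intro queue_iter_tandem[where a=a]) (auto simp: good_def increasing_pos_def strict_mono_on_def)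
qed

text \<open>The liminf condition of \<open>X_space\<close> without extended reals: divided by the
  negative \<open>m\<close>, the inequality says that the average is at least
  \<open>q\<close>.\<close>

definition pos_lower :: "(int \<Rightarrow> real) \<Rightarrow> bool" where
  "pos_lower x \<longleftrightarrow> (\<exists>q>0. \<forall>\<^sub>F m in at_bot. psum x m \<le> q * real_of_int m)"

lemma pos_lower_iff: "pos_lower x \<longleftrightarrow> Liminf at_bot (\<lambda>m. ereal (left_avg x m)) > 0"
proof
  assume "pos_lower x"
  then obtain q where q: "q > 0" "\<forall>\<^sub>F m in at_bot. psum x m \<le> q * real_of_int m" by (auto simp: pos_lower_def)
  have "\<forall>\<^sub>F m in at_bot. psum x (m + (-1)) \<le> q * real_of_int (m + (-1))"
    using q(2) filterlim_shift_at_bot by (rule eventually_compose_filterlim)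
  with eventually_le_at_bot[of "-1"] have "\<forall>\<^sub>F m in at_bot. ereal q \<le> ereal (left_avg x m)"
  proof eventually_elim
    case (elim m)
    have "psum x (m - 1) \<le> q * real_of_int m" using elim q(1) by (simp add: algebra_simps)
    then show ?case using elim(1) by (simp add: left_avg_psum field_simps)
  qed
  then have "ereal q \<le> Liminf at_bot (\<lambda>m. ereal (left_avg x m))" by (rule Liminf_bounded)
  moreover have "0 < ereal q" using q(1) by simp
  ultimately show "Liminf at_bot (\<lambda>m. ereal (left_avg x m)) > 0" by (rule less_le_trans[rotated])
next
  assume "Liminf at_bot (\<lambda>m. ereal (left_avg x m)) > 0"
  then obtain q where q: "0 < ereal q" "ereal q < Liminf at_bot (\<lambda>m. ereal (left_avg x m))"
    using ereal_dense2 by blast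
  have "\<forall>\<^sub>F m in at_bot. ereal q < ereal (left_avg x m)" using q(2) by (rule less_LiminfD)
  from eventually_compose_filterlim[OF this filterlim_shift_at_bot[of 1]] eventually_le_at_bot[of "-2"]
  \<comment> \<open>Halving \<open>q\<close> absorbs the change of window between
    \<open>psum\<close> and \<open>left_avg\<close>.\<close>
  have "\<forall>\<^sub>F m in at_bot. psum x m \<le> q / 2 * real_of_int m"
  proof eventually_elim
    case (elim m)
    have "q < psum x m / real_of_int (m + 1)" using elim by (simp add: left_avg_psum)
    then have "psum x m < q * real_of_int (m + 1)" using elim(2) by (simp add: field_simps)
    also have "\<dots> = q / 2 * real_of_int m + q / 2 * (real_of_int m + 2)" by (simp add: algebra_simps)
    also have "\<dots> \<le> q / 2 * real_of_int m + 0"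
      using q(1) elim(2) by (intro add_left_mono) (simp add: mult_nonneg_nonpos)
    finally show ?case by simp
  qed
  then show "pos_lower x" unfolding pos_lower_def using q(1) by (intro exI[of _ "q / 2"]) simp
qed

lemma has_avg_pos_lower:
  assumes "has_avg x a" "a > 0"
  shows "pos_lower x"
proof -
  have "\<forall>\<^sub>F m in at_bot. a / 2 < psum x m / real_of_int m"
    using assms by (intro order_tendstoD(1)[OF assms(1)[unfolded has_avg_def]]) simp
  with eventually_le_at_bot[of "-1"] have "\<forall>\<^sub>F m in at_bot. psum x m \<le> a / 2 * real_of_int m"
    by eventually_elim (simp add: field_simps)
  then show ?thesis unfolding pos_lower_def using assms(2) by (intro exI[of _ "a / 2"]) simp
qed

lemma pos_lower_shift:
  assumes "pos_lower x"
  shows "pos_lower (\<lambda>k. x (k + l))"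
proof -
  from assms obtain q where q: "q > 0" "\<forall>\<^sub>F m in at_bot. psum x m \<le> q * real_of_int m" by (auto simp: pos_lower_def)
  define c where "c = q * real_of_int l - psum x l"
  have "filterlim (\<lambda>m. q / 2 * real_of_int m) at_bot at_bot"
    using q(1) filterlim_real_of_int_at_bot by (intro filterlim_tendsto_pos_mult_at_bot[OF tendsto_const]) auto
  then have "\<forall>\<^sub>F m in at_bot. q / 2 * real_of_int m \<le> - c" unfolding filterlim_at_bot by blast
  moreover have "\<forall>\<^sub>F m in at_bot. psum x (m + l) \<le> q * real_of_int (m + l)"
    using q(2) filterlim_shift_at_bot by (rule eventually_compose_filterlim)
  ultimately have "\<forall>\<^sub>F m in at_bot. psum (\<lambda>k. x (k + l)) m \<le> q / 2 * real_of_int m"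
    by eventually_elim (simp add: psum_add c_def algebra_simps)
  then show ?thesis unfolding pos_lower_def using q(1) by (intro exI[of _ "q / 2"]) simp
qed

lemma pos_lower_mono:
  assumes "pos_lower x" "\<And>k. x k \<le> y k"
  shows "pos_lower y"
proof -
  from assms(1) obtain q where q: "q > 0" "\<forall>\<^sub>F m in at_bot. psum x m \<le> q * real_of_int m" by (auto simp: pos_lower_def)
  have "psum y m \<le> psum x m" if "m \<le> 0" for m
    using sum_mono[of "{m+1..0}" x y] assms(2) that by (simp add: sum_interval_psum)
  note le = this
  from q(2) eventually_le_at_bot[of 0] have "\<forall>\<^sub>F m in at_bot. psum y m \<le> q * real_of_int m"
  proof eventually_elim
    case (elim m)
    then show ?case using le[of m] by linarith
  qed
  then show ?thesis using q(1) by (auto simp: pos_lower_def)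
qed

lemma X_space_iff: "\<eta> \<in> X_space n \<longleftrightarrow> \<eta> \<in> nonneg_tuples n \<and>
    (\<forall>i\<in>{2..n}. \<forall>k. \<eta> (i - 1) k \<le> \<eta> i k) \<and> pos_lower (\<eta> 1)"
  by (auto simp: X_space_def pos_lower_iff)

text \<open>Adjacent outputs are ordered because line \<open>i\<close> first meets server
  \<open>I (i - 1)\<close>, its departures dominate the services there (\<open>qD_ge\<close>), and
  both lines then pass the same monotone tandem.\<close>

lemma mqD_in_X_space:
  assumes g: "good n a I" and a: "increasing_pos n a" and n: "1 \<le> n"
  shows "mqD n I \<in> X_space n"
proof -
  have av: "has_avg (I j) (a j)" "\<And>k. 0 \<le> I j k" if "1 \<le> j" "j \<le> n" for j
    using g that by (auto simp: good_def nonneg_tuples_def PiE_iff)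
  have less: "a j < a i" if "1 \<le> j" "j < i" "i \<le> n" for i j
    using a that by (auto simp: increasing_pos_def strict_mono_on_def)
  have "mqD n I \<in> nonneg_tuples n"
    unfolding mqD_def nonneg_tuples_def
  proof (rule restrict_PiE_iff[THEN iffD2], intro ballI CollectI allI)
    fix i k assume "i \<in> {1..n}"
    then show "0 \<le> tandem I (I i) (i - 1) k"
      using av less by (intro tandem_nonneg[where b="a i" and a=a]) auto
  qed
  moreover have "mqD n I (i - 1) k \<le> mqD n I i k" if i: "i \<in> {2..n}" for i k
  proof -
    obtain m where m: "i = Suc (Suc m)" using i by (cases i; cases "i - 1") auto
    have A: "adm (I i) (I (i - 1))"
      using i by (intro has_avg_adm[of _ "a i" _ "a (i - 1)"] av less) auto
    have "tandem I (I (i - 1)) m k \<le> tandem I (qD (I i) (I (i - 1))) m k"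
    proof (rule tandem_mono[where b="a (i - 1)" and c="a i" and a=a])
      show "has_avg (I (i - 1)) (a (i - 1))" using i by (intro av) auto
      show "has_avg (qD (I i) (I (i - 1))) (a i)"
        using i by (intro has_avg_queue(1)[where a="a (i - 1)"] av less) auto
      show "I (i - 1) k \<le> qD (I i) (I (i - 1)) k" for k by (rule qD_ge[OF A])
      show "has_avg (I j) (a j) \<and> a j < a (i - 1) \<and> a j < a i" if "1 \<le> j" "j \<le> m" for j
        using i that m by (intro conjI av less) auto
    qed
    then show ?thesis using i m by (simp add: mqD_def)
  qed
  moreover have "pos_lower (mqD n I 1)"
    using av[of 1] a n by (intro has_avg_pos_lower[of _ "a 1"]) (auto simp: mqD_def increasing_pos_def)
  ultimately show ?thesis by (simp add: X_space_iff)
qed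

text \<open>\<open>Y_space\<close> provides averages pair by pair, and uniqueness of limits glues
  them into one function \<open>a\<close>. With a single line there are no pairs and an average may
  fail to exist, hence \<open>2 \<le> n\<close>.\<close>

lemma Y_space_good:
  assumes "I \<in> Y_space n" "2 \<le> n"
  shows "\<exists>a. good n a I \<and> increasing_pos n a"
proof -
  define a where "a i = Lim at_bot (\<lambda>m. psum (I i) m / real_of_int m)" for i
  have aI: "b = a i" if "has_avg (I i) b" for i b
    using that unfolding a_def has_avg_def by (intro tendsto_Lim[symmetric]) auto
  have Y: "has_avg (I i) (a i) \<and> has_avg (I (i - 1)) (a (i - 1)) \<and> a (i - 1) < a i \<and> 0 < a (i - 1)" if i: "i \<in> {2..n}" for i
  proof -
    from assms(1) i obtain c d where "has_avg (I i) c" "has_avg (I (i - 1)) d" "d < c" "0 < d"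
      unfolding Y_space_def left_avg_iff_has_avg by blast
    then show ?thesis using aI by metis
  qed
  have av: "has_avg (I i) (a i)" "0 < a i" if "i \<in> {1..n}" for i
  proof -
    show "has_avg (I i) (a i)" using Y[of i] Y[of 2] that assms(2) by (cases "i = 1") auto
    have "0 < a i" if "i \<ge> 1" "i \<le> n" for i using Y[of i] Y[of 2] that assms(2) by (cases "i = 1") auto
    then show "0 < a i" using that by auto
  qed
  have "strict_mono_on {1..n} a"
  proof (rule strict_mono_onI)
    fix i j assume ij: "i \<in> {1..n}" "j \<in> {1..n}" "i < j"
    have "Suc i \<le> j" using ij by simp
    then show "a i < a j" using ij(2)
    proof (induction j rule: dec_induct)
      case base
      then show ?case using Y[of "Suc i"] ij(1) by simp
    next
      case (step k)
      then show ?case using Y[of "Suc k"] ij(1) by force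
    qed
  qed
  moreover have "I \<in> nonneg_tuples n" using assms(1) by (simp add: Y_space_def)
  ultimately show ?thesis using av by (intro exI[of _ a]) (auto simp: good_def increasing_pos_def)
qed

lemma good_Y_space:
  assumes "good n a I" "increasing_pos n a"
  shows "I \<in> Y_space n"
  unfolding Y_space_def left_avg_iff_has_avg
proof (intro CollectI conjI ballI)
  show "I \<in> nonneg_tuples n" using assms(1) by (simp add: good_def)
  fix i assume i: "i \<in> {2..n}"
  then have "i \<in> {1..n}" "i - 1 \<in> {1..n}" "i - 1 < i" by auto
  then have "has_avg (I i) (a i) \<and> has_avg (I (i - 1)) (a (i - 1)) \<and> a (i - 1) < a i \<and> 0 < a (i - 1)"
    using assms unfolding good_def increasing_pos_def strict_mono_on_def by blast
  then show "\<exists>a b. has_avg (I i) a \<and> has_avg (I (i - 1)) b \<and> b < a \<and> 0 < b" by blast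
qed

section \<open>The measures\<close>

lemma nu_eq: "nu n \<rho> = PiM {1..n} (\<lambda>i. line (\<rho> i))"
  by (simp add: nu_def expm_def)

lemma space_nu: "space (nu n \<rho>) = {1..n} \<rightarrow>\<^sub>E UNIV"
  by (simp add: nu_eq space_PiM)

lemma prob_space_nu: "(\<And>i. i \<in> {1..n} \<Longrightarrow> 0 < \<rho> i) \<Longrightarrow> prob_space (nu n \<rho>)"
  unfolding nu_eq by (intro prob_space_PiM prob_space_line)

lemma nu_component:
  assumes "i \<in> {1..n}"
  shows "(\<lambda>I. I i k) \<in> borel_measurable (nu n \<rho>)"
  unfolding nu_eq
  by (rule measurable_compose[OF measurable_component_singleton[OF assms] line_component_measurable])

lemma measurable_into_nu:
  assumes "\<And>i k. i \<in> {1..n} \<Longrightarrow> (\<lambda>p. f p i k) \<in> borel_measurable M"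
    and "\<And>p. p \<in> space M \<Longrightarrow> f p \<in> extensional {1..n}"
  shows "f \<in> measurable M (nu n \<rho>)"
proof -
  have "(\<lambda>p. \<lambda>i\<in>{1..n}. f p i) \<in> measurable M (nu n \<rho>)"
    unfolding nu_eq by (intro measurable_restrict measurable_into_line assms(1)) auto
  then show ?thesis
    by (rule measurable_cong[THEN iffD1, rotated]) (rule extensional_restrict[OF assms(2)])
qed

lemma measurable_into_tuples:
  fixes f :: "'z \<Rightarrow> nat \<Rightarrow> int \<Rightarrow> real"
  assumes "\<And>i k. (\<lambda>p. f p i k) \<in> borel_measurable M"
  shows "f \<in> borel_measurable M"
  by (intro measurable_coordinatewise_then_product assms)

section \<open>Measurability of the outputs and of the spaces\<close>

lemma tandem_measurable:
  assumes "\<And>k. (\<lambda>p. x p k) \<in> borel_measurable M"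
    "\<And>j k. 1 \<le> j \<Longrightarrow> j \<le> m \<Longrightarrow> (\<lambda>p. I p j k) \<in> borel_measurable M"
  shows "(\<lambda>p. tandem (I p) (x p) m k) \<in> borel_measurable M"
  using assms
proof (induction m arbitrary: x)
  case (Suc m)
  have "(\<lambda>p. qD (x p) (I p (Suc m)) j) \<in> borel_measurable M" for j
    using Suc.prems by (intro qD_measurable) auto
  then show ?case using Suc.IH[of "\<lambda>p. qD (x p) (I p (Suc m))"] Suc.prems(2) by simp
qed simp

lemma mqD_measurable: "mqD n \<in> borel_measurable (nu n \<rho>)"
proof (rule measurable_into_tuples)
  fix i k
  show "(\<lambda>I. mqD n I i k) \<in> borel_measurable (nu n \<rho>)"
  proof (cases "i \<in> {1..n}")
    case True
    then have "(\<lambda>I. tandem I (I i) (i - 1) k) \<in> borel_measurable (nu n \<rho>)"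
      by (intro tandem_measurable nu_component) auto
    with True show ?thesis by (simp add: mqD_def)
  next
    case False
    then have "mqD n I i = undefined" for I by (simp only: mqD_def restrict_apply if_False)
    then show ?thesis by simp
  qed
qed

text \<open>Slopes \<open>1 / Suc q\<close> and integer thresholds make the condition countable, as
  measurability needs.\<close>

lemma pos_lower_countable:
  "pos_lower x \<longleftrightarrow> (\<exists>q N. \<forall>m. m \<le> N \<longrightarrow> psum x m \<le> real_of_int m / real (Suc q))"
proof
  assume "pos_lower x"
  then obtain q N0 where q: "q > 0" and N0: "\<And>m. m \<le> N0 \<Longrightarrow> psum x m \<le> q * real_of_int m"
    unfolding pos_lower_def eventually_at_bot_linorder by blast
  obtain p where p: "inverse (real (Suc p)) < q" using reals_Archimedean[OF q] by blast
  have "psum x m \<le> real_of_int m / real (Suc p)" if "m \<le> min N0 0" for m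
  proof -
    have "psum x m \<le> q * real_of_int m" using N0 that by simp
    also have "\<dots> \<le> inverse (real (Suc p)) * real_of_int m"
      using p that by (intro mult_right_mono_neg) auto
    finally show ?thesis by (simp add: divide_inverse mult.commute)
  qed
  then show "\<exists>q N. \<forall>m. m \<le> N \<longrightarrow> psum x m \<le> real_of_int m / real (Suc q)" by blast
next
  assume "\<exists>q N. \<forall>m. m \<le> N \<longrightarrow> psum x m \<le> real_of_int m / real (Suc q)"
  then obtain q N where "\<And>m::int. m \<le> N \<Longrightarrow> psum x m \<le> real_of_int m / real (Suc q)" by blast
  then show "pos_lower x"
    unfolding pos_lower_def eventually_at_bot_linorder by (intro exI[of _ "1 / real (Suc q)"]) auto
qed

lemma tuple_component [measurable]: "(\<lambda>\<eta>::nat \<Rightarrow> int \<Rightarrow> real. \<eta> i k) \<in> borel_measurable borel"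
  by (rule measurable_compose[OF measurable_product_coordinates measurable_product_coordinates])

lemma X_space_sets: "X_space n \<in> sets borel"
proof -
  have [measurable]: "(\<lambda>\<eta>::nat \<Rightarrow> int \<Rightarrow> real. psum (\<eta> i) m) \<in> borel_measurable borel" for i m
    by (intro psum_measurable) measurable
  have "X_space n = {\<eta> \<in> space borel. (\<forall>i\<in>{1..n}. \<forall>k. 0 \<le> \<eta> i k) \<and> (\<forall>i. i \<notin> {1..n} \<longrightarrow> (\<forall>k. \<eta> i k = undefined k)) \<and>
     (\<forall>i\<in>{2..n}. \<forall>k. \<eta> (i - 1) k \<le> \<eta> i k) \<and> (\<exists>q N. \<forall>m. m \<le> N \<longrightarrow> psum (\<eta> 1) m \<le> real_of_int m / real (Suc q))}"
    unfolding pos_lower_countable[symmetric]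
    by (auto simp: X_space_iff nonneg_tuples_def PiE_iff extensional_def fun_eq_iff)
  also have "\<dots> \<in> sets borel"
  proof (intro sets.sets_Collect_conj)
    show "{\<eta> \<in> space (borel :: (nat \<Rightarrow> int \<Rightarrow> real) measure). \<forall>i\<in>{1..n}. \<forall>k. 0 \<le> \<eta> i k} \<in> sets borel"
      by measurable
    show "{\<eta> \<in> space borel. \<forall>i. i \<notin> {1..n} \<longrightarrow> (\<forall>k. \<eta> i k = undefined k)} \<in> sets (borel :: (nat \<Rightarrow> int \<Rightarrow> real) measure)"
    proof -
      have "{\<eta> \<in> space borel. \<eta> i k = c} \<in> sets (borel :: (nat \<Rightarrow> int \<Rightarrow> real) measure)" for i k and c :: real
        by measurable
      then show ?thesis
        by (intro sets.sets_Collect_countable_All sets.sets_Collect_imp sets.sets_Collect_const)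
    qed
    show "{\<eta> \<in> space borel. \<forall>i\<in>{2..n}. \<forall>k. \<eta> (i - 1) k \<le> \<eta> i k} \<in> sets (borel :: (nat \<Rightarrow> int \<Rightarrow> real) measure)"
      by (intro sets.sets_Collect_finite_All sets.sets_Collect_countable_All borel_measurable_le tuple_component) auto
    show "{\<eta> \<in> space borel. \<exists>q N. \<forall>m. m \<le> N \<longrightarrow> psum (\<eta> 1) m \<le> real_of_int m / real (Suc q)} \<in> sets (borel :: (nat \<Rightarrow> int \<Rightarrow> real) measure)"
      by (intro sets.sets_Collect_countable_All sets.sets_Collect_countable_Ex sets.sets_Collect_imp sets.sets_Collect_const) measurable
  qed
  finally show ?thesis .
qed

text \<open>Existence of a limit becomes the Cauchy property and its value the total function
  \<open>lim\<close>; both are measurable in the sequence.\<close>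

lemma has_avg_measurable_iff:
  fixes s :: "(int \<Rightarrow> real) \<Rightarrow> nat \<Rightarrow> real"
  defines "s \<equiv> \<lambda>x n. past_sum x n / real n"
  shows "(\<exists>a b. has_avg x a \<and> has_avg y b \<and> b < a \<and> 0 < b) \<longleftrightarrow>
    Cauchy (s x) \<and> Cauchy (s y) \<and> lim (s y) < lim (s x) \<and> 0 < lim (s y)"
proof -
  have "has_avg x a \<longleftrightarrow> Cauchy (s x) \<and> a = lim (s x)" for x a
  proof -
    have 1: "has_avg x a \<longleftrightarrow> s x \<longlonglongrightarrow> a" unfolding has_avg_iff_seq s_def ..
    show ?thesis unfolding 1
    proof
      assume "s x \<longlonglongrightarrow> a"
      then show "Cauchy (s x) \<and> a = lim (s x)" using LIMSEQ_imp_Cauchy limI by blast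
    next
      assume "Cauchy (s x) \<and> a = lim (s x)"
      then show "s x \<longlonglongrightarrow> a" by (simp add: Cauchy_convergent_iff convergent_LIMSEQ_iff)
    qed
  qed
  then show ?thesis by auto
qed

lemma Y_space_sets: "Y_space n \<inter> space (nu n \<rho>) \<in> sets (nu n \<rho>)"
proof -
  define s :: "(int \<Rightarrow> real) \<Rightarrow> nat \<Rightarrow> real" where "s x n = past_sum x n / real n" for x n
  let ?P = "\<lambda>I i. Cauchy (s (I i)) \<and> Cauchy (s (I (i - 1))) \<and> lim (s (I (i - 1))) < lim (s (I i)) \<and> 0 < lim (s (I (i - 1)))"
  have eq: "Y_space n \<inter> space (nu n \<rho>) = {I \<in> space (nu n \<rho>). (\<forall>i\<in>{1..n}. \<forall>k. 0 \<le> I i k) \<and>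
    (\<forall>i\<in>{2..n}. ?P I i)}"
    unfolding Y_space_def left_avg_iff_has_avg
    using has_avg_measurable_iff[folded s_def]
    by (auto simp: nonneg_tuples_def space_nu PiE_iff extensional_def)
  have sm: "(\<lambda>I. s (I i) N) \<in> borel_measurable (nu n \<rho>)" if "i \<in> {1..n}" for i N
    unfolding s_def using nu_component[OF that] by (intro borel_measurable_divide borel_measurable_sum) auto
  have 1: "{I \<in> space (nu n \<rho>). \<forall>i\<in>{1..n}. \<forall>k. 0 \<le> I i k} \<in> sets (nu n \<rho>)"
    by (intro sets.sets_Collect_finite_All sets.sets_Collect_countable_All borel_measurable_le nu_component) auto
  have 2: "{I \<in> space (nu n \<rho>). ?P I i} \<in> sets (nu n \<rho>)"
    if "i \<in> {2..n}" for i
  proof -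
    have [measurable]: "(\<lambda>I. s (I i) N) \<in> borel_measurable (nu n \<rho>)" "(\<lambda>I. s (I (i - 1)) N) \<in> borel_measurable (nu n \<rho>)" for N
      using that by (auto intro!: sm)
    have [measurable]: "(\<lambda>I. lim (s (I i))) \<in> borel_measurable (nu n \<rho>)" "(\<lambda>I. lim (s (I (i - 1)))) \<in> borel_measurable (nu n \<rho>)"
      by (rule borel_measurable_lim_metric, measurable)+
    have C: "{I \<in> space (nu n \<rho>). Cauchy (s (I j))} \<in> sets (nu n \<rho>)" if "j \<in> {1..n}" for j
      by (rule sets_Collect_Cauchy) (rule sm[OF that])
    have [measurable]: "{I \<in> space (nu n \<rho>). Cauchy (s (I i))} \<in> sets (nu n \<rho>)"
      "{I \<in> space (nu n \<rho>). Cauchy (s (I (i - 1)))} \<in> sets (nu n \<rho>)"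
      by (rule C, use that in auto)+
    show ?thesis by (intro sets.sets_Collect_conj) measurable
  qed
  have "{I \<in> space (nu n \<rho>). \<forall>i\<in>{2..n}. ?P I i} \<in> sets (nu n \<rho>)"
    using 2 by (intro sets.sets_Collect_finite_All) auto
  from sets.sets_Collect_conj[OF this 1] show ?thesis unfolding eq .
qed

lemma AE_good:
  assumes pos: "\<And>i. i \<in> {1..n} \<Longrightarrow> 0 < \<rho> i"
  shows "AE I in nu n \<rho>. good n \<rho> I"
proof -
  have "AE I in nu n \<rho>. has_avg (I i) (\<rho> i) \<and> (\<forall>k. 0 \<le> I i k)" if i: "i \<in> {1..n}" for i
  proof -
    have "AE x in line (\<rho> i). has_avg x (\<rho> i) \<and> (\<forall>k. 0 \<le> x k)"
      using line_has_avg[OF pos[OF i]] line_nonneg[OF pos[OF i]] by eventually_elim blast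
    then show ?thesis unfolding nu_eq
      using i pos by (intro AE_PiM_component prob_space_line) auto
  qed
  then have "AE I in nu n \<rho>. \<forall>i\<in>{1..n}. has_avg (I i) (\<rho> i) \<and> (\<forall>k. 0 \<le> I i k)"
    by (intro AE_finite_allI) auto
  then show ?thesis
    using AE_space by eventually_elim (auto simp: good_def nonneg_tuples_def space_nu PiE_iff)
qed

text \<open>The multi-queue map, redefined on a null set so that it takes values in \<open>X_space n\<close> everywhere.\<close>

definition Phi :: "nat \<Rightarrow> (nat \<Rightarrow> int \<Rightarrow> real) \<Rightarrow> nat \<Rightarrow> int \<Rightarrow> real" where
  "Phi n I = (if mqD n I \<in> X_space n then mqD n I else (\<lambda>i\<in>{1..n}. \<lambda>_. 1))"

lemma Phi_in_X_space:
  assumes "1 \<le> n"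
  shows "Phi n I \<in> X_space n"
proof -
  have "psum (\<lambda>_. 1) m = real_of_int m" for m
    by (subst psum_unique[where G="real_of_int"]) auto
  then have "has_avg (\<lambda>_. 1) 1"
    unfolding has_avg_def
    by (intro tendsto_eventually eventually_at_bot_linorderI[of "-1"]) simp
  then have "pos_lower (\<lambda>_. 1)" by (rule has_avg_pos_lower) simp
  then have "(\<lambda>i\<in>{1..n}. \<lambda>_. 1) \<in> X_space n"
    using assms by (auto simp: X_space_iff nonneg_tuples_def)
  then show ?thesis by (simp add: Phi_def)
qed

lemma Phi_measurable:
  assumes "1 \<le> n"
  shows "Phi n \<in> measurable (nu n \<rho>) (X_borel n)"
proof (rule measurable_restrict_space2)
  show "Phi n \<in> space (nu n \<rho>) \<rightarrow> X_space n" using Phi_in_X_space[OF assms] by simp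
  have "{I \<in> space (nu n \<rho>). mqD n I \<in> X_space n} \<in> sets (nu n \<rho>)"
    using measurable_sets[OF mqD_measurable X_space_sets] by (simp add: vimage_def Int_def conj_commute)
  then show "Phi n \<in> borel_measurable (nu n \<rho>)"
    unfolding Phi_def by (intro measurable_If mqD_measurable) auto
qed

lemma Phi_good:
  assumes "good n a I" "increasing_pos n a" "1 \<le> n"
  shows "Phi n I = mqD n I"
  using mqD_in_X_space[OF assms] by (simp add: Phi_def)

text \<open>\<open>good\<close> configurations have full measure and lie in
  \<open>Y_space n\<close>, and on them \<open>multi_queue_map\<close>, \<open>mqD\<close> and
  \<open>Phi\<close> agree. Afterwards the measure is the image of a product measure under one map
  defined everywhere.\<close>

lemma mu_eq:
  assumes n: "1 \<le> n" and \<rho>: "increasing_pos n \<rho>"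
  shows "mu n \<rho> = distr (nu n \<rho>) (X_borel n) (Phi n)"
proof (rule measure_eqI)
  let ?R = "restrict_space (nu n \<rho>) (Y_space n)"
  let ?D = "distr ?R borel (multi_queue_map n)"
  have mm: "multi_queue_map n \<in> borel_measurable ?R"
  proof (rule measurable_cong[THEN iffD1])
    show "mqD n \<in> borel_measurable ?R" by (intro measurable_restrict_space1 mqD_measurable)
    fix I assume "I \<in> space ?R"
    then have I: "I \<in> Y_space n" by (simp add: space_restrict_space)
    show "mqD n I = multi_queue_map n I"
    proof (cases "n = 1")
      case True
      then show ?thesis by (auto simp: mqD_def multi_queue_map_def)
    next
      case False
      then show ?thesis using Y_space_good[OF I] multi_queue_map_eq_mqD n by fastforce
    qed
  qed
  have sD: "sets (mu n \<rho>) = sets (X_borel n)"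
    unfolding mu_def by (intro sets_restrict_space_cong) simp
  then show "sets (mu n \<rho>) = sets (distr (nu n \<rho>) (X_borel n) (Phi n))" by simp
  fix A assume "A \<in> sets (mu n \<rho>)"
  then have A: "A \<in> sets (X_borel n)" using sD by simp
  then have A': "A \<subseteq> X_space n" "A \<in> sets borel"
    using sets_restrict_space_iff[of "X_space n" borel A] X_space_sets by auto
  have "emeasure (mu n \<rho>) A = emeasure ?D A"
    unfolding mu_def using A' X_space_sets by (intro emeasure_restrict_space) auto
  also have "\<dots> = emeasure ?R (multi_queue_map n -` A \<inter> space ?R)"
    by (rule emeasure_distr[OF mm A'(2)])
  also have "\<dots> = emeasure (nu n \<rho>) (multi_queue_map n -` A \<inter> space ?R)"
    by (intro emeasure_restrict_space Y_space_sets) (auto simp: space_restrict_space)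
  also have "\<dots> = emeasure (nu n \<rho>) (Phi n -` A \<inter> space (nu n \<rho>))"
  proof (rule emeasure_eq_AE)
    have pos: "0 < \<rho> i" if "i \<in> {1..n}" for i using \<rho> that by (simp add: increasing_pos_def)
    have ae: "AE I in nu n \<rho>. good n \<rho> I" by (rule AE_good) (rule pos)
    show "AE I in nu n \<rho>. I \<in> multi_queue_map n -` A \<inter> space ?R \<longleftrightarrow> I \<in> Phi n -` A \<inter> space (nu n \<rho>)"
      using ae AE_space
    proof eventually_elim
      case (elim I)
      then show ?case
        using multi_queue_map_eq_mqD[OF elim(1) \<rho>] Phi_good[OF elim(1) \<rho> n] good_Y_space[OF elim(1) \<rho>]
        by (auto simp: space_restrict_space)
    qed
    show "multi_queue_map n -` A \<inter> space ?R \<in> sets (nu n \<rho>)"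
      using measurable_sets[OF mm A'(2)] Y_space_sets
      by (simp add: sets_restrict_space_iff)
    show "Phi n -` A \<inter> space (nu n \<rho>) \<in> sets (nu n \<rho>)"
      by (rule measurable_sets[OF Phi_measurable[OF n] A])
  qed
  also have "\<dots> = emeasure (distr (nu n \<rho>) (X_borel n) (Phi n)) A"
    by (rule emeasure_distr[OF Phi_measurable[OF n] A, symmetric])
  finally show "emeasure (mu n \<rho>) A = emeasure (distr (nu n \<rho>) (X_borel n) (Phi n)) A" .
qed

section \<open>Ergodicity\<close>

lemma has_avg_shift:
  assumes "has_avg x a"
  shows "has_avg (\<lambda>k. x (k + l)) a"
proof -
  have "((\<lambda>m. psum x (m + l) / real_of_int (m + l) * (real_of_int (m + l) / real_of_int m) - psum x l / real_of_int m) \<longlongrightarrow> a * 1 - 0) at_bot"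
    using assms unfolding has_avg_def
    by (intro tendsto_diff tendsto_mult tendsto_shift_ratio tendsto_divide_int_at_bot filterlim_compose[OF _ filterlim_shift_at_bot])
  moreover have "\<forall>\<^sub>F m in at_bot. psum x (m + l) / real_of_int (m + l) * (real_of_int (m + l) / real_of_int m) - psum x l / real_of_int m
      = psum (\<lambda>k. x (k + l)) m / real_of_int m"
  proof (rule eventually_at_bot_linorderI)
    fix m assume "m \<le> - \<bar>l\<bar> - 1"
    then have "real_of_int (m + l) \<noteq> 0" by linarith
    then show "psum x (m + l) / real_of_int (m + l) * (real_of_int (m + l) / real_of_int m) - psum x l / real_of_int m
      = psum (\<lambda>k. x (k + l)) m / real_of_int m"
      by (simp add: psum_add diff_divide_distrib del: of_int_add)
  qed
  ultimately show ?thesis unfolding has_avg_def mult_1_right diff_zero by (rule Lim_transform_eventually)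
qed

lemma zdiff_shift:
  "zdiff (\<lambda>k. I (k + l)) (\<lambda>k. \<omega> (k + l)) m = zdiff I \<omega> (m + l) - (psum I l - psum \<omega> l)"
proof -
  have "m - 1 + l = m + l - 1" by simp
  then show ?thesis unfolding zdiff_def psum_add by (simp only: algebra_simps)
qed

text \<open>A translation changes the walk by a constant, so the maximiser moves along; the constant
  cancels in \<open>qD\<close>.\<close>

lemma rmax_shift:
  assumes "adm I \<omega>" "adm (\<lambda>k. I (k + l)) (\<lambda>k. \<omega> (k + l))"
  shows "rmax (\<lambda>k. I (k + l)) (\<lambda>k. \<omega> (k + l)) m = rmax I \<omega> (m + l) - (psum I l - psum \<omega> l)"
proof -
  obtain k where k: "k \<le> m + l" "rmax I \<omega> (m + l) = zdiff I \<omega> k" using rmax_max(1)[OF assms(1)] by blast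
  show ?thesis
  proof (rule rmax_eqI[OF assms(2)])
    show "k - l \<le> m" using k by simp
    show "zdiff (\<lambda>k. I (k + l)) (\<lambda>k. \<omega> (k + l)) (k - l) = rmax I \<omega> (m + l) - (psum I l - psum \<omega> l)"
      unfolding zdiff_shift using k by simp
    show "zdiff (\<lambda>k. I (k + l)) (\<lambda>k. \<omega> (k + l)) j \<le> rmax I \<omega> (m + l) - (psum I l - psum \<omega> l)" if "j \<le> m" for j
      unfolding zdiff_shift using rmax_max(2)[OF assms(1), of "j + l" "m + l"] that by simp
  qed
qed

lemma qD_shift:
  assumes "has_avg I b" "has_avg \<omega> a" "a < b"
  shows "qD (\<lambda>k. I (k + l)) (\<lambda>k. \<omega> (k + l)) = (\<lambda>k. qD I \<omega> (k + l))"
proof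
  fix m
  have "adm I \<omega>" "adm (\<lambda>k. I (k + l)) (\<lambda>k. \<omega> (k + l))"
    using assms by (auto intro: has_avg_adm has_avg_shift)
  note r = rmax_shift[OF this]
  have "m - 1 + l = m + l - 1" by simp
  then show "qD (\<lambda>k. I (k + l)) (\<lambda>k. \<omega> (k + l)) m = qD I \<omega> (m + l)"
    unfolding qD_def r by (simp only: algebra_simps)
qed

lemma tandem_shift:
  assumes "has_avg x b" "\<And>j. 1 \<le> j \<Longrightarrow> j \<le> m \<Longrightarrow> has_avg (I j) (a j) \<and> a j < b"
  shows "tandem (\<lambda>j k. I j (k + l)) (\<lambda>k. x (k + l)) m = (\<lambda>k. tandem I x m (k + l))"
  using assms
proof (induction m arbitrary: x)
  case (Suc m)
  have av: "has_avg (I (Suc m)) (a (Suc m))" "a (Suc m) < b" using Suc.prems(2)[of "Suc m"] by auto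
  have "has_avg (qD x (I (Suc m))) b" using Suc.prems(1) av by (auto intro: has_avg_queue)
  then show ?case using Suc.IH Suc.prems(2) by (simp add: qD_shift[OF Suc.prems(1) av])
qed simp

lemma nonneg_tuples_translate: "\<eta> \<in> nonneg_tuples n \<Longrightarrow> translate n l \<eta> \<in> nonneg_tuples n"
  by (auto simp: nonneg_tuples_def translate_def PiE_iff)

lemma good_translate:
  assumes "good n a I"
  shows "good n a (translate n l I)"
  using assms nonneg_tuples_translate[of I n l] by (auto simp: good_def translate_def intro: has_avg_shift)

lemma mqD_translate:
  assumes g: "good n a I" and a: "increasing_pos n a"
  shows "mqD n (translate n l I) = translate n l (mqD n I)"
proof
  fix i
  show "mqD n (translate n l I) i = translate n l (mqD n I) i"
  proof (cases "i \<in> {1..n}")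
    case True
    have "tandem (translate n l I) (translate n l I i) (i - 1) = tandem (\<lambda>j k. I j (k + l)) (\<lambda>k. I i (k + l)) (i - 1)"
      using True by (subst tandem_cong[where I'="\<lambda>j k. I j (k + l)"]) (auto simp: translate_def)
    also have "\<dots> = (\<lambda>k. tandem I (I i) (i - 1) (k + l))"
    proof (rule tandem_shift[where a=a and b="a i"])
      show "has_avg (I i) (a i)" using g True by (simp add: good_def)
      fix j assume j: "1 \<le> j" "j \<le> i - 1"
      then have "j \<in> {1..n}" "j < i" using True by auto
      then show "has_avg (I j) (a j) \<and> a j < a i"
        using g a True unfolding good_def increasing_pos_def strict_mono_on_def by blast
    qed
    finally show ?thesis using True by (simp add: mqD_def translate_def)
  next
    case False
    then show ?thesis by (simp only: mqD_def translate_def restrict_apply if_False)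
  qed
qed

lemma X_space_translate:
  assumes "\<eta> \<in> X_space n" "1 \<le> n"
  shows "translate n l \<eta> \<in> X_space n"
  unfolding X_space_iff
proof (intro conjI ballI allI)
  show "translate n l \<eta> \<in> nonneg_tuples n" using assms by (intro nonneg_tuples_translate) (simp add: X_space_iff)
  show "pos_lower (translate n l \<eta> 1)" using assms by (simp add: X_space_iff translate_def pos_lower_shift)
  fix i k assume "i \<in> {2..n}"
  then have "i \<in> {1..n}" "i - 1 \<in> {1..n}" "i \<in> {2..n}" by auto
  then show "translate n l \<eta> (i - 1) k \<le> translate n l \<eta> i k"
    using assms(1) unfolding translate_def X_space_iff by simp
qed

lemma space_X_borel: "space (X_borel n) = X_space n"
  by (simp add: space_restrict_space)

lemma translate_measurable:
  assumes "1 \<le> n"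
  shows "translate n l \<in> measurable (X_borel n) (X_borel n)"
proof (rule measurable_restrict_space2)
  show "translate n l \<in> space (X_borel n) \<rightarrow> X_space n"
    using X_space_translate[OF _ assms] by (auto simp: space_X_borel)
  show "translate n l \<in> borel_measurable (X_borel n)"
  proof (rule measurable_restrict_space1, rule measurable_into_tuples)
    fix i k
    show "(\<lambda>\<eta>. translate n l \<eta> i k) \<in> borel_measurable borel"
      by (cases "i \<in> {1..n}") (simp_all only: translate_def restrict_apply if_True if_False, measurable)
  qed
qed

lemma line_shift_measurable: "(\<lambda>x k. x (k + l)) \<in> measurable (line r) (line s)"
  by (rule measurable_into_line, rule line_component_measurable)

lemma nu_componentwise:
  assumes "\<And>i. i \<in> {1..n} \<Longrightarrow> prob_space (line (\<rho> i))"
    and f: "\<And>i. i \<in> {1..n} \<Longrightarrow> f i \<in> measurable (line (\<rho> i)) (line (\<rho>' i))"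
    and law: "\<And>i. i \<in> {1..n} \<Longrightarrow> distr (line (\<rho> i)) (line (\<rho>' i)) (f i) = line (\<rho>' i)"
  shows "(\<lambda>x. \<lambda>i\<in>{1..n}. f i (x i)) \<in> measurable (nu n \<rho>) (nu n \<rho>')"
    "distr (nu n \<rho>) (nu n \<rho>') (\<lambda>x. \<lambda>i\<in>{1..n}. f i (x i)) = nu n \<rho>'"
proof -
  have "(\<lambda>x. f i (x i)) \<in> measurable (nu n \<rho>) (line (\<rho>' i))" if i: "i \<in> {1..n}" for i
    unfolding nu_eq
    by (rule measurable_compose[OF measurable_component_singleton[OF i, where M="\<lambda>i. line (\<rho> i)"] f[OF i]])
  then show "(\<lambda>x. \<lambda>i\<in>{1..n}. f i (x i)) \<in> measurable (nu n \<rho>) (nu n \<rho>')"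
    unfolding nu_eq[of n \<rho>'] by (rule measurable_restrict)
  have "distr (nu n \<rho>) (nu n \<rho>') (\<lambda>x. \<lambda>i\<in>{1..n}. f i (x i)) = PiM {1..n} (\<lambda>i. distr (line (\<rho> i)) (line (\<rho>' i)) (f i))"
    unfolding nu_eq by (rule distr_PiM_componentwise[OF assms(1) f])
  also have "\<dots> = nu n \<rho>'" unfolding nu_eq by (intro PiM_cong refl law)
  finally show "distr (nu n \<rho>) (nu n \<rho>') (\<lambda>x. \<lambda>i\<in>{1..n}. f i (x i)) = nu n \<rho>'" .
qed

lemma nu_translate:
  assumes "\<And>i. i \<in> {1..n} \<Longrightarrow> 0 < \<rho> i"
  shows "translate n l \<in> measurable (nu n \<rho>) (nu n \<rho>)" "distr (nu n \<rho>) (nu n \<rho>) (translate n l) = nu n \<rho>"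
  using nu_componentwise[of n \<rho> "\<lambda>i x k. x (k + l)" \<rho>] assms
  unfolding translate_def[abs_def] by (blast intro: prob_space_line line_shift_measurable line_shift)+

lemma nu_mixing:
  assumes "\<And>i. i \<in> {1..n} \<Longrightarrow> 0 < \<rho> i"
  shows "mixing (nu n \<rho>) (\<lambda>N. translate n (int N))"
proof -
  have "mixing (nu n \<rho>) (\<lambda>N x. \<lambda>i\<in>{1..n}. (\<lambda>i N x k. x (k + int N)) i N (x i))"
    unfolding nu_eq
    by (rule PiM_mixing) (blast intro: prob_space_line assms line_shift_measurable line_shift PiM_shift_mixing prob_space_expm)+
  then show ?thesis by (simp add: translate_def[abs_def])
qed

lemma mu_ergodic:
  assumes n: "1 \<le> n" and \<rho>: "increasing_pos n \<rho>"
  shows "translation_ergodic n (mu n \<rho>)"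
proof -
  let ?Q = "distr (nu n \<rho>) (X_borel n) (Phi n)"
  have pos: "0 < \<rho> i" if "i \<in> {1..n}" for i using \<rho> that by (simp add: increasing_pos_def)
  interpret prob_space "nu n \<rho>" by (rule prob_space_nu) (rule pos)
  note Pm = Phi_measurable[OF n, of \<rho>]
  have ae: "AE I in nu n \<rho>. good n \<rho> I" by (rule AE_good) (rule pos)
  \<comment> \<open>Off the \<open>good\<close> configurations the running maxima carry no meaning,
    so laws and invariant events are compared up to null sets.\<close>
  have equiv: "AE I in nu n \<rho>. translate n l (Phi n I) = Phi n (translate n l I)" for l
    using ae
  proof eventually_elim
    case (elim I)
    then show ?case using Phi_good[OF elim \<rho> n] Phi_good[OF good_translate[OF elim] \<rho> n] mqD_translate[OF elim \<rho>] by simp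
  qed
  note tm = translate_measurable[OF n]
  have tn: "translate n l \<in> measurable (nu n \<rho>) (nu n \<rho>)" "distr (nu n \<rho>) (nu n \<rho>) (translate n l) = nu n \<rho>" for l
    using nu_translate[of n \<rho> l] pos by auto
  show ?thesis unfolding translation_ergodic_def mu_eq[OF n \<rho>]
  proof (intro conjI allI ballI impI)
    show "prob_space ?Q" by (rule prob_space_distr[OF Pm])
    show "sets ?Q = sets (X_borel n)" by simp
    fix l
    have "distr ?Q (X_borel n) (translate n l) = distr (nu n \<rho>) (X_borel n) (translate n l \<circ> Phi n)"
      by (rule distr_distr[OF tm Pm])
    also have "\<dots> = distr (nu n \<rho>) (X_borel n) (Phi n \<circ> translate n l)"
      using equiv[of l] by (intro distr_cong_AE measurable_comp[OF Pm tm] measurable_comp[OF tn(1) Pm]) auto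
    also have "\<dots> = distr (distr (nu n \<rho>) (nu n \<rho>) (translate n l)) (X_borel n) (Phi n)"
      by (rule distr_distr[OF Pm tn(1), symmetric])
    finally show "distr ?Q (X_borel n) (translate n l) = ?Q"
      by (simp add: tn(2))
  next
    fix A assume A: "A \<in> sets (X_borel n)" and inv: "\<forall>l. translate n l -` A \<inter> X_space n = A"
    let ?A = "Phi n -` A \<inter> space (nu n \<rho>)"
    have "measure (nu n \<rho>) ?A \<in> {0, 1}"
    proof (rule mixing_invariant[OF prob_space_axioms])
      show "mixing (nu n \<rho>) (\<lambda>N. translate n (int N))" by (rule nu_mixing) (rule pos)
      show "?A \<in> sets (nu n \<rho>)" by (rule measurable_sets[OF Pm A])
      show "translate n (int N) \<in> measurable (nu n \<rho>) (nu n \<rho>)" for N by (rule tn(1))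
      show "AE I in nu n \<rho>. translate n (int N) I \<in> ?A \<longleftrightarrow> I \<in> ?A" for N
        using equiv[of "int N"] AE_space
      proof eventually_elim
        case (elim I)
        have "translate n (int N) I \<in> space (nu n \<rho>)" using tn(1) elim(2) by (rule measurable_space)
        moreover have "Phi n I \<in> A \<longleftrightarrow> translate n (int N) (Phi n I) \<in> A"
          using inv Phi_in_X_space[OF n, of I] by blast
        ultimately show ?case using elim by simp
      qed
    qed
    then show "measure ?Q A \<in> {0, 1}"
      by (simp add: measure_distr[OF Pm A])
  qed
qed

section \<open>Continuity\<close>

lemma tandem_cavg:
  assumes "cavg F x x' b" "\<And>j. 1 \<le> j \<Longrightarrow> j \<le> m \<Longrightarrow> cavg F (\<lambda>r. I r j) (I' j) (a j) \<and> a j < b"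
  shows "cavg F (\<lambda>r. tandem (I r) (x r) m) (tandem I' x' m) b"
  using assms
proof (induction m arbitrary: x x')
  case (Suc m)
  have "cavg F (\<lambda>r. I r (Suc m)) (I' (Suc m)) (a (Suc m))" "a (Suc m) < b" using Suc.prems(2)[of "Suc m"] by auto
  then have "cavg F (\<lambda>r. qD (x r) (I r (Suc m))) (qD x' (I' (Suc m))) b"
    by (intro cavg_qD[OF Suc.prems(1)])
  from Suc.IH[OF this] Suc.prems(2) show ?case by simp
qed simp

lemma psum_scale: "psum (\<lambda>k. c * x k) m = c * psum x m"
  by (simp add: psum_def sum_distrib_left right_diff_distrib)

lemma has_avg_scale: "has_avg x a \<Longrightarrow> has_avg (\<lambda>k. c * x k) (c * a)"
  unfolding has_avg_def psum_scale times_divide_eq_right[symmetric] by (rule tendsto_mult_left)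

text \<open>Uniformity comes for free: the quotient is a function of \<open>r\<close> times a
  function of \<open>m\<close>, the averages of the single sequence \<open>x\<close>. This is what
  the coupling by scaling is for.\<close>

lemma cavg_scale:
  assumes "has_avg x 1" "(c \<longlongrightarrow> d) F"
  shows "cavg F (\<lambda>r k. c r * x k) (\<lambda>k. d * x k) d"
proof -
  have "((\<lambda>p. c (fst p) * (psum x (snd p) / real_of_int (snd p))) \<longlongrightarrow> d * 1) (F \<times>\<^sub>F at_bot)"
    using assms unfolding has_avg_def
    by (intro tendsto_mult filterlim_compose[OF _ filterlim_fst] filterlim_compose[OF _ filterlim_snd])
  then have "uavg F (\<lambda>r k. c r * x k) d"
    by (simp add: uavg_def psum_scale case_prod_unfold)
  moreover have "has_avg (\<lambda>k. d * x k) d" using has_avg_scale[OF assms(1), of d] by simp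
  ultimately show ?thesis using assms(2) by (auto simp: cavg_def intro!: tendsto_intros)
qed

lemma tendsto_fun:
  fixes f :: "'r \<Rightarrow> 'i \<Rightarrow> 'a::topological_space"
  assumes "\<And>i. ((\<lambda>r. f r i) \<longlongrightarrow> l i) F"
  shows "(f \<longlongrightarrow> l) F"
proof -
  have "limitin (product_topology (\<lambda>_. euclidean) UNIV) f l F"
    using assms by (simp add: limitin_componentwise)
  then show ?thesis by (simp add: euclidean_product_topology)
qed

definition scale_tuple :: "nat \<Rightarrow> (nat \<Rightarrow> real) \<Rightarrow> (nat \<Rightarrow> int \<Rightarrow> real) \<Rightarrow> nat \<Rightarrow> int \<Rightarrow> real" where
  "scale_tuple n \<rho> e = (\<lambda>i\<in>{1..n}. \<lambda>k. \<rho> i * e i k)"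

lemma nu_scale:
  assumes "\<And>i. i \<in> {1..n} \<Longrightarrow> 0 < \<rho> i"
  shows "scale_tuple n \<rho> \<in> measurable (nu n (\<lambda>_. 1)) (nu n \<rho>)"
    "distr (nu n (\<lambda>_. 1)) (nu n \<rho>) (scale_tuple n \<rho>) = nu n \<rho>"
proof -
  have "(\<lambda>x k. c * x k) \<in> measurable (line 1) (line r)" for c r
    by (rule measurable_into_line, rule borel_measurable_times[OF borel_measurable_const line_component_measurable])
  note * = nu_componentwise[of n "\<lambda>_. 1" "\<lambda>i x k. \<rho> i * x k" \<rho>, OF prob_space_line[OF zero_less_one] this line_scale[OF assms]]
  show "scale_tuple n \<rho> \<in> measurable (nu n (\<lambda>_. 1)) (nu n \<rho>)"
    "distr (nu n (\<lambda>_. 1)) (nu n \<rho>) (scale_tuple n \<rho>) = nu n \<rho>"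
    using * unfolding scale_tuple_def[abs_def] by blast+
qed

lemma good_scale:
  assumes "good n (\<lambda>_. 1) e" "\<And>i. i \<in> {1..n} \<Longrightarrow> 0 < \<rho> i"
  shows "good n \<rho> (scale_tuple n \<rho> e)"
  unfolding good_def
proof
  show "scale_tuple n \<rho> e \<in> nonneg_tuples n"
    using assms unfolding good_def nonneg_tuples_def scale_tuple_def PiE_iff by (auto simp: less_imp_le)
  show "\<forall>i\<in>{1..n}. has_avg (scale_tuple n \<rho> e i) (\<rho> i)"
    using assms(1) has_avg_scale[of "e i" 1 "\<rho> i" for i] by (auto simp: good_def scale_tuple_def)
qed

lemma mqD_scale_tendsto:
  assumes e: "good n (\<lambda>_. 1) e" and \<rho>: "increasing_pos n \<rho>" and lim: "\<And>i. ((\<lambda>r. \<rho>s r i) \<longlongrightarrow> \<rho> i) F"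
  shows "((\<lambda>r. mqD n (scale_tuple n (\<rho>s r) e)) \<longlongrightarrow> mqD n (scale_tuple n \<rho> e)) F"
proof (intro tendsto_fun)
  fix i k
  show "((\<lambda>r. mqD n (scale_tuple n (\<rho>s r) e) i k) \<longlongrightarrow> mqD n (scale_tuple n \<rho> e) i k) F"
  proof (cases "i \<in> {1..n}")
    case True
    have c: "cavg F (\<lambda>r. scale_tuple n (\<rho>s r) e j) (scale_tuple n \<rho> e j) (\<rho> j)" if "j \<in> {1..n}" for j
      using that e lim by (simp add: scale_tuple_def good_def cavg_scale)
    have "cavg F (\<lambda>r. tandem (scale_tuple n (\<rho>s r) e) (scale_tuple n (\<rho>s r) e i) (i - 1))
        (tandem (scale_tuple n \<rho> e) (scale_tuple n \<rho> e i) (i - 1)) (\<rho> i)"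
    proof (rule tandem_cavg[where a=\<rho>])
      show "cavg F (\<lambda>r. scale_tuple n (\<rho>s r) e i) (scale_tuple n \<rho> e i) (\<rho> i)" using True by (rule c)
      fix j assume "1 \<le> j" "j \<le> i - 1"
      then have j: "j \<in> {1..n}" "j < i" using True by auto
      then have "\<rho> j < \<rho> i" using \<rho> True unfolding increasing_pos_def strict_mono_on_def by blast
      with c[OF j(1)] show "cavg F (\<lambda>r. scale_tuple n (\<rho>s r) e j) (scale_tuple n \<rho> e j) (\<rho> j) \<and> \<rho> j < \<rho> i" by blast
    qed
    with True show ?thesis by (simp add: mqD_def cavg_def)
  next
    case False
    then show ?thesis by (simp only: mqD_def restrict_apply if_False tendsto_const)
  qed
qed

lemma mu_integral_scale:
  assumes n: "1 \<le> n" and \<rho>: "increasing_pos n \<rho>" and f: "f \<in> borel_measurable (X_borel n)"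
  shows "(\<lambda>e. f (Phi n (scale_tuple n \<rho> e))) \<in> borel_measurable (nu n (\<lambda>_. 1))"
    "(\<integral>\<eta>. f \<eta> \<partial>mu n \<rho>) = (\<integral>e. (f (Phi n (scale_tuple n \<rho> e)) :: real) \<partial>nu n (\<lambda>_. 1))"
proof -
  have pos: "0 < \<rho> i" if "i \<in> {1..n}" for i using \<rho> that by (simp add: increasing_pos_def)
  have s: "scale_tuple n \<rho> \<in> measurable (nu n (\<lambda>_. 1)) (nu n \<rho>)"
    "distr (nu n (\<lambda>_. 1)) (nu n \<rho>) (scale_tuple n \<rho>) = nu n \<rho>"
    using nu_scale[of n \<rho>] pos by auto
  have fP: "(\<lambda>I. f (Phi n I)) \<in> borel_measurable (nu n \<rho>)"
    by (rule measurable_compose[OF Phi_measurable[OF n] f])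
  show "(\<lambda>e. f (Phi n (scale_tuple n \<rho> e))) \<in> borel_measurable (nu n (\<lambda>_. 1))"
    by (rule measurable_compose[OF s(1) fP])
  have "(\<integral>\<eta>. f \<eta> \<partial>mu n \<rho>) = (\<integral>I. f (Phi n I) \<partial>nu n \<rho>)"
    unfolding mu_eq[OF n \<rho>] by (rule integral_distr[OF Phi_measurable[OF n] f])
  also have "\<dots> = (\<integral>I. f (Phi n I) \<partial>distr (nu n (\<lambda>_. 1)) (nu n \<rho>) (scale_tuple n \<rho>))" by (simp add: s(2))
  also have "\<dots> = (\<integral>e. f (Phi n (scale_tuple n \<rho> e)) \<partial>nu n (\<lambda>_. 1))" by (rule integral_distr[OF s(1) fP])
  finally show "(\<integral>\<eta>. f \<eta> \<partial>mu n \<rho>) = (\<integral>e. f (Phi n (scale_tuple n \<rho> e)) \<partial>nu n (\<lambda>_. 1))" .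
qed

lemma mu_continuous:
  assumes n: "1 \<le> n"
  shows "weakly_continuous_on (increasing_means n) (X_space n) (mu n)"
  unfolding weakly_continuous_on_def
proof (intro allI impI, elim conjE)
  fix f :: "(nat \<Rightarrow> int \<Rightarrow> real) \<Rightarrow> real" assume fc: "continuous_on (X_space n) f" and "bounded (f ` X_space n)"
  then obtain B where B: "\<And>\<eta>. \<eta> \<in> X_space n \<Longrightarrow> \<bar>f \<eta>\<bar> \<le> B" by (auto simp: bounded_iff)
  have f: "f \<in> borel_measurable (X_borel n)" by (rule borel_measurable_continuous_on_restrict[OF fc])
  let ?N = "nu n (\<lambda>_. 1)"
  interpret prob_space ?N by (rule prob_space_nu) simp
  have ae: "AE e in ?N. good n (\<lambda>_. 1) e" by (rule AE_good) simp
  show "continuous_on (increasing_means n) (\<lambda>\<rho>. \<integral>\<eta>. f \<eta> \<partial>mu n \<rho>)"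
    \<comment> \<open>Sequences suffice in this countable product of parameters, and dominated
      convergence is a statement about sequences.\<close>
    unfolding continuous_on_sequentially comp_def
  proof (intro allI ballI impI, elim conjE)
    fix \<rho>s :: "nat \<Rightarrow> nat \<Rightarrow> real" and \<rho>
    assume "\<rho> \<in> increasing_means n" "\<forall>r. \<rho>s r \<in> increasing_means n" and lim: "\<rho>s \<longlonglongrightarrow> \<rho>"
    then have \<rho>: "increasing_pos n \<rho>" and \<rho>s: "\<And>r. increasing_pos n (\<rho>s r)" by (auto simp: increasing_means_iff)
    have limi: "(\<lambda>r. \<rho>s r i) \<longlonglongrightarrow> \<rho> i" for i
      by (rule continuous_on_tendsto_compose[OF continuous_on_product_coordinates lim]) auto
    have "(\<lambda>r. \<integral>e. f (Phi n (scale_tuple n (\<rho>s r) e)) \<partial>?N) \<longlonglongrightarrow> (\<integral>e. f (Phi n (scale_tuple n \<rho> e)) \<partial>?N)"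
    proof (rule integral_dominated_convergence[where w="\<lambda>_. B"])
      show "(\<lambda>e. f (Phi n (scale_tuple n \<rho> e))) \<in> borel_measurable ?N"
        "(\<lambda>e. f (Phi n (scale_tuple n (\<rho>s r) e))) \<in> borel_measurable ?N" for r
        by (rule mu_integral_scale(1)[OF n _ f], rule \<rho> \<rho>s)+
      show "integrable ?N (\<lambda>_. B)" by simp
      show "AE e in ?N. norm (f (Phi n (scale_tuple n (\<rho>s r) e))) \<le> B" for r
        using B[OF Phi_in_X_space[OF n]] by simp
      show "AE e in ?N. (\<lambda>r. f (Phi n (scale_tuple n (\<rho>s r) e))) \<longlonglongrightarrow> f (Phi n (scale_tuple n \<rho> e))"
        using ae
      proof eventually_elim
        case (elim e)
        have P: "Phi n (scale_tuple n \<rho>' e) = mqD n (scale_tuple n \<rho>' e)" if "increasing_pos n \<rho>'" for \<rho>'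
          using that by (intro Phi_good[OF good_scale[OF elim] that n]) (simp add: increasing_pos_def)
        have "(\<lambda>r. Phi n (scale_tuple n (\<rho>s r) e)) \<longlonglongrightarrow> Phi n (scale_tuple n \<rho> e)"
          unfolding P[OF \<rho>] P[OF \<rho>s] by (rule mqD_scale_tendsto[OF elim \<rho> limi])
        \<comment> \<open>\<open>f\<close> is continuous on \<open>X_space n\<close>, and the values
          of \<open>Phi\<close> lie there for every \<open>e\<close>.\<close>
        then show ?case
          by (rule continuous_on_tendsto_compose[OF fc]) (simp_all add: Phi_in_X_space[OF n])
      qed
    qed
    then show "(\<lambda>r. \<integral>\<eta>. f \<eta> \<partial>mu n (\<rho>s r)) \<longlonglongrightarrow> (\<integral>\<eta>. f \<eta> \<partial>mu n \<rho>)"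
      unfolding mu_integral_scale(2)[OF n \<rho> f] mu_integral_scale(2)[OF n \<rho>s f] .
  qed
qed

section \<open>Consistency\<close>

definition swap_lines :: "nat \<Rightarrow> nat \<Rightarrow> (nat \<Rightarrow> int \<Rightarrow> real) \<Rightarrow> nat \<Rightarrow> int \<Rightarrow> real" where
  "swap_lines n j I = (\<lambda>i\<in>{1..n}. if i = j then qD (I (j + 1)) (I j) else if i = j + 1 then qR (I (j + 1)) (I j) else I i)"

text \<open>Servers met before the pair are the same on both sides, so the induction goes down to
  \<open>m = j + 1\<close>; there \<open>qD_interchange\<close> treats the pair, and the later
  servers coincide again. Its admissibility conditions follow from averages: \<open>qR\<close> has
  average \<open>a j\<close> and \<open>qD\<close> has \<open>a (j + 1)\<close>, both below
  \<open>b\<close>.\<close>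

lemma tandem_swap_lines:
  assumes j: "1 \<le> j" and m: "j + 1 \<le> m" "m \<le> n" and x: "has_avg x b"
    and av: "\<And>l. 1 \<le> l \<Longrightarrow> l \<le> m \<Longrightarrow> has_avg (I l) (a l) \<and> a l < b" and less: "a j < a (j + 1)"
  shows "tandem I x m = tandem (swap_lines n j I) x m"
  using m x av
proof (induction m arbitrary: x rule: dec_induct)
  case base
  obtain j' where j': "j = Suc j'" using j by (cases j) auto
  let ?S = "swap_lines n j I"
  have S: "?S (Suc j) = qR (I (Suc j)) (I j)" "?S j = qD (I (Suc j)) (I j)" "\<And>l. 1 \<le> l \<Longrightarrow> l < j \<Longrightarrow> ?S l = I l"
    using j base(1) by (auto simp: swap_lines_def)
  have A: "has_avg (I (Suc j)) (a (Suc j))" "a (Suc j) < b" and C: "has_avg (I j) (a j)" "a j < b"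
    using base.prems(3)[of "Suc j"] base.prems(3)[of j] j by auto
  have AC: "a j < a (Suc j)" using less by simp
  note q1 = has_avg_queue[OF A(1) C(1) AC] and q2 = has_avg_queue(1)[OF base.prems(2) A]
  note q3 = has_avg_queue(1)[OF base.prems(2) q1(2) C(2)]
  have "qD (qD x (I (Suc j))) (I j) = qD (qD x (?S (Suc j))) (?S j)"
    unfolding S(1,2)
    by (rule qD_interchange[OF has_avg_adm[OF A(1) C(1) AC] has_avg_adm[OF base.prems(2) A]
          has_avg_adm[OF q2 C] has_avg_adm[OF base.prems(2) q1(2) C(2)] has_avg_adm[OF q3 q1(1) A(2)]])
  moreover have "tandem I y j' = tandem ?S y j'" for y
    using S(3) by (intro tandem_cong) (auto simp: j')
  ultimately show ?case unfolding j' by simp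
next
  case (step m)
  have "has_avg (I (Suc m)) (a (Suc m))" "a (Suc m) < b" using step.prems(3)[of "Suc m"] by auto
  then have "has_avg (qD x (I (Suc m))) b" by (rule has_avg_queue(1)[OF step.prems(2)])
  moreover have "swap_lines n j I (Suc m) = I (Suc m)" using step by (auto simp: swap_lines_def)
  ultimately show ?case using step.IH step.prems by simp
qed

text \<open>On the right, line \<open>j + 1\<close> arrives with average \<open>\<rho> j\<close> at
  server \<open>j\<close> of larger average \<open>\<rho> (j + 1)\<close>, an unstable queue; its
  output is the one deleted there. The order of \<open>\<rho>\<close> is asked away from
  \<open>j\<close> because earlier exchanges leave the mean to be deleted out of order.\<close>

lemma delete_coord_swap:
  assumes j: "1 \<le> j" "j < n" and av: "\<And>i. i \<in> {1..n} \<Longrightarrow> has_avg (I i) (\<rho> i)"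
    and inc: "strict_mono_on ({1..n} - {j}) \<rho>" and low: "\<And>i. j < i \<Longrightarrow> i \<le> n \<Longrightarrow> \<rho> j < \<rho> i"
  shows "delete_coord n j (mqD n I) = delete_coord n (j + 1) (mqD n (swap_lines n j I))"
proof
  fix i
  let ?S = "swap_lines n j I"
  consider "i \<notin> {1..n - 1}" | "1 \<le> i" "i < j" | "i = j" | "j < i" "i \<le> n - 1" by force
  then show "delete_coord n j (mqD n I) i = delete_coord n (j + 1) (mqD n ?S) i"
  proof cases
    case 1
    then show ?thesis by (simp only: delete_coord_def restrict_apply if_False)
  next
    case 2
    then have "tandem I (I i) (i - 1) = tandem ?S (?S i) (i - 1)"
      using j by (subst tandem_cong[where I'="?S"]) (auto simp: swap_lines_def)
    then show ?thesis using 2 j by (simp add: delete_coord_def mqD_def)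
  next
    case 3
    obtain j' where j': "j = Suc j'" using j by (cases j) auto
    \<comment> \<open>Line \<open>j + 1\<close> meets server \<open>j\<close> first, and its
      departures are the new line \<open>j\<close>.\<close>
    have "tandem I (I (j + 1)) j = tandem I (qD (I (j + 1)) (I j)) j'" by (simp add: j')
    also have "\<dots> = tandem ?S (?S j) j'"
      using j by (subst tandem_cong[where I'="?S"]) (auto simp: swap_lines_def j')
    finally show ?thesis using 3 j by (simp add: delete_coord_def mqD_def j')
  next
    case 4
    \<comment> \<open>After the deletion position \<open>i\<close> shows output
      \<open>i + 1\<close>, whose servers include the exchanged pair.\<close>
    have "tandem I (I (i + 1)) i = tandem ?S (I (i + 1)) i"
    proof (rule tandem_swap_lines[where b="\<rho> (i + 1)" and a=\<rho>])
      show "has_avg (I (i + 1)) (\<rho> (i + 1))" using 4 by (intro av) auto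
      show "\<rho> j < \<rho> (j + 1)" using j by (intro low) auto
      fix l assume l: "1 \<le> l" "l \<le> i"
      have "\<rho> l < \<rho> (i + 1)"
      proof (cases "l = j")
        case True
        then show ?thesis using 4 by (auto intro: low)
      next
        case False
        then have "l \<in> {1..n} - {j}" "i + 1 \<in> {1..n} - {j}" "l < i + 1" using l 4 by auto
        then show ?thesis using inc unfolding strict_mono_on_def by blast
      qed
      then show "has_avg (I l) (\<rho> l) \<and> \<rho> l < \<rho> (i + 1)" using l 4 by (auto intro!: av)
    qed (use 4 j in auto)
    moreover have "?S (i + 1) = I (i + 1)" using 4 by (auto simp: swap_lines_def)
    ultimately show ?thesis using 4 j by (simp add: delete_coord_def mqD_def)
  qed
qed

lemma delete_mqD_measurable: "(\<lambda>I. delete_coord n j (mqD n I)) \<in> borel_measurable (nu n \<rho>)"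
proof (rule measurable_into_tuples)
  fix i k
  have m: "(\<lambda>I. mqD n I l k) \<in> borel_measurable (nu n \<rho>)" for l
    by (rule measurable_compose[OF mqD_measurable tuple_component])
  show "(\<lambda>I. delete_coord n j (mqD n I) i k) \<in> borel_measurable (nu n \<rho>)"
    by (cases "i \<in> {1..n - 1}"; cases "i < j") (simp_all only: delete_coord_def restrict_apply if_True if_False m borel_measurable_const)
qed

text \<open>Moving the mean \<open>\<rho> j\<close> upwards past all larger means, one adjacent swap at a time, reduces the
  deletion of coordinate \<open>j\<close> to the deletion of the last coordinate. Hence \<open>\<rho>\<close> is here only required to be
  increasing away from \<open>j\<close>.\<close>

lemma delete_coord_law:
  assumes n: "2 \<le> n" and j: "1 \<le> j" "j \<le> n" and pos: "\<And>i. i \<in> {1..n} \<Longrightarrow> 0 < \<rho> i"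
    and inc: "strict_mono_on ({1..n} - {j}) \<rho>" and low: "\<And>i. j < i \<Longrightarrow> i \<le> n \<Longrightarrow> \<rho> j < \<rho> i"
  shows "distr (nu n \<rho>) borel (\<lambda>I. delete_coord n j (mqD n I)) = distr (nu (n - 1) (delete_coord n j \<rho>)) borel (mqD (n - 1))"
  using j(2,1) pos inc low
proof (induction j arbitrary: \<rho> rule: inc_induct)
  \<comment> \<open>No output before the last reads line \<open>n\<close>, and the first
    \<open>n - 1\<close> lines of \<open>nu n \<rho>\<close> have the law with the last mean
    dropped.\<close>
  case base
  let ?\<rho> = "delete_coord n n \<rho>"
  have pr: "prob_space (line (\<rho> i))" if "i \<in> {1..n}" for i using base.prems(2)[OF that] by (rule prob_space_line)
  have nu': "nu (n - 1) ?\<rho> = PiM {1..n - 1} (\<lambda>i. line (\<rho> i))"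
    unfolding nu_eq by (intro PiM_cong) (auto simp: delete_coord_def)
  have "distr (PiM {1..n} (\<lambda>i. line (\<rho> i))) (PiM {1..n - 1} (\<lambda>i. line (\<rho> i))) (\<lambda>\<omega>. \<lambda>i\<in>{1..n - 1}. \<omega> i) =
      PiM {1..n - 1} (\<lambda>i. line (\<rho> i))"
    using pr by (intro distr_PiM_reindex[where f="\<lambda>i. i"]) auto
  then have eq: "distr (nu n \<rho>) (nu (n - 1) ?\<rho>) (\<lambda>I. restrict I {1..n - 1}) = nu (n - 1) ?\<rho>"
    unfolding nu' unfolding nu_eq .
  have rm: "(\<lambda>I. restrict I {1..n - 1}) \<in> measurable (nu n \<rho>) (nu (n - 1) ?\<rho>)"
    unfolding nu' unfolding nu_eq by (rule measurable_restrict_subset) auto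
  have "distr (nu (n - 1) ?\<rho>) borel (mqD (n - 1)) =
      distr (distr (nu n \<rho>) (nu (n - 1) ?\<rho>) (\<lambda>I. restrict I {1..n - 1})) borel (mqD (n - 1))"
    unfolding eq ..
  also have "\<dots> = distr (nu n \<rho>) borel (mqD (n - 1) \<circ> (\<lambda>I. restrict I {1..n - 1}))"
    by (rule distr_distr[OF mqD_measurable rm])
  also have "mqD (n - 1) \<circ> (\<lambda>I. restrict I {1..n - 1}) = (\<lambda>I. delete_coord n n (mqD n I))"
  proof (intro ext)
    fix I i k
    have "tandem (restrict I {1..n - 1}) (I i) (i - 1) = tandem I (I i) (i - 1)" if "i \<in> {1..n - 1}"
      using that by (intro tandem_cong) auto
    then show "(mqD (n - 1) \<circ> (\<lambda>I. restrict I {1..n - 1})) I i k = delete_coord n n (mqD n I) i k"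
      by (auto simp: mqD_def delete_coord_def)
  qed
  finally show ?case by simp
next
  case (step j)
  let ?\<rho>' = "\<rho>(j := \<rho> (j + 1), j + 1 := \<rho> j)"
  have jn: "j \<in> {1..n}" "j + 1 \<in> {1..n}" "j \<noteq> j + 1" "\<rho> j < \<rho> (j + 1)"
    using step.hyps step.prems by auto
  have law: "distr (nu n \<rho>) (nu n ?\<rho>') (swap_lines n j) = nu n ?\<rho>'"
    unfolding nu_eq swap_lines_def[abs_def] using step.prems(2) jn by (intro PiM_line_swap) auto
  have Sm: "swap_lines n j \<in> measurable (nu n \<rho>) (nu n ?\<rho>')"
  proof (rule measurable_into_nu)
    fix i k assume i: "i \<in> {1..n}"
    show "(\<lambda>p. swap_lines n j p i k) \<in> borel_measurable (nu n \<rho>)"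
      using i jn nu_component
      by (cases "i = j"; cases "i = j + 1") (auto simp: swap_lines_def intro!: qD_measurable qR_measurable)
  qed (simp add: swap_lines_def)
  have ae: "AE I in nu n \<rho>. good n \<rho> I" by (rule AE_good) (rule step.prems(2))
  have "distr (nu n \<rho>) borel (\<lambda>I. delete_coord n j (mqD n I)) =
      distr (nu n \<rho>) borel ((\<lambda>I. delete_coord n (j + 1) (mqD n I)) \<circ> swap_lines n j)"
  proof (rule distr_cong_AE[OF refl refl])
    show "AE I in nu n \<rho>. delete_coord n j (mqD n I) = ((\<lambda>I. delete_coord n (j + 1) (mqD n I)) \<circ> swap_lines n j) I"
      using ae
    proof eventually_elim
      case (elim I)
      then show ?case unfolding comp_def
        using step.hyps step.prems by (intro delete_coord_swap) (auto simp: good_def)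
    qed
  qed (rule delete_mqD_measurable, rule measurable_comp[OF Sm delete_mqD_measurable])
  also have "\<dots> = distr (distr (nu n \<rho>) (nu n ?\<rho>') (swap_lines n j)) borel (\<lambda>I. delete_coord n (j + 1) (mqD n I))"
    by (rule distr_distr[OF delete_mqD_measurable Sm, symmetric])
  also have "\<dots> = distr (nu n ?\<rho>') borel (\<lambda>I. delete_coord n (j + 1) (mqD n I))" unfolding law ..
  also have "\<dots> = distr (nu (n - 1) (delete_coord n (j + 1) ?\<rho>')) borel (mqD (n - 1))"
    unfolding Suc_eq_plus1[symmetric]
  proof (rule step.IH)
    show "0 < (\<rho>(j := \<rho> (Suc j), Suc j := \<rho> j)) i" if "i \<in> {1..n}" for i
      using that jn step.prems(2) by auto
    show "(\<rho>(j := \<rho> (Suc j), Suc j := \<rho> j)) (Suc j) < (\<rho>(j := \<rho> (Suc j), Suc j := \<rho> j)) i" if "Suc j < i" "i \<le> n" for i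
      using that step.prems(4) by auto
    show "strict_mono_on ({1..n} - {Suc j}) (\<rho>(j := \<rho> (Suc j), Suc j := \<rho> j))"
    proof (rule strict_mono_onI)
      fix r s assume rs: "r \<in> {1..n} - {Suc j}" "s \<in> {1..n} - {Suc j}" "r < s"
      have mono: "\<rho> p < \<rho> q" if "p \<in> {1..n} - {j}" "q \<in> {1..n} - {j}" "p < q" for p q
        using step.prems(3) that unfolding strict_mono_on_def by blast
      show "(\<rho>(j := \<rho> (Suc j), Suc j := \<rho> j)) r < (\<rho>(j := \<rho> (Suc j), Suc j := \<rho> j)) s"
        using rs jn mono[of r s] mono[of "Suc j" s] mono[of r "Suc j"] by (cases "r = j"; cases "s = j") auto
    qed
  qed simp
  \<comment> \<open>\<open>\<rho> j\<close> now sits at position \<open>j + 1\<close>, so deleting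
    there leaves the same means.\<close>
  also have "delete_coord n (j + 1) ?\<rho>' = delete_coord n j \<rho>"
    using jn by (auto simp: delete_coord_def fun_eq_iff restrict_def less_Suc_eq)
  finally show ?case .
qed

lemma X_space_delete:
  assumes n: "2 \<le> n" and j: "j \<in> {1..n}" and \<eta>: "\<eta> \<in> X_space n"
  shows "delete_coord n j \<eta> \<in> X_space (n - 1)"
  unfolding X_space_iff
proof (intro conjI ballI allI)
  have mono: "\<eta> (i - 1) k \<le> \<eta> i k" if "i \<in> {2..n}" for i k using \<eta> that by (simp add: X_space_iff)
  show "delete_coord n j \<eta> \<in> nonneg_tuples (n - 1)"
    using \<eta> by (auto simp: X_space_iff nonneg_tuples_def delete_coord_def PiE_iff)
  have p1: "pos_lower (\<eta> 1)" using \<eta> by (simp add: X_space_iff)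
  \<comment> \<open>For \<open>j = 1\<close> the second line becomes the first; it dominates
    \<open>\<eta> 1\<close> and inherits the lower bound on the averages.\<close>
  have "\<eta> 1 k \<le> \<eta> (1 + 1) k" for k using mono[of "1 + 1" k] n by simp
  with p1 have p2: "pos_lower (\<eta> (1 + 1))" by (rule pos_lower_mono)
  have "delete_coord n j \<eta> 1 = (if 1 < j then \<eta> 1 else \<eta> (1 + 1))" using n by (auto simp: delete_coord_def)
  with p1 p2 show "pos_lower (delete_coord n j \<eta> 1)" by presburger
  fix i k assume i: "i \<in> {2..n - 1}"
  have "delete_coord n j \<eta> i = (if i < j then \<eta> i else \<eta> (i + 1))"
    "delete_coord n j \<eta> (i - 1) = (if i - 1 < j then \<eta> (i - 1) else \<eta> i)"
    using i by (auto simp: delete_coord_def)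
  moreover have "\<eta> (i - 1) k \<le> \<eta> i k" using i by (intro mono) auto
  moreover have "i + 1 \<in> {2..n}" using i by auto
  then have "\<eta> i k \<le> \<eta> (i + 1) k" using mono[of "i + 1" k] by simp
  ultimately show "delete_coord n j \<eta> (i - 1) k \<le> delete_coord n j \<eta> i k" by simp
qed

lemma delete_coord_measurable:
  assumes n: "2 \<le> n" and j: "j \<in> {1..n}"
  shows "delete_coord n j \<in> measurable (X_borel n) (X_borel (n - 1))"
proof (rule measurable_restrict_space2)
  show "delete_coord n j \<in> space (X_borel n) \<rightarrow> X_space (n - 1)"
    using X_space_delete[OF n j] by (auto simp: space_X_borel)
  show "delete_coord n j \<in> borel_measurable (X_borel n)"
  proof (rule measurable_restrict_space1, rule measurable_into_tuples)
    fix i k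
    show "(\<lambda>\<eta>::nat \<Rightarrow> int \<Rightarrow> real. delete_coord n j \<eta> i k) \<in> borel_measurable borel"
      by (cases "i \<in> {1..n - 1}"; cases "i < j")
        (simp_all only: delete_coord_def restrict_apply if_True if_False tuple_component borel_measurable_const)
  qed
qed

text \<open>\<open>delete_coord_law\<close> concerns \<open>mqD\<close> in the ambient space, since
  its induction passes through means that are not increasing. Both sides are transferred to
  \<open>Phi\<close>, which agrees with \<open>mqD\<close> almost surely for increasing
  means.\<close>

lemma mu_consistent:
  assumes n: "2 \<le> n" and \<rho>: "increasing_pos n \<rho>" and j: "j \<in> {1..n}"
  shows "distr (mu n \<rho>) (X_borel (n - 1)) (delete_coord n j) = mu (n - 1) (delete_coord n j \<rho>)"
proof -
  let ?\<rho> = "delete_coord n j \<rho>" and ?d = "\<lambda>I. delete_coord n j (mqD n I)"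
    and ?L = "distr (mu n \<rho>) (X_borel (n - 1)) (delete_coord n j)"
  let ?N = "nu (n - 1) ?\<rho>"
  have n1: "1 \<le> n" "1 \<le> n - 1" using n by auto
  have mono: "\<rho> p < \<rho> q" if "p \<in> {1..n}" "q \<in> {1..n}" "p < q" for p q
    using \<rho> that unfolding increasing_pos_def strict_mono_on_def by blast
  have pos: "0 < \<rho> i" if "i \<in> {1..n}" for i using \<rho> that by (simp add: increasing_pos_def)
  have \<rho>': "increasing_pos (n - 1) ?\<rho>"
    unfolding increasing_pos_def
  proof
    show "\<forall>i\<in>{1..n - 1}. 0 < ?\<rho> i" using pos by (auto simp: delete_coord_def)
    show "strict_mono_on {1..n - 1} ?\<rho>"
    proof (rule strict_mono_onI)
      fix r s assume "r \<in> {1..n - 1}" "s \<in> {1..n - 1}" "r < s"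
      then show "?\<rho> r < ?\<rho> s" by (auto simp: delete_coord_def intro!: mono)
    qed
  qed
  have pos': "0 < ?\<rho> i" if "i \<in> {1..n - 1}" for i using \<rho>' that by (simp add: increasing_pos_def)
  have ae: "AE I in nu n \<rho>. good n \<rho> I" by (rule AE_good) (rule pos)
  have ae': "AE I in ?N. good (n - 1) ?\<rho> I" by (rule AE_good) (rule pos')
  note dm = delete_coord_measurable[OF n j]
  note P = Phi_measurable[OF n1(1), of \<rho>] and P' = Phi_measurable[OF n1(2), of ?\<rho>]
  show ?thesis
  proof (rule measure_eqI)
    show "sets (?L) = sets (mu (n - 1) ?\<rho>)"
      unfolding mu_eq[OF n1(2) \<rho>'] sets_distr ..
    fix A assume "A \<in> sets (?L)"
    then have A: "A \<in> sets (X_borel (n - 1))" by simp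
    then have A': "A \<in> sets borel" using sets_restrict_space_iff[of "X_space (n - 1)" borel A] X_space_sets by auto
    have "emeasure (?L) A =
        emeasure (distr (nu n \<rho>) (X_borel (n - 1)) (delete_coord n j \<circ> Phi n)) A"
      unfolding mu_eq[OF n1(1) \<rho>] by (simp only: distr_distr[OF dm P])
    also have "\<dots> = emeasure (nu n \<rho>) ((delete_coord n j \<circ> Phi n) -` A \<inter> space (nu n \<rho>))"
      by (rule emeasure_distr[OF measurable_comp[OF P dm] A])
    also have "\<dots> = emeasure (nu n \<rho>) (?d -` A \<inter> space (nu n \<rho>))"
    proof (rule emeasure_eq_AE)
      show "AE I in nu n \<rho>. I \<in> (delete_coord n j \<circ> Phi n) -` A \<inter> space (nu n \<rho>) \<longleftrightarrow>
          I \<in> ?d -` A \<inter> space (nu n \<rho>)"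
        using ae by eventually_elim (simp add: Phi_good[OF _ \<rho> n1(1)])
    qed (rule measurable_sets[OF measurable_comp[OF P dm] A], rule measurable_sets[OF delete_mqD_measurable A'])
    also have "\<dots> = emeasure (distr (nu n \<rho>) borel ?d) A"
      by (rule emeasure_distr[OF delete_mqD_measurable A', symmetric])
    also have "\<dots> = emeasure (distr ?N borel (mqD (n - 1))) A"
    proof -
      have "strict_mono_on ({1..n} - {j}) \<rho>" by (rule strict_mono_onI) (auto intro: mono)
      then show ?thesis using j by (subst delete_coord_law[OF n]) (auto intro!: pos mono)
    qed
    also have "\<dots> = emeasure ?N (mqD (n - 1) -` A \<inter> space ?N)"
      by (rule emeasure_distr[OF mqD_measurable A'])
    also have "\<dots> = emeasure ?N (Phi (n - 1) -` A \<inter> space ?N)"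
    proof (rule emeasure_eq_AE)
      show "AE I in ?N. I \<in> mqD (n - 1) -` A \<inter> space ?N \<longleftrightarrow>
          I \<in> Phi (n - 1) -` A \<inter> space ?N"
        using ae'
      proof eventually_elim
        case (elim I)
        show ?case unfolding Int_iff vimage_eq Phi_good[OF elim \<rho>' n1(2)] ..
      qed
    qed (rule measurable_sets[OF mqD_measurable A'], rule measurable_sets[OF P' A])
    also have "\<dots> = emeasure (mu (n - 1) ?\<rho>) A"
      unfolding mu_eq[OF n1(2) \<rho>'] by (rule emeasure_distr[OF P' A, symmetric])
    finally show "emeasure (?L) A = emeasure (mu (n - 1) ?\<rho>) A" .
  qed
qed

theorem theorem3p1:
  fixes n :: nat
  assumes "n \<ge> 1"
  shows "(\<forall>\<rho>\<in>increasing_means n. translation_ergodic n (mu n \<rho>)) \<and>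
    weakly_continuous_on (increasing_means n) (X_space n) (mu n) \<and>
    (n \<ge> 2 \<longrightarrow> (\<forall>\<rho>\<in>increasing_means n. \<forall>j\<in>{1..n}.
       distr (mu n \<rho>) (X_borel (n - 1)) (delete_coord n j) = mu (n - 1) (delete_coord n j \<rho>)))"
proof (intro conjI ballI impI)
  fix \<rho> :: "nat \<Rightarrow> real" assume "\<rho> \<in> increasing_means n"
  then have \<rho>: "increasing_pos n \<rho>" by (simp add: increasing_means_iff)
  show "translation_ergodic n (mu n \<rho>)" by (rule mu_ergodic[OF assms \<rho>])
  fix j assume "2 \<le> n" "j \<in> {1..n}"
  then show "distr (mu n \<rho>) (X_borel (n - 1)) (delete_coord n j) = mu (n - 1) (delete_coord n j \<rho>)"
    using \<rho> by (intro mu_consistent)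
next
  show "weakly_continuous_on (increasing_means n) (X_space n) (mu n)" by (rule mu_continuous[OF assms])
qed

end
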